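(* Take a finite system of fermions and bosons on a lattice, evolving via the causal unitary $U_A$. Add a copy of the system and consider the evolution of the two copies via $U_AU_B^\dagger$, where $U_B$ is equivalent to $U_A$ but acts on the copy system. Then this evolution can be decomposed into local unitaries: $$U_AU_B^\dagger=\prod_{\vec k}S_{\vec k}\prod_{\vec n}\mathbb{S}_{\vec n}\prod_{\vec m}\left[U_BS_{\vec m}U_B^\dagger\right]\prod_{\vec l}\left[U_B\mathbb{S}_{\vec l}\,U_B^\dagger\right],$$ where $S_{\vec n}=\exp[i\frac{\pi}{2}(b_{\vec n}^\dagger-a_{\vec n}^\dagger)(b_{\vec n}-a_{\vec n})]$ and $\mathbb{S}_{\vec n}=\exp[i\frac{\pi}{2}(d_{\vec n}^\dagger-c_{\vec n}^\dagger)(d_{\vec n}-c_{\vec n})]$ are the on-site fermionic and bosonic swaps, and the $U_BS_{\vec n}U_B^\dagger$ and $U_B\mathbb{S}_{\vec n}U_B^\dagger$ are commuting local unitaries.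
   Context: The lattice has finitely many sites. Site $\vec n$ carries a fermionic mode with annihilation operator $a_{\vec n}$ and a bosonic mode with annihilation operator $c_{\vec n}$; the copy has fermionic annihilation operators $b_{\vec n}$ and bosonic annihilation operators $d_{\vec n}$ at the same sites. The $a$'s and $b$'s jointly satisfy canonical anticommutation relations, the $c$'s and $d$'s jointly satisfy canonical commutation relations, and bosonic operators commute with fermionic ones; fermions and bosons may interact. $U_B$ is $U_A$ with $a_{\vec n},c_{\vec n}$ replaced by $b_{\vec n},d_{\vec n}$. An operator is localized on a region if it can be built from creation and annihilation operators of modes at sites of that region only (for bosonic modes: it belongs to, or is affiliated with, the von Neumann algebra generated by the fermionic operators and the bosonic Weyl operators of the region). $U_A$ is causal if there is $L\ge0$ such that for each $\vec n$ the operators $U_A^\dagger a_{\vec n}U_A$ and $U_A^\dagger c_{\vec n}U_A$ are localized on sites $\vec m$ with $|\vec n-\vec m|<L$. As for all evolution operators of systems with fermions, $U_A$ is assumed to leave invariant any additional ancillary fermionic mode $e$ (anticommuting with the other fermionic operators): $U_A^\dagger eU_A=e$. Local means localized on sites within a distance fixed by $L$: $S_{\vec n},\mathbb{S}_{\vec n}$ on site $\vec n$, and $U_BS_{\vec n}U_B^\dagger$, $U_B\mathbb{S}_{\vec n}U_B^\dagger$ on sites $\vec k$ with $|\vec k-\vec n|<L$. *)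

theory Defs
  imports "HOL-Analysis.Analysis" "HOL-Combinatorics.Multiset_Permutations"
begin

section \<open>Complex Hilbert spaces and bounded operators\<close>

class complex_hilbert = banach +
  fixes scaleC :: "complex \<Rightarrow> 'a \<Rightarrow> 'a" (infixr "*\<^sub>C" 75)
    and cinner :: "'a \<Rightarrow> 'a \<Rightarrow> complex"
  assumes scaleC_of_real: "complex_of_real r *\<^sub>C x = r *\<^sub>R x"
    and scaleC_add_right: "z *\<^sub>C (x + y) = z *\<^sub>C x + z *\<^sub>C y"
    and scaleC_add_left: "(z + w) *\<^sub>C x = z *\<^sub>C x + w *\<^sub>C x"
    and scaleC_scaleC: "z *\<^sub>C w *\<^sub>C x = (z * w) *\<^sub>C x"
    and cinner_commute: "cinner y x = cnj (cinner x y)"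
    and cinner_add_right: "cinner x (y + y') = cinner x y + cinner x y'"
    and cinner_scaleC_right: "cinner x (z *\<^sub>C y) = z * cinner x y"
    and cinner_self: "cinner x x = complex_of_real ((norm x)\<^sup>2)"

definition bounded_clinear :: "('h::complex_hilbert \<Rightarrow> 'h) \<Rightarrow> bool" where
  "bounded_clinear X \<longleftrightarrow> bounded_linear X \<and> (\<forall>z x. X (z *\<^sub>C x) = z *\<^sub>C X x)"

definition adj :: "('h::complex_hilbert \<Rightarrow> 'h) \<Rightarrow> 'h \<Rightarrow> 'h" where
  "adj X = (THE Y. \<forall>x y. cinner (Y x) y = cinner x (X y))"

definition unitary :: "('h::complex_hilbert \<Rightarrow> 'h) \<Rightarrow> bool" where
  "unitary U \<longleftrightarrow> bounded_clinear U \<and> adj U \<circ> U = id \<and> U \<circ> adj U = id"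

definition op_prod :: "('i \<Rightarrow> 'h \<Rightarrow> 'h) \<Rightarrow> 'i list \<Rightarrow> 'h \<Rightarrow> 'h" where
  "op_prod F ns = foldr (\<circ>) (map F ns) id"


section \<open>Unbounded operators\<close>

text \<open>
  An unbounded operator is represented by its graph: \<open>(x, y) \<in> T\<close> says that \<open>x\<close> is in the
  domain of \<open>T\<close> and \<open>T x = y\<close>. Sums, products and scalar multiples carry their natural
  (maximal) domains. The closure of an operator is the topological closure of its graph.
\<close>

type_synonym 'h uop = "('h \<times> 'h) set"

definition graph :: "('h \<Rightarrow> 'h) \<Rightarrow> 'h uop" where
  "graph X = {(x, X x) | x. True}"

definition linear_operator :: "'h::complex_hilbert uop \<Rightarrow> bool" where
  "linear_operator T \<longleftrightarrow> single_valued T \<and>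
     (\<forall>x y x' y' z. (x, y) \<in> T \<longrightarrow> (x', y') \<in> T \<longrightarrow> (z *\<^sub>C x + x', z *\<^sub>C y + y') \<in> T)"

definition op_scale :: "complex \<Rightarrow> 'h::complex_hilbert uop \<Rightarrow> 'h uop" where
  "op_scale z T = {(x, z *\<^sub>C y) | x y. (x, y) \<in> T}"

definition op_plus :: "'h::complex_hilbert uop \<Rightarrow> 'h uop \<Rightarrow> 'h uop" where
  "op_plus S T = {(x, y + z) | x y z. (x, y) \<in> S \<and> (x, z) \<in> T}"

definition op_minus :: "'h::complex_hilbert uop \<Rightarrow> 'h uop \<Rightarrow> 'h uop" where
  "op_minus S T = {(x, y - z) | x y z. (x, y) \<in> S \<and> (x, z) \<in> T}"

definition op_comp :: "'h uop \<Rightarrow> 'h uop \<Rightarrow> 'h uop" where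
  "op_comp S T = {(x, z). \<exists>y. (x, y) \<in> T \<and> (y, z) \<in> S}"

definition commutator :: "'h::complex_hilbert uop \<Rightarrow> 'h uop \<Rightarrow> 'h uop" where
  "commutator S T = op_minus (op_comp S T) (op_comp T S)"

definition adjoint :: "'h::complex_hilbert uop \<Rightarrow> 'h uop" where
  "adjoint T = {(y, w). \<forall>x v. (x, v) \<in> T \<longrightarrow> cinner w x = cinner y v}"

text \<open>\<open>X T \<subseteq> T X\<close> for an everywhere defined operator \<open>X\<close>.\<close>

definition commutes_with :: "('h \<Rightarrow> 'h) \<Rightarrow> 'h uop \<Rightarrow> bool" where
  "commutes_with X T \<longleftrightarrow> (\<forall>x y. (x, y) \<in> T \<longrightarrow> (X x, X y) \<in> T)"

text \<open>\<open>U\<^sup>\<dagger> T U\<close> for a unitary \<open>U\<close>.\<close>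

definition conjugate :: "('h::complex_hilbert \<Rightarrow> 'h) \<Rightarrow> 'h uop \<Rightarrow> 'h uop" where
  "conjugate U T = {(adj U x, adj U y) | x y. (x, y) \<in> T}"

definition unitary_group :: "(real \<Rightarrow> 'h::complex_hilbert \<Rightarrow> 'h) \<Rightarrow> bool" where
  "unitary_group V \<longleftrightarrow> (\<forall>t. unitary (V t)) \<and> (\<forall>s t. V (s + t) = V s \<circ> V t) \<and>
     (\<forall>x. continuous_on UNIV (\<lambda>t. V t x))"

definition generator :: "(real \<Rightarrow> 'h::complex_hilbert \<Rightarrow> 'h) \<Rightarrow> 'h uop" where
  "generator V = {(x, y). ((\<lambda>t. V t x) has_vector_derivative \<i> *\<^sub>C y) (at 0)}"

text \<open>
  \<open>exp (i T)\<close> for an essentially self-adjoint \<open>T\<close>: by Stone's theorem there is exactly one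
  strongly continuous unitary group \<open>t \<mapsto> exp (i t T)\<close> whose generator is the closure of \<open>T\<close>.
\<close>

definition exp_i :: "'h::complex_hilbert uop \<Rightarrow> 'h \<Rightarrow> 'h" where
  "exp_i T = (THE U. \<exists>V. unitary_group V \<and> generator V = closure T \<and> U = V 1)"


section \<open>Von Neumann algebras\<close>

definition commutant :: "('h::complex_hilbert \<Rightarrow> 'h) set \<Rightarrow> ('h \<Rightarrow> 'h) set" where
  "commutant M = {X. bounded_clinear X \<and> (\<forall>Y\<in>M. X \<circ> Y = Y \<circ> X)}"

definition vN_generated :: "('h::complex_hilbert \<Rightarrow> 'h) set \<Rightarrow> ('h \<Rightarrow> 'h) set" where
  "vN_generated M = commutant (commutant (M \<union> adj ` M))"

text \<open>For a closed operator \<open>T\<close>: every unitary \<open>X\<close> in the commutant of \<open>M\<close> satisfies \<open>X T \<subseteq> T X\<close>.\<close>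

definition affiliated :: "'h::complex_hilbert uop \<Rightarrow> ('h \<Rightarrow> 'h) set \<Rightarrow> bool" where
  "affiliated T M \<longleftrightarrow> (\<forall>X\<in>commutant M. unitary X \<longrightarrow> commutes_with X T)"

definition star_isomorphism ::
  "(('h::complex_hilbert \<Rightarrow> 'h) \<Rightarrow> 'h \<Rightarrow> 'h) \<Rightarrow> ('h \<Rightarrow> 'h) set \<Rightarrow> ('h \<Rightarrow> 'h) set \<Rightarrow> bool" where
  "star_isomorphism \<Phi> M N \<longleftrightarrow> bij_betw \<Phi> M N \<and>
     (\<forall>X\<in>M. \<forall>Y\<in>M. \<Phi> (\<lambda>x. X x + Y x) = (\<lambda>x. \<Phi> X x + \<Phi> Y x) \<and> \<Phi> (X \<circ> Y) = \<Phi> X \<circ> \<Phi> Y) \<and>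
     (\<forall>X\<in>M. \<forall>z. \<Phi> (\<lambda>x. z *\<^sub>C X x) = (\<lambda>x. z *\<^sub>C \<Phi> X x)) \<and>
     (\<forall>X\<in>M. \<Phi> (adj X) = adj (\<Phi> X))"


section \<open>Fermionic and bosonic modes\<close>

definition CAR :: "'i set \<Rightarrow> ('i \<Rightarrow> 'h::complex_hilbert \<Rightarrow> 'h) \<Rightarrow> bool" where
  "CAR I f \<longleftrightarrow> (\<forall>i\<in>I. bounded_clinear (f i)) \<and>
     (\<forall>i\<in>I. \<forall>j\<in>I. \<forall>x. f i (f j x) + f j (f i x) = 0) \<and>
     (\<forall>i\<in>I. \<forall>j\<in>I. \<forall>x. f i (adj (f j) x) + adj (f j) (f i x) = (if i = j then x else 0))"

text \<open>
  Canonical commutation relations on \<open>D\<close>; this includes that \<open>D\<close> lies in the domains of all the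
  operator products involved.
\<close>

definition CCR_on :: "'h set \<Rightarrow> 'i set \<Rightarrow> ('i \<Rightarrow> 'h::complex_hilbert uop) \<Rightarrow> bool" where
  "CCR_on D I q \<longleftrightarrow> (\<forall>i\<in>I. \<forall>j\<in>I. \<forall>x\<in>D.
     (x, if i = j then x else 0) \<in> commutator (q i) (adjoint (q j)) \<and>
     (x, 0) \<in> commutator (q i) (q j) \<and>
     (x, 0) \<in> commutator (adjoint (q i)) (adjoint (q j)))"

text \<open>The vectors with finitely many particles over the vacuum \<open>\<Omega>\<close>.\<close>

inductive_set finite_particle ::
  "'i set \<Rightarrow> ('i \<Rightarrow> 'h \<Rightarrow> 'h) \<Rightarrow> ('i \<Rightarrow> 'h uop) \<Rightarrow> 'h \<Rightarrow> 'h::complex_hilbert set"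
  for I f q \<Omega> where
    vacuum: "\<Omega> \<in> finite_particle I f q \<Omega>"
  | lincomb: "x \<in> finite_particle I f q \<Omega> \<Longrightarrow> y \<in> finite_particle I f q \<Omega> \<Longrightarrow>
      z *\<^sub>C x + y \<in> finite_particle I f q \<Omega>"
  | fermion: "x \<in> finite_particle I f q \<Omega> \<Longrightarrow> i \<in> I \<Longrightarrow> adj (f i) x \<in> finite_particle I f q \<Omega>"
  | boson: "x \<in> finite_particle I f q \<Omega> \<Longrightarrow> i \<in> I \<Longrightarrow> (x, y) \<in> adjoint (q i) \<Longrightarrow>
      y \<in> finite_particle I f q \<Omega>"

text \<open>
  Each \<open>i \<in> I\<close> labels one fermionic mode \<open>f i\<close> and one bosonic mode \<open>q i\<close>. Algebraic
  commutation relations do not determine unbounded operators, so the Hilbert space is taken to be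
  the Fock space of the modes, described by its cyclic vacuum; for finitely many modes this is, up
  to unitary equivalence, the only irreducible (regular) representation. The \<open>q i\<close> are closed,
  with the finite-particle vectors as a core.
\<close>

locale fock_modes =
  fixes I :: "'i set"
    and f :: "'i \<Rightarrow> 'h::complex_hilbert \<Rightarrow> 'h"
    and q :: "'i \<Rightarrow> 'h uop"
    and \<Omega> :: 'h
  assumes vacuum_norm: "norm \<Omega> = 1"
    and fermion_vacuum: "i \<in> I \<Longrightarrow> f i \<Omega> = 0"
    and boson_vacuum: "i \<in> I \<Longrightarrow> (\<Omega>, 0) \<in> q i"
    and vacuum_cyclic: "closure (finite_particle I f q \<Omega>) = UNIV"
    and boson_linear: "i \<in> I \<Longrightarrow> linear_operator (q i)"
    and boson_core: "i \<in> I \<Longrightarrow> closure {(x, y) \<in> q i. x \<in> finite_particle I f q \<Omega>} = q i"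
    and fermion_CAR: "CAR I f"
    and boson_CCR: "CCR_on (finite_particle I f q \<Omega>) I q"
    and boson_fermion_commute: "i \<in> I \<Longrightarrow> j \<in> I \<Longrightarrow>
      commutes_with (f i) (q j) \<and> commutes_with (adj (f i)) (q j)"

text \<open>\<open>exp (i (z q\<^sup>\<dagger> + \<bar>z\<bar> q))\<close>, with \<open>\<bar>z\<bar>\<close> the complex conjugate.\<close>

definition weyl :: "'h::complex_hilbert uop \<Rightarrow> complex \<Rightarrow> 'h \<Rightarrow> 'h" where
  "weyl q z = exp_i (op_plus (op_scale z (adjoint q)) (op_scale (cnj z) q))"

definition mode_algebra ::
  "'i set \<Rightarrow> ('i \<Rightarrow> 'h::complex_hilbert \<Rightarrow> 'h) \<Rightarrow> ('i \<Rightarrow> 'h uop) \<Rightarrow> ('h \<Rightarrow> 'h) set" where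
  "mode_algebra R f q = vN_generated (f ` R \<union> {weyl (q i) z | i z. i \<in> R})"

text \<open>\<open>exp [i (\<pi>/2) (p\<^sup>\<dagger> - q\<^sup>\<dagger>) (p - q)]\<close>\<close>

definition swap :: "'h::complex_hilbert uop \<Rightarrow> 'h uop \<Rightarrow> 'h \<Rightarrow> 'h" where
  "swap q p = exp_i (op_scale (complex_of_real (pi / 2))
     (op_comp (op_minus (adjoint p) (adjoint q)) (op_minus p q)))"


section \<open>The lattice system and its copy\<close>

text \<open>Operators localized on \<open>R\<close>: all modes of both copies at the sites in \<open>R\<close>.\<close>

definition region_algebra ::
  "('s \<Rightarrow> 'h::complex_hilbert \<Rightarrow> 'h) \<Rightarrow> ('s \<Rightarrow> 'h \<Rightarrow> 'h) \<Rightarrow> ('s \<Rightarrow> 'h uop) \<Rightarrow> ('s \<Rightarrow> 'h uop) \<Rightarrow>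
   's set \<Rightarrow> ('h \<Rightarrow> 'h) set" where
  "region_algebra a b c d R = mode_algebra (R <+> R) (case_sum a b) (case_sum c d)"

definition causal ::
  "'s::metric_space set \<Rightarrow> ('s \<Rightarrow> 'h::complex_hilbert \<Rightarrow> 'h) \<Rightarrow> ('s \<Rightarrow> 'h \<Rightarrow> 'h) \<Rightarrow>
   ('s \<Rightarrow> 'h uop) \<Rightarrow> ('s \<Rightarrow> 'h uop) \<Rightarrow> real \<Rightarrow> ('h \<Rightarrow> 'h) \<Rightarrow> bool" where
  "causal \<Lambda> a b c d L U \<longleftrightarrow> (\<forall>n\<in>\<Lambda>.
     adj U \<circ> a n \<circ> U \<in> region_algebra a b c d {m\<in>\<Lambda>. dist n m < L} \<and>
     affiliated (conjugate U (c n)) (region_algebra a b c d {m\<in>\<Lambda>. dist n m < L}))"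

text \<open>
  A further fermionic mode besides those of the system with modes \<open>a\<close>, \<open>c\<close>. The fermionic
  modes of a copy of the system are of this kind.
\<close>

definition ancillary_fermion ::
  "'s set \<Rightarrow> ('s \<Rightarrow> 'h::complex_hilbert \<Rightarrow> 'h) \<Rightarrow> ('s \<Rightarrow> 'h uop) \<Rightarrow> ('h \<Rightarrow> 'h) \<Rightarrow> bool" where
  "ancillary_fermion \<Lambda> a c e \<longleftrightarrow> CAR (insert None (Some ` \<Lambda>)) (case_option e a) \<and>
     (\<forall>n\<in>\<Lambda>. commutes_with e (c n) \<and> commutes_with (adj e) (c n))"

text \<open>
  Replacing \<open>a\<close>, \<open>c\<close> by \<open>b\<close>, \<open>d\<close> in \<open>U\<close> gives \<open>U'\<close>. The substitution is the
  *-isomorphism of von Neumann algebras determined by its values on the generators.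
\<close>

definition substituted ::
  "'s set \<Rightarrow> ('s \<Rightarrow> 'h::complex_hilbert \<Rightarrow> 'h) \<Rightarrow> ('s \<Rightarrow> 'h \<Rightarrow> 'h) \<Rightarrow> ('s \<Rightarrow> 'h uop) \<Rightarrow> ('s \<Rightarrow> 'h uop) \<Rightarrow>
   ('h \<Rightarrow> 'h) \<Rightarrow> ('h \<Rightarrow> 'h) \<Rightarrow> bool" where
  "substituted \<Lambda> a b c d U U' \<longleftrightarrow> (\<exists>\<Phi>.
     star_isomorphism \<Phi> (mode_algebra \<Lambda> a c) (mode_algebra \<Lambda> b d) \<and>
     (\<forall>n\<in>\<Lambda>. \<Phi> (a n) = b n \<and> (\<forall>z. \<Phi> (weyl (c n) z) = weyl (d n) z)) \<and>
     \<Phi> U = U')"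

end

theory Submission
  imports Defs
begin

text \<open>
  Write \<open>\<Sigma>\<close> for the product of all on-site swaps; it is an involution that exchanges the two copies.
  If \<open>U\<^sub>B = \<Sigma> U\<^sub>A \<Sigma>\<close>, then \<open>U\<^sub>A U\<^sub>B\<^sup>\<dagger> = \<Sigma> (U\<^sub>B \<Sigma> U\<^sub>B\<^sup>\<dagger>)\<close>, and conjugation distributes over the factors of
  the second \<open>\<Sigma>\<close>. The analytic work lies in three points.

  The exponentials have to be identified. The finite-particle vectors are entire vectors of the field
  operators and of the swap generators, so Nelson's argument gives their self-adjointness, and a
  bounded operator commutes with an exponential as soon as it commutes weakly with the generator on
  these vectors. On them a swap acts as the second quantization of a transposition of modes, and an
  operator of this kind is determined by the permutation of the modes.

  The substitution that defines \<open>U\<^sub>B\<close> is an abstract *-isomorphism, not assumed to be normal. Composed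
  with conjugation by \<open>\<Sigma>\<close> it becomes an automorphism of a type I factor that fixes the generators;
  it fixes the vacuum projection, hence everything.

  Finally, causality bounds the evolution of \<open>a\<close> and \<open>c\<close>, while locality of \<open>U\<^sub>B S U\<^sub>B\<^sup>\<dagger>\<close> concerns the
  inverse evolution. Causality implies that \<open>U\<^sub>B S U\<^sub>B\<^sup>\<dagger>\<close> commutes with all distant modes; being even, it
  is then localized by Haag duality, with a Klein transformation taking care of the fermionic signs.
\<close>

section \<open>Complex Hilbert spaces\<close>

text \<open>The constant \<open>pi / 2\<close> is a normalization: \<open>(p - q) / sqrt 2\<close>
  annihilates the antisymmetric combination of two modes, so a swap is the exponential of
  \<open>\<i> * pi\<close> times the number operator of that combination, that is, its parity. It
  negates the antisymmetric one-particle state and fixes the symmetric one; this is a transposition.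

  A bounded operator from a commutant need not map finite-particle vectors into the domain of an
  unbounded mode operator. Commutation is therefore tested in matrix elements between
  finite-particle vectors, with one mode operator moved to the left argument; this form survives
  closures and exponentials.

  Evenness of \<open>U\<^sub>A\<close> has to be derived: invariance of ancillary modes makes it
  commute with the fermions of the copy, and membership in the algebra of the original system makes
  it commute with those fermions twisted by a parity. Evenness cannot be dispensed with in the
  localization, because a fermion of the region times the parity of the outside also commutes with
  every distant mode.\<close>

lemma scaleC_one [simp]: "1 *\<^sub>C x = x"
  using scaleC_of_real[of 1 x] by simp

lemma scaleC_zero_left [simp]: "0 *\<^sub>C x = 0"
  using scaleC_of_real[of 0 x] by simp

lemma scaleC_zero_right [simp]: "z *\<^sub>C 0 = 0"
  using scaleC_add_right[of z 0 0] by simp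

lemma scaleC_minus_right [simp]: "z *\<^sub>C (- x) = - (z *\<^sub>C x)"
  using scaleC_add_right[of z x "- x"] by (simp add: minus_unique)

lemma scaleC_minus_left [simp]: "(- z) *\<^sub>C x = - (z *\<^sub>C x)"
  using scaleC_add_left[of z "- z" x] by (simp add: minus_unique)

lemma scaleC_diff_right: "z *\<^sub>C (x - y) = z *\<^sub>C x - z *\<^sub>C y"
  using scaleC_add_right[of z x "- y"] by simp

lemma scaleC_diff_left: "(z - w) *\<^sub>C x = z *\<^sub>C x - w *\<^sub>C x"
  using scaleC_add_left[of z "- w" x] by simp

lemma cinner_add_left: "cinner (x + x') y = cinner x y + cinner x' y"
proof -
  have "cinner (x + x') y = cnj (cinner y (x + x'))" by (rule cinner_commute)
  also have "\<dots> = cnj (cinner y x) + cnj (cinner y x')" by (simp add: cinner_add_right)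
  also have "\<dots> = cinner x y + cinner x' y" by (metis cinner_commute)
  finally show ?thesis .
qed

lemma cinner_scaleC_left: "cinner (z *\<^sub>C x) y = cnj z * cinner x y"
proof -
  have "cinner (z *\<^sub>C x) y = cnj (cinner y (z *\<^sub>C x))" by (rule cinner_commute)
  also have "\<dots> = cnj z * cnj (cinner y x)" by (simp add: cinner_scaleC_right)
  also have "\<dots> = cnj z * cinner x y" by (metis cinner_commute)
  finally show ?thesis .
qed

lemma cinner_zero_right [simp]: "cinner x 0 = 0"
  using cinner_scaleC_right[of x 0 0] by simp

lemma cinner_zero_left [simp]: "cinner 0 x = 0"
  using cinner_scaleC_left[of 0 0 x] by simp

lemma cinner_minus_right [simp]: "cinner x (- y) = - cinner x y"
  using cinner_scaleC_right[of x "-1" y] by simp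

lemma cinner_minus_left [simp]: "cinner (- x) y = - cinner x y"
  using cinner_scaleC_left[of "-1" x y] by simp

lemma cinner_diff_right: "cinner x (y - z) = cinner x y - cinner x z"
  using cinner_add_right[of x y "- z"] by simp

lemma cinner_diff_left: "cinner (x - y) z = cinner x z - cinner y z"
  using cinner_add_left[of x "- y" z] by simp

lemmas cinner_simps = cinner_add_left cinner_add_right cinner_diff_left cinner_diff_right
  cinner_scaleC_left cinner_scaleC_right

lemma cinner_self_eq_0 [simp]: "cinner x x = 0 \<longleftrightarrow> x = 0"
  by (simp add: cinner_self)

lemma Re_cinner_self: "Re (cinner x x) = (norm x)\<^sup>2"
  by (simp add: cinner_self)

lemma norm_scaleC [simp]: "norm (z *\<^sub>C x) = cmod z * norm x"
proof -
  have "cinner (z *\<^sub>C x) (z *\<^sub>C x) = cnj z * z * cinner x x"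
    by (simp add: cinner_simps)
  also have "\<dots> = complex_of_real ((cmod z * norm x)\<^sup>2)"
    by (simp add: cinner_self power_mult_distrib mult.commute flip: complex_norm_square)
  finally have "(norm (z *\<^sub>C x))\<^sup>2 = (cmod z * norm x)\<^sup>2"
    unfolding cinner_self of_real_eq_iff .
  then show ?thesis by (simp add: power2_eq_iff_nonneg)
qed

lemma pythagoras:
  assumes "cinner x y = 0"
  shows "(norm (x + y))\<^sup>2 = (norm x)\<^sup>2 + (norm y)\<^sup>2"
proof -
  have "cinner y x = 0" using assms cinner_commute[of y x] by simp
  then have "cinner (x + y) (x + y) = cinner x x + cinner y y"
    using assms by (simp add: cinner_simps)
  then have "Re (cinner (x + y) (x + y)) = Re (cinner x x) + Re (cinner y y)" by simp
  then show ?thesis by (simp only: Re_cinner_self)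
qed

lemma parallelogram:
  fixes x y :: "'h::complex_hilbert"
  shows "(norm (x + y))\<^sup>2 + (norm (x - y))\<^sup>2 = 2 * (norm x)\<^sup>2 + 2 * (norm y)\<^sup>2"
proof -
  have "cinner (x + y) (x + y) + cinner (x - y) (x - y) = 2 * cinner x x + 2 * cinner y y"
    by (simp add: cinner_simps)
  then have "Re (cinner (x + y) (x + y)) + Re (cinner (x - y) (x - y))
    = Re (2 * cinner x x + 2 * cinner y y)" by (metis plus_complex.simps(1))
  then show ?thesis by (simp add: Re_cinner_self)
qed

text \<open>The multiple of \<open>x\<close> split off here is the component of \<open>y\<close>
  along \<open>x\<close>; by Pythagoras it is no longer than \<open>y\<close>.\<close>

lemma cmod_cinner_le: "cmod (cinner x y) \<le> norm x * norm y"
proof (cases "x = 0")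
  case False
  define c where "c = cinner x y / cinner x x"
  have ne: "cinner x x \<noteq> 0" using False by simp
  have "cinner (c *\<^sub>C x) (y - c *\<^sub>C x) = 0"
    using ne by (simp add: cinner_simps c_def)
  then have "(norm (c *\<^sub>C x + (y - c *\<^sub>C x)))\<^sup>2 = (norm (c *\<^sub>C x))\<^sup>2 + (norm (y - c *\<^sub>C x))\<^sup>2"
    by (rule pythagoras)
  then have "(norm (c *\<^sub>C x))\<^sup>2 \<le> (norm y)\<^sup>2" by simp
  then have "cmod c * norm x \<le> norm y" by (simp add: power2_le_iff_abs_le)
  moreover have "cmod c = cmod (cinner x y) / (norm x)\<^sup>2"
    by (simp add: c_def norm_divide cinner_self norm_power)
  ultimately show ?thesis
    using False by (simp add: power2_eq_square field_simps)
qed simp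

lemma cinner_ext:
  assumes "\<And>y. cinner y x = cinner y x'"
  shows "x = x'"
proof -
  have "cinner (x - x') (x - x') = 0"
    using assms[of "x - x'"] by (simp add: cinner_diff_right)
  then show ?thesis by simp
qed

lemma bounded_bilinear_cinner: "bounded_bilinear (cinner :: 'h::complex_hilbert \<Rightarrow> 'h \<Rightarrow> complex)"
proof
  show "\<exists>K. \<forall>a b::'h. cmod (cinner a b) \<le> norm a * norm b * K"
    by (rule exI[of _ 1]) (simp add: cmod_cinner_le)
  fix r :: real and x y :: 'h
  show "cinner (r *\<^sub>R x) y = r *\<^sub>R cinner x y"
    by (simp add: cinner_scaleC_left scaleR_conv_of_real flip: scaleC_of_real)
  show "cinner x (r *\<^sub>R y) = r *\<^sub>R cinner x y"
    by (simp add: cinner_scaleC_right scaleR_conv_of_real flip: scaleC_of_real)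
qed (simp_all add: cinner_add_left cinner_add_right)

lemma bounded_linear_scaleC: "bounded_linear (\<lambda>x::'h::complex_hilbert. z *\<^sub>C x)"
proof (rule bounded_linear_intro[where K = "cmod z"])
  fix r :: real and x :: 'h
  show "z *\<^sub>C r *\<^sub>R x = r *\<^sub>R z *\<^sub>C x"
    by (simp add: scaleC_scaleC mult.commute flip: scaleC_of_real)
qed (simp_all add: scaleC_add_right mult.commute)

lemma bounded_linear_scaleC_left: "bounded_linear (\<lambda>z. z *\<^sub>C (v :: 'h::complex_hilbert))"
proof (rule bounded_linear_intro[where K = "norm v"])
  show "(r *\<^sub>R z) *\<^sub>C v = r *\<^sub>R (z *\<^sub>C v)" for r z
    by (simp add: scaleC_scaleC scaleR_conv_of_real flip: scaleC_of_real)
qed (simp_all add: scaleC_add_left)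

lemmas tendsto_cinner = bounded_bilinear.tendsto[OF bounded_bilinear_cinner]
lemmas tendsto_scaleC = bounded_linear.tendsto[OF bounded_linear_scaleC]
lemmas continuous_on_cinner = bounded_bilinear.continuous_on[OF bounded_bilinear_cinner]

subsection \<open>Bounded operators\<close>

lemma bounded_clinear_bounded_linear: "bounded_clinear X \<Longrightarrow> bounded_linear X"
  by (simp add: bounded_clinear_def)

lemma bounded_clinearD:
  assumes "bounded_clinear X"
  shows "X (x + y) = X x + X y" "X (z *\<^sub>C x) = z *\<^sub>C X x" "X 0 = 0" "X (x - y) = X x - X y"
    "X (- x) = - X x"
  using assms bounded_linear.linear[of X]
  by (auto simp: bounded_clinear_def linear_add linear_0 linear_diff linear_neg)

lemma bounded_clinearI:
  assumes "\<And>x y. X (x + y) = X x + X y" "\<And>z x. X (z *\<^sub>C x) = z *\<^sub>C X x"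
    and "\<And>x. norm (X x) \<le> K * norm x"
  shows "bounded_clinear X"
  unfolding bounded_clinear_def
proof (intro conjI allI)
  show "bounded_linear X"
  proof (rule bounded_linear_intro)
    show "X (r *\<^sub>R x) = r *\<^sub>R X x" for r x
      using assms(2)[of "of_real r" x] by (simp add: scaleC_of_real)
    show "norm (X x) \<le> norm x * K" for x using assms(3)[of x] by (simp add: mult.commute)
  qed (rule assms)
qed (rule assms)

lemma bounded_clinear_id [simp]: "bounded_clinear id" "bounded_clinear (\<lambda>x. x)"
  by (auto intro!: bounded_clinearI[where K = 1])

lemma bounded_clinear_zero [simp]: "bounded_clinear (\<lambda>x. 0)"
  by (auto intro!: bounded_clinearI[where K = 0])

lemma bounded_clinear_comp:
  "bounded_clinear X \<Longrightarrow> bounded_clinear Y \<Longrightarrow> bounded_clinear (X \<circ> Y)"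
  by (auto simp: bounded_clinear_def comp_def bounded_linear_compose)

lemma bounded_clinear_add:
  "bounded_clinear X \<Longrightarrow> bounded_clinear Y \<Longrightarrow> bounded_clinear (\<lambda>x. X x + Y x)"
  by (auto simp: bounded_clinear_def bounded_linear_add scaleC_add_right)

lemma bounded_clinear_diff:
  "bounded_clinear X \<Longrightarrow> bounded_clinear Y \<Longrightarrow> bounded_clinear (\<lambda>x. X x - Y x)"
  by (auto simp: bounded_clinear_def bounded_linear_sub scaleC_diff_right)

lemma bounded_clinear_scaleC:
  "bounded_clinear X \<Longrightarrow> bounded_clinear (\<lambda>x. z *\<^sub>C X x)"
  by (auto simp: bounded_clinear_def scaleC_scaleC mult.commute
      intro: bounded_linear_compose[OF bounded_linear_scaleC])

section \<open>Orthogonal projections and the Riesz representation\<close>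

definition csubspace :: "'h::complex_hilbert set \<Rightarrow> bool" where
  "csubspace K \<longleftrightarrow> 0 \<in> K \<and> (\<forall>x\<in>K. \<forall>y\<in>K. \<forall>z. z *\<^sub>C x + y \<in> K)"

lemma csubspaceD:
  assumes "csubspace K"
  shows "0 \<in> K" "x \<in> K \<Longrightarrow> y \<in> K \<Longrightarrow> z *\<^sub>C x + y \<in> K" "x \<in> K \<Longrightarrow> z *\<^sub>C x \<in> K"
    "x \<in> K \<Longrightarrow> y \<in> K \<Longrightarrow> x + y \<in> K" "x \<in> K \<Longrightarrow> y \<in> K \<Longrightarrow> x - y \<in> K"
proof -
  note * = assms[unfolded csubspace_def]
  show 0: "0 \<in> K" using * by blast
  show 1: "x \<in> K \<Longrightarrow> y \<in> K \<Longrightarrow> z *\<^sub>C x + y \<in> K" for x y z using * by blast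
  show "x \<in> K \<Longrightarrow> z *\<^sub>C x \<in> K" using 1[of x 0 z] 0 by simp
  show "x \<in> K \<Longrightarrow> y \<in> K \<Longrightarrow> x + y \<in> K" using 1[of x y 1] by simp
  show "x \<in> K \<Longrightarrow> y \<in> K \<Longrightarrow> x - y \<in> K" using 1[of y x "-1"] by simp
qed

text \<open>Shifting \<open>k\<close> by the component of the residual \<open>x - k\<close> along
  \<open>y\<close> would shorten the residual unless that component vanishes.\<close>

lemma minimizing_orthogonal:
  fixes x k :: "'h::complex_hilbert"
  assumes "csubspace K" "k \<in> K" "\<And>y. y \<in> K \<Longrightarrow> norm (x - k) \<le> norm (x - y)" "y \<in> K"
  shows "cinner y (x - k) = 0"
proof (cases "y = 0")
  case False
  define v where "v = x - k"
  define t where "t = cinner y v / cinner y y"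
  have ne: "cinner y y \<noteq> 0" using False by simp
  have "k + t *\<^sub>C y \<in> K" using assms(1,2,4) csubspaceD(3,4) by metis
  then have le: "norm v \<le> norm (v - t *\<^sub>C y)"
    using assms(3)[of "k + t *\<^sub>C y"] by (simp add: v_def algebra_simps)
  have "cinner (t *\<^sub>C y) (v - t *\<^sub>C y) = 0"
    using ne by (simp add: cinner_simps t_def)
  then have "(norm v)\<^sup>2 = (norm (t *\<^sub>C y))\<^sup>2 + (norm (v - t *\<^sub>C y))\<^sup>2"
    using pythagoras[of "t *\<^sub>C y" "v - t *\<^sub>C y"] by simp
  moreover have "(norm v)\<^sup>2 \<le> (norm (v - t *\<^sub>C y))\<^sup>2" using le by (simp add: power_mono)
  ultimately have "(norm (t *\<^sub>C y))\<^sup>2 \<le> 0" by linarith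
  then have "norm (t *\<^sub>C y) = 0" by (simp del: norm_scaleC)
  then have "cmod t * norm y = 0" by simp
  then show ?thesis using False ne by (simp add: t_def v_def)
qed simp

text \<open>The midpoint of two members of a minimizing sequence lies in \<open>K\<close>, so its
  distance from \<open>x\<close> is at least \<open>d\<close>; the parallelogram law then forces the
  members together.\<close>

lemma projection_exists:
  fixes K :: "'h::complex_hilbert set"
  assumes "csubspace K" "closed K"
  shows "\<exists>k\<in>K. \<forall>y\<in>K. cinner y (x - k) = 0"
proof -
  define d where "d = infdist x K"
  have ne: "K \<noteq> {}" using csubspaceD(1)[OF assms(1)] by blast
  have d0: "0 \<le> d" by (simp add: d_def infdist_nonneg)
  have d_le: "d \<le> norm (x - y)" if "y \<in> K" for y
    using infdist_le[OF that, of x] by (simp add: d_def dist_norm)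
  have "\<exists>y\<in>K. norm (x - y) < d + 1 / real (Suc n)" for n
  proof (rule ccontr)
    assume "\<not> ?thesis"
    then have "d + 1 / real (Suc n) \<le> d"
      unfolding d_def infdist_notempty[OF ne]
      by (intro cINF_greatest ne) (auto simp: not_less dist_norm)
    then show False by simp
  qed
  then obtain s where sK: "\<And>n. s n \<in> K" and s: "\<And>n. norm (x - s n) < d + 1 / real (Suc n)"
    by metis
  have lim: "(\<lambda>n. norm (x - s n)) \<longlonglongrightarrow> d"
  proof (rule real_tendsto_sandwich[OF always_eventually always_eventually tendsto_const])
    show "(\<lambda>n. d + 1 / real (Suc n)) \<longlonglongrightarrow> d"
      using tendsto_add[OF tendsto_const LIMSEQ_inverse_real_of_nat, of d]
      by (simp add: inverse_eq_divide)
    show "\<forall>n. d \<le> norm (x - s n)" using d_le sK by blast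
    show "\<forall>n. norm (x - s n) \<le> d + 1 / real (Suc n)" using s less_imp_le by blast
  qed
  have "Cauchy s"
  proof (rule metric_CauchyI)
    fix e :: real assume e: "e > 0"
    have "(\<lambda>n. (norm (x - s n))\<^sup>2) \<longlonglongrightarrow> d\<^sup>2" by (intro tendsto_intros lim)
    moreover have "d\<^sup>2 < d\<^sup>2 + e\<^sup>2 / 4" using e by simp
    ultimately have "eventually (\<lambda>n. (norm (x - s n))\<^sup>2 < d\<^sup>2 + e\<^sup>2 / 4) sequentially"
      by (rule order_tendstoD(2))
    then obtain M where M: "\<And>n. n \<ge> M \<Longrightarrow> (norm (x - s n))\<^sup>2 < d\<^sup>2 + e\<^sup>2 / 4"
      by (auto simp: eventually_sequentially)
    show "\<exists>M. \<forall>m\<ge>M. \<forall>n\<ge>M. dist (s m) (s n) < e"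
    proof (intro exI allI impI)
      fix m n assume m: "m \<ge> M" and n: "n \<ge> M"
      let ?u = "x - s m" and ?v = "x - s n"
      define c where "c = (1/2 :: complex)"
      have "c *\<^sub>C s m + c *\<^sub>C s n \<in> K"
        using csubspaceD(2,3)[OF assms(1)] sK by blast
      then have "d \<le> norm (x - (c *\<^sub>C s m + c *\<^sub>C s n))" by (rule d_le)
      also have "x - (c *\<^sub>C s m + c *\<^sub>C s n) = c *\<^sub>C (?u + ?v)"
      proof -
        have "x = c *\<^sub>C x + c *\<^sub>C x" by (simp add: c_def flip: scaleC_add_left)
        then show ?thesis by (simp add: scaleC_add_right scaleC_diff_right)
      qed
      finally have "2 * d \<le> norm (?u + ?v)" by (simp add: c_def)
      then have "(2 * d)\<^sup>2 \<le> (norm (?u + ?v))\<^sup>2" using d0 by (intro power_mono) auto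
      moreover have "(norm (?u + ?v))\<^sup>2 + (norm (?u - ?v))\<^sup>2 = 2 * (norm ?u)\<^sup>2 + 2 * (norm ?v)\<^sup>2"
        by (rule parallelogram)
      ultimately have "(norm (?u - ?v))\<^sup>2 < e\<^sup>2"
        using M[OF m] M[OF n] by (simp add: power_mult_distrib)
      then have "norm (?u - ?v) < e" using e by (simp add: power_less_imp_less_base)
      then show "dist (s m) (s n) < e" by (simp add: dist_norm norm_minus_commute)
    qed
  qed
  then obtain k where k: "s \<longlonglongrightarrow> k" using Cauchy_convergent convergent_def by blast
  have kK: "k \<in> K" using assms(2) sK k closed_sequentially by metis
  have "(\<lambda>n. norm (x - s n)) \<longlonglongrightarrow> norm (x - k)" by (intro tendsto_intros k)
  then have "norm (x - k) = d" using lim LIMSEQ_unique by blast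
  then show ?thesis using minimizing_orthogonal[OF assms(1) kK] d_le kK by auto
qed

definition proj :: "'h::complex_hilbert set \<Rightarrow> 'h \<Rightarrow> 'h" where
  "proj K x = (SOME k. k \<in> K \<and> (\<forall>y\<in>K. cinner y (x - k) = 0))"

lemma proj:
  assumes "csubspace K" "closed K"
  shows "proj K x \<in> K" "y \<in> K \<Longrightarrow> cinner y (x - proj K x) = 0"
    "y \<in> K \<Longrightarrow> cinner y (proj K x) = cinner y x"
proof -
  have "\<exists>k. k \<in> K \<and> (\<forall>y\<in>K. cinner y (x - k) = 0)" using projection_exists[OF assms] by blast
  from someI_ex[OF this] show "proj K x \<in> K" "y \<in> K \<Longrightarrow> cinner y (x - proj K x) = 0"
    by (auto simp: proj_def)
  then show "y \<in> K \<Longrightarrow> cinner y (proj K x) = cinner y x" by (simp add: cinner_diff_right)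
qed

lemma proj_unique:
  assumes "csubspace K" "closed K" "k \<in> K" "\<And>y. y \<in> K \<Longrightarrow> cinner y (x - k) = 0"
  shows "proj K x = k"
proof -
  have K: "proj K x - k \<in> K" using proj(1)[OF assms(1,2)] assms(1,3) csubspaceD(5) by blast
  have "cinner (proj K x - k) (x - k - (x - proj K x)) = 0"
    using assms(4)[OF K] proj(2)[OF assms(1,2) K] by (simp add: cinner_diff_right)
  then have "cinner (proj K x - k) (proj K x - k) = 0" by simp
  then show ?thesis by simp
qed

lemma proj_mem [simp]: "csubspace K \<Longrightarrow> closed K \<Longrightarrow> x \<in> K \<Longrightarrow> proj K x = x"
  by (rule proj_unique) auto

lemma proj_orth: "csubspace K \<Longrightarrow> closed K \<Longrightarrow> (\<And>y. y \<in> K \<Longrightarrow> cinner y x = 0) \<Longrightarrow> proj K x = 0"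
  by (rule proj_unique) (auto simp: csubspaceD)

lemma bounded_clinear_proj:
  fixes K :: "'h::complex_hilbert set"
  assumes K: "csubspace K" "closed K"
  shows "bounded_clinear (proj K)"
proof (rule bounded_clinearI[where K = 1])
  fix x y :: 'h and z :: complex
  show "proj K (x + y) = proj K x + proj K y"
    by (rule proj_unique[OF K]) (auto simp: csubspaceD(4)[OF K(1)] proj[OF K] cinner_simps)
  show "proj K (z *\<^sub>C x) = z *\<^sub>C proj K x"
    by (rule proj_unique[OF K]) (auto simp: csubspaceD(3)[OF K(1)] proj[OF K] cinner_simps)
  have "(norm (proj K x + (x - proj K x)))\<^sup>2 = (norm (proj K x))\<^sup>2 + (norm (x - proj K x))\<^sup>2"
    by (intro pythagoras proj[OF K])
  then show "norm (proj K x) \<le> 1 * norm x" by (simp add: power2_le_imp_le)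
qed

lemma cinner_proj:
  assumes K: "csubspace K" "closed K"
  shows "cinner (proj K x) y = cinner x (proj K y)"
proof -
  have "cinner (proj K x) y = cinner (proj K x) (proj K y)" using proj(1,3)[OF K] by metis
  also have "\<dots> = cnj (cinner (proj K y) (proj K x))" by (rule cinner_commute)
  also have "\<dots> = cnj (cinner (proj K y) x)" using proj(1,3)[OF K] by metis
  also have "\<dots> = cinner x (proj K y)" by (metis cinner_commute)
  finally show ?thesis .
qed

text \<open>The kernel is a closed subspace of codimension at most one; a nonzero vector
  \<open>v\<close> orthogonal to it represents the functional after rescaling.\<close>

lemma riesz:
  fixes \<phi> :: "'h::complex_hilbert \<Rightarrow> complex"
  assumes add: "\<And>x y. \<phi> (x + y) = \<phi> x + \<phi> y" and scale: "\<And>z x. \<phi> (z *\<^sub>C x) = z * \<phi> x"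
    and bound: "\<And>x. cmod (\<phi> x) \<le> C * norm x"
  shows "\<exists>w. \<forall>x. \<phi> x = cinner w x"
proof (cases "\<forall>x. \<phi> x = 0")
  case True
  then show ?thesis by (intro exI[of _ 0]) simp
next
  case False
  then obtain u where u: "\<phi> u \<noteq> 0" by blast
  define K where "K = {x. \<phi> x = 0}"
  have "bounded_linear \<phi>"
  proof (rule bounded_linear_intro[where K = C])
    show "\<phi> (r *\<^sub>R x) = r *\<^sub>R \<phi> x" for r x
      using scale[of "of_real r" x] by (simp add: scaleC_of_real scaleR_conv_of_real)
    show "cmod (\<phi> x) \<le> norm x * C" for x using bound[of x] by (simp only: mult.commute)
  qed (rule add)
  then have "continuous_on UNIV \<phi>" by (rule linear_continuous_on)
  then have cl: "closed K"
    unfolding K_def by (intro closed_Collect_eq continuous_intros)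
  have \<phi>0: "\<phi> 0 = 0" using scale[of 0 0] by simp
  have sub: "csubspace K" by (auto simp: csubspace_def K_def add scale \<phi>0)
  define v where "v = u - proj K u"
  have \<phi>diff: "\<phi> (x - y) = \<phi> x - \<phi> y" for x y using add[of "x - y" y] by simp
  have "proj K u \<in> K" by (rule proj(1)[OF sub cl])
  then have \<phi>v: "\<phi> v = \<phi> u" by (simp add: v_def \<phi>diff K_def)
  then have "v \<noteq> 0" using u \<phi>0 by auto
  then have ne: "cinner v v \<noteq> 0" by simp
  have orth: "cinner v y = 0" if "y \<in> K" for y
    using proj(2)[OF sub cl that, of u] cinner_commute[of v y] by (simp add: v_def)
  show ?thesis
  proof (intro exI allI)
    fix x
    have "x - (\<phi> x / \<phi> v) *\<^sub>C v \<in> K"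
      using u by (simp add: K_def \<phi>diff scale \<phi>v)
    from orth[OF this] have "cinner v x = \<phi> x / \<phi> v * cinner v v" by (simp add: cinner_simps)
    then show "\<phi> x = cinner ((cnj (\<phi> v) / cnj (cinner v v)) *\<^sub>C v) x"
      using ne u by (simp add: cinner_simps \<phi>v)
  qed
qed

section \<open>Adjoints of bounded operators\<close>

lemma adj_eqI:
  fixes X :: "'h::complex_hilbert \<Rightarrow> 'h"
  assumes "\<And>x y. cinner (Y x) y = cinner x (X y)"
  shows "adj X = Y"
  unfolding adj_def
proof (rule the_equality)
  fix Y' assume Y': "\<forall>x y. cinner (Y' x) y = cinner x (X y)"
  show "Y' = Y"
  proof
    fix x
    show "Y' x = Y x"
    proof (rule cinner_ext)
      fix y
      have "cinner (Y' x) y = cinner (Y x) y" using Y' assms by simp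
      then show "cinner y (Y' x) = cinner y (Y x)" by (metis cinner_commute)
    qed
  qed
qed (use assms in blast)

text \<open>\<open>adj\<close> is a definite description over all functions. Riesz gives its value
  at each point, and linearity follows because inner products separate vectors.\<close>

lemma adj_exists:
  fixes X :: "'h::complex_hilbert \<Rightarrow> 'h"
  assumes X: "bounded_clinear X"
  shows "\<exists>Y. bounded_clinear Y \<and> (\<forall>x y. cinner (Y x) y = cinner x (X y))"
proof -
  obtain C where C: "\<And>x. norm (X x) \<le> norm x * C" and C0: "C > 0"
    using bounded_linear.pos_bounded[OF bounded_clinear_bounded_linear[OF X]] by blast
  have "\<exists>w. \<forall>y. cinner x (X y) = cinner w y" for x
  proof (rule riesz[where C = "norm x * C"])
    fix y
    have "cmod (cinner x (X y)) \<le> norm x * norm (X y)" by (rule cmod_cinner_le)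
    also have "\<dots> \<le> norm x * (norm y * C)" by (intro mult_left_mono C) auto
    finally show "cmod (cinner x (X y)) \<le> norm x * C * norm y" by (simp add: mult_ac)
  qed (simp_all add: bounded_clinearD[OF X] cinner_simps)
  then obtain Y where Y: "\<And>x y. cinner (Y x) y = cinner x (X y)" by metis
  have Y': "cinner y (Y x) = cinner (X y) x" for x y
    using Y[of x y] by (metis cinner_commute)
  have "bounded_clinear Y"
  proof (rule bounded_clinearI[where K = C])
    fix x
    have "(norm (Y x))\<^sup>2 = cmod (cinner (Y x) (Y x))" by (simp add: cinner_self norm_power)
    also have "\<dots> \<le> norm x * norm (X (Y x))" unfolding Y by (rule cmod_cinner_le)
    also have "\<dots> \<le> norm x * (norm (Y x) * C)" by (intro mult_left_mono C) auto
    finally have "norm (Y x) * norm (Y x) \<le> norm (Y x) * (C * norm x)"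
      by (simp add: power2_eq_square mult_ac)
    then show "norm (Y x) \<le> C * norm x"
      using C0 by (cases "norm (Y x) = 0") (auto simp: mult_le_cancel_left)
  qed (rule cinner_ext, simp add: Y' cinner_simps)+
  then show ?thesis using Y by blast
qed

lemma adj:
  assumes "bounded_clinear X"
  shows bounded_clinear_adj: "bounded_clinear (adj X)"
    and cinner_adj_left: "cinner (adj X x) y = cinner x (X y)"
    and cinner_adj_right: "cinner x (adj X y) = cinner (X x) y"
proof -
  obtain Y where Y: "bounded_clinear Y" "\<And>x y. cinner (Y x) y = cinner x (X y)"
    using adj_exists[OF assms] by blast
  have [simp]: "adj X = Y" by (rule adj_eqI) (rule Y)
  show "bounded_clinear (adj X)" "cinner (adj X x) y = cinner x (X y)" using Y by auto
  then show "cinner x (adj X y) = cinner (X x) y" by (metis Y(2) \<open>adj X = Y\<close> cinner_commute)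
qed

lemma adj_adj [simp]: "bounded_clinear X \<Longrightarrow> adj (adj X) = X"
  by (rule adj_eqI) (simp add: cinner_adj_right)

lemma adj_comp: "bounded_clinear X \<Longrightarrow> bounded_clinear Y \<Longrightarrow> adj (X \<circ> Y) = adj Y \<circ> adj X"
  by (rule adj_eqI) (simp add: cinner_adj_left)

lemma adj_id [simp]: "adj id = id" "adj (\<lambda>x. x) = (\<lambda>x. x)"
  by (rule adj_eqI, simp)+

lemma adj_proj: "csubspace K \<Longrightarrow> closed K \<Longrightarrow> adj (proj K) = proj K"
  by (rule adj_eqI) (rule cinner_proj)

lemma commute_adj:
  assumes "bounded_clinear X" "bounded_clinear Y" "X \<circ> Y = Y \<circ> X"
  shows "adj X \<circ> adj Y = adj Y \<circ> adj X"
  using assms by (metis adj_comp)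

text \<open>\<open>K\<close> reduces \<open>X\<close>: invariance under the adjoint keeps the image
  of the residual orthogonal to \<open>K\<close>. This is how projections are placed in commutants
  below.\<close>

lemma proj_commute:
  assumes K: "csubspace K" "closed K" and X: "bounded_clinear X"
    and inv: "\<And>x. x \<in> K \<Longrightarrow> X x \<in> K" "\<And>x. x \<in> K \<Longrightarrow> adj X x \<in> K"
  shows "X \<circ> proj K = proj K \<circ> X"
proof
  fix x
  have "proj K (X x) = X (proj K x)"
  proof (rule proj_unique[OF K])
    show "X (proj K x) \<in> K" by (intro inv proj(1) K)
    fix y assume "y \<in> K"
    then have "adj X y \<in> K" by (rule inv)
    then have "cinner (adj X y) (x - proj K x) = 0" by (rule proj(2)[OF K])
    then show "cinner y (X x - X (proj K x)) = 0"
      by (simp add: cinner_adj_left[OF X] bounded_clinearD[OF X])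
  qed
  then show "(X \<circ> proj K) x = (proj K \<circ> X) x" by simp
qed

section \<open>Dense subspaces\<close>

lemma csubspace_closure:
  assumes "csubspace K"
  shows "csubspace (closure K)"
  unfolding csubspace_def
proof (intro conjI ballI allI)
  show "0 \<in> closure K" using csubspaceD(1)[OF assms] closure_subset by blast
  fix x y :: 'a and z :: complex
  assume "x \<in> closure K" "y \<in> closure K"
  then obtain s t where "\<And>n. s n \<in> K" "s \<longlonglongrightarrow> x" "\<And>n. t n \<in> K" "t \<longlonglongrightarrow> y"
    by (auto simp: closure_sequential)
  then have "(\<lambda>n. z *\<^sub>C s n + t n) \<longlonglongrightarrow> z *\<^sub>C x + y" "\<And>n. z *\<^sub>C s n + t n \<in> K"
    by (auto intro!: tendsto_intros tendsto_scaleC csubspaceD(2)[OF assms])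
  then show "z *\<^sub>C x + y \<in> closure K"
    unfolding closure_sequential by (intro exI[of _ "\<lambda>n. z *\<^sub>C s n + t n"]) blast
qed

lemma dense_of_orthogonal_trivial:
  fixes K :: "'h::complex_hilbert set"
  assumes "csubspace K" "\<And>y. (\<And>x. x \<in> K \<Longrightarrow> cinner x y = 0) \<Longrightarrow> y = 0"
  shows "closure K = UNIV"
proof -
  note cK = csubspace_closure[OF assms(1)] closed_closure
  have "x \<in> closure K" for x
  proof -
    have "x - proj (closure K) x = 0"
      by (rule assms(2)) (use proj(2)[OF cK] closure_subset in blast)
    then have "x = proj (closure K) x" by simp
    also have "\<dots> \<in> closure K" by (rule proj(1)[OF cK])
    finally show ?thesis .
  qed
  then show ?thesis by blast
qed

text \<open>Approximating \<open>v\<close> itself from \<open>D\<close> gives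
  \<open>(norm v)\<^sup>2 \<le> C * norm v\<close>. This turns weak estimates with a uniform
  constant into strong ones.\<close>

lemma dense_norm_le:
  fixes D :: "'h::complex_hilbert set"
  assumes D: "closure D = UNIV" and C: "C \<ge> 0"
    and le: "\<And>x. x \<in> D \<Longrightarrow> cmod (cinner x v) \<le> C * norm x"
  shows "norm v \<le> C"
proof (cases "v = 0")
  case True
  then show ?thesis using C by simp
next
  case False
  obtain s where s: "\<And>n. s n \<in> D" "s \<longlonglongrightarrow> v"
    using D by (metis UNIV_I closure_sequential)
  have "(\<lambda>n. cmod (cinner (s n) v)) \<longlonglongrightarrow> cmod (cinner v v)"
    by (intro tendsto_intros tendsto_cinner s)
  moreover have "(\<lambda>n. C * norm (s n)) \<longlonglongrightarrow> C * norm v" by (intro tendsto_intros s)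
  ultimately have "cmod (cinner v v) \<le> C * norm v"
    by (rule LIMSEQ_le) (use le s in blast)
  then show ?thesis using False by (simp add: cinner_self norm_mult power2_eq_square)
qed

lemma dense_cinner_eq:
  fixes D :: "'h::complex_hilbert set"
  assumes "closure D = UNIV" "\<And>y. y \<in> D \<Longrightarrow> cinner y u = cinner y v"
  shows "u = v"
proof -
  have "norm (u - v) \<le> 0"
    by (rule dense_norm_le[OF assms(1)]) (simp_all add: cinner_diff_right assms(2))
  then show ?thesis by simp
qed

lemma dense_bounded_clinear_eq:
  fixes D :: "'h::complex_hilbert set"
  assumes D: "closure D = UNIV" and X: "bounded_clinear X" and Y: "bounded_clinear Y"
    and eq: "\<And>x. x \<in> D \<Longrightarrow> X x = Y x"
  shows "X = Y"
proof
  fix x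
  obtain s where s: "\<And>n. s n \<in> D" "s \<longlonglongrightarrow> x"
    using D by (metis UNIV_I closure_sequential)
  have "(\<lambda>n. X (s n)) \<longlonglongrightarrow> X x" "(\<lambda>n. Y (s n)) \<longlonglongrightarrow> Y x"
    using X Y s(2) bounded_linear.tendsto bounded_clinear_bounded_linear by blast+
  then show "X x = Y x" using eq s(1) LIMSEQ_unique by fastforce
qed

lemma isometry_extend:
  fixes D :: "'h::complex_hilbert set"
  assumes D: "csubspace D" "closure D = UNIV"
    and lin: "\<And>z x y. x \<in> D \<Longrightarrow> y \<in> D \<Longrightarrow> f (z *\<^sub>C x + y) = z *\<^sub>C f x + f y"
    and iso: "\<And>x. x \<in> D \<Longrightarrow> norm (f x) = norm x"
  shows "\<exists>F. bounded_clinear F \<and> (\<forall>x\<in>D. F x = (f x :: 'h))"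
proof -
  have diff: "f (x - y) = f x - f y" if "x \<in> D" "y \<in> D" for x y
    using lin[of y x "-1"] that by simp
  have "uniformly_continuous_on D f"
    unfolding uniformly_continuous_on_def
  proof (intro allI impI)
    fix e :: real assume "e > 0"
    then show "\<exists>d>0. \<forall>x\<in>D. \<forall>x'\<in>D. dist x' x < d \<longrightarrow> dist (f x') (f x) < e"
      by (intro exI[of _ e]) (metis csubspaceD(5) D(1) diff dist_norm iso)
  qed
  then obtain F where F: "uniformly_continuous_on (closure D) F" "\<And>x. x \<in> D \<Longrightarrow> f x = F x"
    using uniformly_continuous_on_extension_on_closure[of D f] by metis
  have cont: "(\<lambda>n. F (s n)) \<longlonglongrightarrow> F x" if "s \<longlonglongrightarrow> x" for s x
    using uniformly_continuous_imp_continuous[OF F(1)] that D(2)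
    by (auto simp: continuous_on_sequentially o_def)
  have seq: "\<exists>s. (\<forall>n. s n \<in> D) \<and> s \<longlonglongrightarrow> x" for x
    using D(2) by (metis UNIV_I closure_sequential)
  have Flin: "F (z *\<^sub>C x + y) = z *\<^sub>C F x + F y" for z x y
  proof -
    obtain s t where s: "\<And>n. s n \<in> D" "s \<longlonglongrightarrow> x" and t: "\<And>n. t n \<in> D" "t \<longlonglongrightarrow> y"
      using seq by meson
    have "(\<lambda>n. F (z *\<^sub>C s n + t n)) \<longlonglongrightarrow> F (z *\<^sub>C x + y)"
      by (intro cont tendsto_intros tendsto_scaleC s t)
    moreover have "F (z *\<^sub>C s n + t n) = z *\<^sub>C F (s n) + F (t n)" for n
      using lin[of "s n" "t n" z] F(2) s t csubspaceD(2)[OF D(1)] by metis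
    moreover have "(\<lambda>n. z *\<^sub>C F (s n) + F (t n)) \<longlonglongrightarrow> z *\<^sub>C F x + F y"
      by (intro cont tendsto_intros tendsto_scaleC s t)
    ultimately show ?thesis using LIMSEQ_unique by simp
  qed
  have F0: "F 0 = 0" using Flin[of "-1" 0 0] by simp
  have "bounded_clinear F"
  proof (rule bounded_clinearI[where K = 1])
    fix x y z
    show "F (x + y) = F x + F y" using Flin[of 1 x y] by simp
    show "F (z *\<^sub>C x) = z *\<^sub>C F x" using Flin[of z x 0] F0 by simp
    obtain s where s: "\<And>n. s n \<in> D" "s \<longlonglongrightarrow> x" using seq by meson
    have "(\<lambda>n. norm (F (s n))) \<longlonglongrightarrow> norm (F x)" "(\<lambda>n. norm (s n)) \<longlonglongrightarrow> norm x"
      by (intro cont tendsto_intros s)+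
    moreover have "norm (F (s n)) = norm (s n)" for n using F(2) iso s by metis
    ultimately show "norm (F x) \<le> 1 * norm x" using LIMSEQ_unique by fastforce
  qed
  then show ?thesis using F(2) by metis
qed

section \<open>Unitary groups and their generators\<close>

lemma unitaryD:
  assumes "unitary U"
  shows "bounded_clinear U" "adj U (U x) = x" "U (adj U x) = x" "cinner (U x) (U y) = cinner x y"
    "norm (U x) = norm x"
proof -
  show b: "bounded_clinear U" and 1: "adj U (U x) = x" and 2: "U (adj U x) = x" for x
    using assms by (auto simp: unitary_def fun_eq_iff)
  show 3: "cinner (U x) (U y) = cinner x y" for x y
    by (metis 1 cinner_adj_right b)
  have "(norm (U x))\<^sup>2 = (norm x)\<^sup>2" using 3[of x x] by (metis Re_cinner_self)
  then show "norm (U x) = norm x" by simp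
qed

lemma unitaryI:
  "bounded_clinear U \<Longrightarrow> (\<And>x. adj U (U x) = x) \<Longrightarrow> (\<And>x. U (adj U x) = x) \<Longrightarrow> unitary U"
  by (auto simp: unitary_def)

lemma unitary_comp: "unitary U \<Longrightarrow> unitary V \<Longrightarrow> unitary (U \<circ> V)"
  by (rule unitaryI) (auto simp: unitaryD adj_comp intro: bounded_clinear_comp)

lemma unitary_adj: "unitary U \<Longrightarrow> unitary (adj U)"
  by (rule unitaryI) (auto simp: unitaryD adj intro: bounded_clinear_adj)

lemma unitary_groupD:
  assumes "unitary_group V"
  shows "unitary (V t)" "bounded_clinear (V t)" "V (s + t) x = V s (V t x)" "V 0 x = x"
    "V (- t) (V t x) = x" "adj (V t) = V (- t)" "continuous_on UNIV (\<lambda>t. V t x)"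
proof -
  show u: "unitary (V t)" and b: "bounded_clinear (V t)" and add: "V (s + t) x = V s (V t x)"
    and "continuous_on UNIV (\<lambda>t. V t x)" for s t x
    using assms by (auto simp: unitary_group_def unitaryD)
  have "V 0 (V 0 x) = V 0 x" for x using add[of 0 0 x] by simp
  then show 0: "V 0 x = x" for x by (metis u unitaryD(2))
  show inv: "V (- t) (V t x) = x" for t x using add[of "- t" t x] 0 by simp
  show "adj (V t) = V (- t)"
  proof
    fix x show "adj (V t) x = V (- t) x"
      using inv[of "- t" x] unitaryD(2)[OF u, of t "V (- t) x"] by simp
  qed
qed

lemma generator_invariant:
  assumes V: "unitary_group V" and x: "(x, y) \<in> generator V"
  shows "(V s x, V s y) \<in> generator V"
proof -
  have "((\<lambda>t. V s (V t x)) has_vector_derivative V s (\<i> *\<^sub>C y)) (at 0)"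
    using x bounded_linear.has_vector_derivative[OF bounded_clinear_bounded_linear[OF unitary_groupD(2)[OF V]]]
    by (simp add: generator_def)
  moreover have "V s (V t x) = V t (V s x)" for t
    using unitary_groupD(3)[OF V] by (metis add.commute)
  ultimately show ?thesis
    by (simp add: generator_def bounded_clinearD[OF unitary_groupD(2)[OF V]])
qed

lemma generator_derivative:
  assumes V: "unitary_group V" and x: "(x, y) \<in> generator V"
  shows "((\<lambda>t. V t x) has_vector_derivative \<i> *\<^sub>C V s y) (at s)"
proof -
  have "((\<lambda>t. V t (V s x)) has_vector_derivative \<i> *\<^sub>C V s y) (at ((\<lambda>t. t - s) s))"
    using generator_invariant[OF assms] by (simp add: generator_def)
  moreover have "((\<lambda>t. t - s) has_vector_derivative 1) (at s)"
    by (auto intro!: derivative_eq_intros)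
  ultimately have "((\<lambda>t. V t (V s x)) \<circ> (\<lambda>t. t - s) has_vector_derivative 1 *\<^sub>R (\<i> *\<^sub>C V s y)) (at s)"
    by (rule vector_diff_chain_at[rotated])
  moreover have "(\<lambda>t. V t (V s x)) \<circ> (\<lambda>t. t - s) = (\<lambda>t. V t x)"
    using unitary_groupD(3)[OF V, symmetric] by (auto simp: fun_eq_iff)
  ultimately show ?thesis by simp
qed

text \<open>A unitary group preserves inner products, so \<open>cinner (V t x) (V t y)\<close> has
  derivative zero; conjugation in the first argument gives the two factors \<open>\<i>\<close>
  opposite signs.\<close>

lemma generator_symmetric:
  assumes V: "unitary_group V" and x: "(x, x') \<in> generator V" and y: "(y, y') \<in> generator V"
  shows "cinner x' y = cinner x y'"
proof -
  have "((\<lambda>t. cinner (V t x) (V t y)) has_vector_derivative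
      cinner (V 0 x) (\<i> *\<^sub>C V 0 y') + cinner (\<i> *\<^sub>C V 0 x') (V 0 y)) (at 0)"
    by (intro bounded_bilinear.has_vector_derivative[OF bounded_bilinear_cinner]
        generator_derivative[OF V] x y)
  moreover have "(\<lambda>t. cinner (V t x) (V t y)) = (\<lambda>t. cinner x y)"
    using unitaryD(4)[OF unitary_groupD(1)[OF V]] by simp
  ultimately have "((\<lambda>t::real. cinner x y) has_vector_derivative
      cinner x (\<i> *\<^sub>C y') + cinner (\<i> *\<^sub>C x') y) (at 0)"
    by (simp add: unitary_groupD(4)[OF V])
  then have "cinner x (\<i> *\<^sub>C y') + cinner (\<i> *\<^sub>C x') y = 0"
    using has_vector_derivative_const vector_derivative_unique_at by blast
  then show ?thesis by (simp add: cinner_simps)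
qed

lemma closure_pair_sequence:
  fixes x y :: "'h::complex_hilbert"
  assumes "(x, y) \<in> closure G"
  obtains s t where "\<And>n. (s n, t n) \<in> G" "s \<longlonglongrightarrow> x" "t \<longlonglongrightarrow> y"
proof -
  obtain p where p: "\<And>n. p n \<in> G" "p \<longlonglongrightarrow> (x, y)"
    using assms by (auto simp: closure_sequential)
  show ?thesis
    by (rule that[of "fst \<circ> p" "snd \<circ> p"])
      (use p tendsto_fst[OF p(2)] tendsto_snd[OF p(2)] in \<open>auto simp: o_def\<close>)
qed

text \<open>Since \<open>X\<close> occurs only inside inner products, it need not respect any
  domain, and the relation passes to limits of graph elements.\<close>

lemma weak_intertwine_closure:
  fixes X :: "'h::complex_hilbert \<Rightarrow> 'h"
  assumes X: "bounded_clinear X"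
    and w: "\<And>x x' y y'. (x, x') \<in> G \<Longrightarrow> (y, y') \<in> G' \<Longrightarrow> cinner y (X x') = cinner y' (X x)"
    and x: "(x, x') \<in> closure G" and y: "(y, y') \<in> closure G'"
  shows "cinner y (X x') = cinner y' (X x)"
proof -
  obtain s s' where s: "\<And>n. (s n, s' n) \<in> G" "s \<longlonglongrightarrow> x" "s' \<longlonglongrightarrow> x'"
    using closure_pair_sequence[OF x] by metis
  obtain t t' where t: "\<And>n. (t n, t' n) \<in> G'" "t \<longlonglongrightarrow> y" "t' \<longlonglongrightarrow> y'"
    using closure_pair_sequence[OF y] by metis
  note lim = bounded_linear.tendsto[OF bounded_clinear_bounded_linear[OF X]]
  have "(\<lambda>n. cinner (t n) (X (s' n))) \<longlonglongrightarrow> cinner y (X x')"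
    by (intro tendsto_cinner lim s t)
  moreover have "(\<lambda>n. cinner (t' n) (X (s n))) \<longlonglongrightarrow> cinner y' (X x)"
    by (intro tendsto_cinner lim s t)
  ultimately show ?thesis using w[OF s(1) t(1)] LIMSEQ_unique by simp
qed

text \<open>Both sides agree because \<open>\<langle>V' t y, X V t x\<rangle>\<close> has derivative zero in \<open>t\<close>.\<close>

lemma unitary_group_intertwine:
  assumes V: "unitary_group V" "generator V = closure G" "closure (Domain G) = UNIV"
    and V': "unitary_group V'" "generator V' = closure G'" "closure (Domain G') = UNIV"
    and X: "bounded_clinear X"
    and w: "\<And>x x' y y'. (x, x') \<in> G \<Longrightarrow> (y, y') \<in> G' \<Longrightarrow> cinner y (X x') = cinner y' (X x)"
  shows "X \<circ> V t = V' t \<circ> X"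
proof (rule dense_bounded_clinear_eq[OF V(3)])
  show "bounded_clinear (X \<circ> V t)" "bounded_clinear (V' t \<circ> X)"
    using V(1) V'(1) X by (auto intro: bounded_clinear_comp unitary_groupD)
  fix x assume "x \<in> Domain G"
  then obtain x' where x: "(x, x') \<in> generator V"
    using V(2) closure_subset by blast
  have "adj (V' t) (X (V t x)) = X x"
  proof (rule dense_cinner_eq[OF V'(3)])
    fix y assume "y \<in> Domain G'"
    then obtain y' where y: "(y, y') \<in> generator V'"
      using V'(2) closure_subset by blast
    define h where "h s = cinner (V' s y) (X (V s x))" for s
    have "(h has_vector_derivative 0) (at s within UNIV)" for s
    proof -
      have "(h has_vector_derivative
          cinner (V' s y) (X (\<i> *\<^sub>C V s x')) + cinner (\<i> *\<^sub>C V' s y') (X (V s x))) (at s)"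
        unfolding h_def
        by (intro bounded_bilinear.has_vector_derivative[OF bounded_bilinear_cinner]
            bounded_linear.has_vector_derivative[OF bounded_clinear_bounded_linear[OF X]]
            generator_derivative[OF V(1)] generator_derivative[OF V'(1)] x y)
      moreover have "cinner (V' s y) (X (V s x')) = cinner (V' s y') (X (V s x))"
        using generator_invariant[OF V(1) x, of s] generator_invariant[OF V'(1) y, of s]
        unfolding V(2) V'(2) using weak_intertwine_closure[OF X w] by blast
      ultimately show ?thesis by (simp add: bounded_clinearD[OF X] cinner_simps)
    qed
    then obtain c where "\<forall>s\<in>UNIV. h s = c"
      using has_vector_derivative_zero_constant[of UNIV h] by auto
    then have "h t = h 0" by simp
    then show "cinner y (adj (V' t) (X (V t x))) = cinner y (X x)"
      by (simp add: h_def cinner_adj_right[OF unitary_groupD(2)[OF V'(1)]]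
          unitary_groupD(4)[OF V(1)] unitary_groupD(4)[OF V'(1)])
  qed
  then have "V' t (adj (V' t) (X (V t x))) = V' t (X x)" by simp
  then show "(X \<circ> V t) x = (V' t \<circ> X) x"
    using unitaryD(3)[OF unitary_groupD(1)[OF V'(1)]] by simp
qed

text \<open>Uniqueness in Stone's theorem: two groups with the same generator are intertwined by
  \<open>id\<close>, because a generator is symmetric.\<close>

lemma exp_i_eqI:
  assumes V: "unitary_group V" "generator V = closure G" and G: "closure (Domain G) = UNIV"
  shows "exp_i G = V 1"
  unfolding exp_i_def
proof (rule the_equality)
  show "\<exists>W. unitary_group W \<and> generator W = closure G \<and> V 1 = W 1" using V by blast
  fix U assume "\<exists>W. unitary_group W \<and> generator W = closure G \<and> U = W 1"
  then obtain W where W: "unitary_group W" "generator W = closure G" "U = W 1" by blast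
  have "id \<circ> V 1 = W 1 \<circ> id"
  proof (rule unitary_group_intertwine[OF V G W(1,2) G])
    fix x x' y y' assume "(x, x') \<in> G" "(y, y') \<in> G"
    then have "(x, x') \<in> generator V" "(y, y') \<in> generator V"
      using V(2) closure_subset by blast+
    then show "cinner y (id x') = cinner y' (id x)"
      using generator_symmetric[OF V(1)] by simp
  qed simp
  then show "U = V 1" using W(3) by simp
qed

subsection \<open>Exponentials of symmetric operators with entire vectors\<close>

text \<open>The cross terms cancel. For a symmetric operator \<open>T\<close>, the size of
  \<open>T u - \<i> *\<^sub>C u\<close> thus controls \<open>u\<close> and \<open>T u\<close>
  separately.\<close>

lemma norm_sub_i_symmetric:
  assumes "cinner u v = cinner v u"
  shows "(norm (v - \<i> *\<^sub>C u))\<^sup>2 = (norm v)\<^sup>2 + (norm u)\<^sup>2"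
proof -
  have "cinner (v - \<i> *\<^sub>C u) (v - \<i> *\<^sub>C u) = cinner v v + cinner u u"
    using assms by (simp add: cinner_simps algebra_simps)
  then have "Re (cinner (v - \<i> *\<^sub>C u) (v - \<i> *\<^sub>C u)) = Re (cinner v v) + Re (cinner u u)"
    by (metis plus_complex.simps(1))
  then show ?thesis by (simp only: Re_cinner_self)
qed

text \<open>Convergence is required at every radius, so the exponential series exists for all times
  at once and no continuation from small times is needed.\<close>

locale entire_symmetric =
  fixes D :: "'h::complex_hilbert set" and T :: "'h \<Rightarrow> 'h"
  assumes D: "csubspace D" "closure D = UNIV"
    and T_mem: "x \<in> D \<Longrightarrow> T x \<in> D"
    and T_linear: "x \<in> D \<Longrightarrow> y \<in> D \<Longrightarrow> T (z *\<^sub>C x + y) = z *\<^sub>C T x + T y"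
    and T_symmetric: "x \<in> D \<Longrightarrow> y \<in> D \<Longrightarrow> cinner (T x) y = cinner x (T y)"
    and T_entire: "x \<in> D \<Longrightarrow> 0 \<le> r \<Longrightarrow> summable (\<lambda>n. r ^ n / fact n * norm ((T ^^ n) x))"
begin

definition T_graph :: "'h uop" where "T_graph = {(x, T x) | x. x \<in> D}"

definition exp_term :: "'h \<Rightarrow> nat \<Rightarrow> real \<Rightarrow> 'h" where
  "exp_term x n t = ((\<i> * complex_of_real t) ^ n / fact n) *\<^sub>C (T ^^ n) x"

definition part :: "nat \<Rightarrow> real \<Rightarrow> 'h \<Rightarrow> 'h" where
  "part N t x = (\<Sum>n<N. exp_term x n t)"

definition ser :: "real \<Rightarrow> 'h \<Rightarrow> 'h" where
  "ser t x = (\<Sum>n. exp_term x n t)"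

lemma T_zero: "T 0 = 0"
  using T_linear[of 0 0 "-1"] csubspaceD(1)[OF D(1)] by simp

lemma T_scale: "x \<in> D \<Longrightarrow> T (z *\<^sub>C x) = z *\<^sub>C T x"
  using T_linear[of x 0 z] csubspaceD(1)[OF D(1)] by (simp add: T_zero)

lemma T_add: "x \<in> D \<Longrightarrow> y \<in> D \<Longrightarrow> T (x + y) = T x + T y"
  using T_linear[of x y 1] by simp

lemma T_pow_mem: "x \<in> D \<Longrightarrow> (T ^^ n) x \<in> D"
  by (induction n) (auto intro: T_mem)

lemma T_pow_linear:
  "x \<in> D \<Longrightarrow> y \<in> D \<Longrightarrow> (T ^^ n) (z *\<^sub>C x + y) = z *\<^sub>C (T ^^ n) x + (T ^^ n) y"
  by (induction n) (auto simp: T_linear T_pow_mem)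

lemma part_mem: "x \<in> D \<Longrightarrow> part N t x \<in> D"
  by (induction N)
    (auto simp: part_def exp_term_def csubspaceD[OF D(1)] T_pow_mem)

lemma T_part: "x \<in> D \<Longrightarrow> T (part N t x) = part N t (T x)"
proof (induction N)
  case (Suc N)
  have "part (Suc N) t x = exp_term x N t + part N t x" for x by (simp add: part_def)
  moreover have "exp_term x N t \<in> D" "T (exp_term x N t) = exp_term (T x) N t"
    using Suc.prems
    by (auto simp: exp_term_def csubspaceD(3)[OF D(1)] T_pow_mem T_scale funpow_swap1)
  ultimately show ?case using Suc by (simp add: T_add part_mem)
qed (simp add: part_def T_zero)

lemma norm_exp_term: "norm (exp_term x n t) = \<bar>t\<bar> ^ n / fact n * norm ((T ^^ n) x)"
  by (simp add: exp_term_def norm_divide norm_power norm_mult)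

lemma part_uniform: "x \<in> D \<Longrightarrow> uniform_limit {-r..r} (\<lambda>n t. part n t x) (\<lambda>t. ser t x) sequentially"
  unfolding part_def ser_def
proof (rule Weierstrass_m_test)
  assume "x \<in> D"
  then show "summable (\<lambda>n. \<bar>r\<bar> ^ n / fact n * norm ((T ^^ n) x))" by (rule T_entire) simp
  fix n t assume "t \<in> {-r..r}"
  then show "norm (exp_term x n t) \<le> \<bar>r\<bar> ^ n / fact n * norm ((T ^^ n) x)"
    unfolding norm_exp_term
    by (intro mult_right_mono divide_right_mono power_mono) auto
qed

lemma part_tendsto: "x \<in> D \<Longrightarrow> (\<lambda>n. part n t x) \<longlonglongrightarrow> ser t x"
proof -
  have "t \<in> {-\<bar>t\<bar>..\<bar>t\<bar>}" unfolding atLeastAtMost_iff by linarith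
  then show "x \<in> D \<Longrightarrow> ?thesis" using tendsto_uniform_limitI[OF part_uniform] by blast
qed

lemma ser_zero: "ser 0 x = x"
proof -
  have "(\<lambda>n. exp_term x n 0) sums (\<Sum>n\<in>{0}. exp_term x n 0)"
    by (rule sums_finite) (auto simp: exp_term_def power_0_left)
  then show ?thesis by (simp add: ser_def sums_unique[symmetric] exp_term_def)
qed

lemma ser_linear:
  assumes "x \<in> D" "y \<in> D"
  shows "ser t (z *\<^sub>C x + y) = z *\<^sub>C ser t x + ser t y"
proof -
  have *: "part n t (z *\<^sub>C x + y) = z *\<^sub>C part n t x + part n t y" for n
    by (induction n)
      (simp_all add: part_def exp_term_def T_pow_linear assms scaleC_add_right scaleC_scaleC mult_ac)
  have "(\<lambda>n. part n t (z *\<^sub>C x + y)) \<longlonglongrightarrow> z *\<^sub>C ser t x + ser t y"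
    unfolding * by (intro tendsto_intros tendsto_scaleC part_tendsto assms)
  moreover have "(\<lambda>n. part n t (z *\<^sub>C x + y)) \<longlonglongrightarrow> ser t (z *\<^sub>C x + y)"
    by (intro part_tendsto csubspaceD(2)[OF D(1)] assms)
  ultimately show ?thesis using LIMSEQ_unique by blast
qed

lemma part_derivative:
  "((\<lambda>t. part (Suc n) t x) has_vector_derivative \<i> *\<^sub>C part n t (T x)) (at t within S)"
proof (induction n)
  case 0
  show ?case by (simp add: part_def exp_term_def)
next
  case (Suc n)
  have "((\<lambda>z. (\<i> * z) ^ Suc n / fact (Suc n)) has_field_derivative
      (of_nat (Suc n) * (\<i> * of_real t) ^ n * \<i>) / fact (Suc n)) (at (of_real t))"
    by (intro DERIV_cdivide) (auto intro!: derivative_eq_intros simp del: power_Suc)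
  also have "(of_nat (Suc n) * (\<i> * of_real t) ^ n * \<i>) / fact (Suc n)
      = \<i> * (\<i> * of_real t) ^ n / (fact n :: complex)"
    unfolding fact_Suc of_nat_mult by (simp add: mult.commute del: of_nat_Suc)
  finally have "((\<lambda>z. (\<i> * z) ^ Suc n / fact (Suc n)) has_field_derivative
      \<i> * (\<i> * of_real t) ^ n / fact n) (at (of_real t))" .
  then have "((\<lambda>t. (\<i> * of_real t) ^ Suc n / fact (Suc n)) has_vector_derivative
      \<i> * (\<i> * of_real t) ^ n / fact n) (at t within S)"
    by (rule has_vector_derivative_real_field)
  then have "((\<lambda>t. exp_term x (Suc n) t) has_vector_derivative
      (\<i> * (\<i> * of_real t) ^ n / fact n) *\<^sub>C (T ^^ Suc n) x) (at t within S)"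
    unfolding exp_term_def by (rule bounded_linear.has_vector_derivative[OF bounded_linear_scaleC_left])
  moreover have "(\<i> * (\<i> * of_real t) ^ n / fact n) *\<^sub>C (T ^^ Suc n) x = \<i> *\<^sub>C exp_term (T x) n t"
    by (simp add: exp_term_def scaleC_scaleC funpow_swap1)
  ultimately have "((\<lambda>t. part (Suc n) t x + exp_term x (Suc n) t) has_vector_derivative
      \<i> *\<^sub>C part n t (T x) + \<i> *\<^sub>C exp_term (T x) n t) (at t within S)"
    by (intro has_vector_derivative_add Suc.IH) simp
  then show ?case by (simp add: part_def scaleC_add_right)
qed

lemma ser_derivative:
  assumes x: "x \<in> D"
  shows "((\<lambda>t. ser t x) has_vector_derivative \<i> *\<^sub>C ser t (T x)) (at t)"
proof -
  \<comment> \<open>An open interval around \<open>t\<close>, because the derivatives are known to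
    converge uniformly on bounded sets of times.\<close>
  define r where "r = \<bar>t\<bar> + 1"
  let ?S = "{-r<..<r}"
  have S: "t \<in> ?S" "open ?S" "convex ?S" by (auto simp: r_def)
  have "\<exists>g. \<forall>s\<in>?S. (\<lambda>n. part (Suc n) s x) \<longlonglongrightarrow> g s \<and>
      (g has_derivative (\<lambda>h. h *\<^sub>R (\<i> *\<^sub>C ser s (T x)))) (at s within ?S)"
  proof (rule has_derivative_sequence[OF S(3), where f = "\<lambda>n s. part (Suc n) s x"
        and f' = "\<lambda>n s h. h *\<^sub>R (\<i> *\<^sub>C part n s (T x))"])
    show "((\<lambda>s. part (Suc n) s x) has_derivative (\<lambda>h. h *\<^sub>R (\<i> *\<^sub>C part n s (T x)))) (at s within ?S)"
      for n s using part_derivative[of n x s ?S] by (simp add: has_vector_derivative_def)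
    show "t \<in> ?S" by (rule S)
    show "(\<lambda>n. part (Suc n) t x) \<longlonglongrightarrow> ser t x" using part_tendsto[OF x] by (rule LIMSEQ_Suc)
    fix e :: real assume "e > 0"
    from uniform_limitD[OF part_uniform[OF T_mem[OF x], of r] this]
    show "\<forall>\<^sub>F n in sequentially. \<forall>s\<in>?S. \<forall>h. norm (h *\<^sub>R (\<i> *\<^sub>C part n s (T x)) - h *\<^sub>R (\<i> *\<^sub>C ser s (T x)))
        \<le> e * norm h"
    proof eventually_elim
      case (elim n)
      show ?case
      proof (intro ballI allI)
        fix s h assume "s \<in> ?S"
        then have "norm (part n s (T x) - ser s (T x)) \<le> e"
          using elim by (auto simp: dist_norm intro: less_imp_le)
        then have "\<bar>h\<bar> * norm (part n s (T x) - ser s (T x)) \<le> \<bar>h\<bar> * e"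
          by (rule mult_left_mono) simp
        moreover have "norm (h *\<^sub>R (\<i> *\<^sub>C part n s (T x)) - h *\<^sub>R (\<i> *\<^sub>C ser s (T x)))
            = \<bar>h\<bar> * norm (part n s (T x) - ser s (T x))"
          by (simp flip: scaleR_diff_right scaleC_diff_right)
        ultimately show "norm (h *\<^sub>R (\<i> *\<^sub>C part n s (T x)) - h *\<^sub>R (\<i> *\<^sub>C ser s (T x))) \<le> e * norm h"
          by (simp add: mult.commute)
      qed
    qed
  qed
  then obtain g where g: "\<And>s. s \<in> ?S \<Longrightarrow> (\<lambda>n. part (Suc n) s x) \<longlonglongrightarrow> g s"
    "\<And>s. s \<in> ?S \<Longrightarrow> (g has_vector_derivative \<i> *\<^sub>C ser s (T x)) (at s within ?S)"
    unfolding has_vector_derivative_def by blast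
  have "g s = ser s x" if "s \<in> ?S" for s
    using g(1)[OF that] LIMSEQ_Suc[OF part_tendsto[OF x]] LIMSEQ_unique by blast
  then have "((\<lambda>t. ser t x) has_vector_derivative \<i> *\<^sub>C ser t (T x)) (at t within ?S)"
    using has_vector_derivative_transform[OF S(1) _ g(2)[OF S(1)]] by simp
  then show ?thesis unfolding at_within_open[OF S(1,2)] .
qed

text \<open>Here \<open>v\<close> stands for the adjoint of \<open>T\<close> applied to
  \<open>w\<close>. Neither vector has to lie in \<open>D\<close>, which later admits arbitrary
  vectors from the domain of the adjoint.\<close>

lemma ser_adjoint:
  assumes w: "\<And>x. x \<in> D \<Longrightarrow> cinner v x = cinner w (T x)" and x: "x \<in> D"
  shows "cinner v (ser t x) = cinner w (ser t (T x))"
proof -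
  have "(\<lambda>n. cinner v (part n t x)) \<longlonglongrightarrow> cinner v (ser t x)"
    by (intro tendsto_cinner tendsto_intros part_tendsto x)
  moreover have "(\<lambda>n. cinner w (part n t (T x))) \<longlonglongrightarrow> cinner w (ser t (T x))"
    by (intro tendsto_cinner tendsto_intros part_tendsto T_mem x)
  moreover have "cinner v (part n t x) = cinner w (part n t (T x))" for n
    using w[OF part_mem[OF x]] T_part[OF x] by simp
  ultimately show ?thesis using LIMSEQ_unique by simp
qed

text \<open>The derivative in \<open>s\<close> vanishes by symmetry of \<open>T\<close>. For
  \<open>t = 0\<close> this is isometry of the flow on \<open>D\<close>; in general it encodes the
  adjoint and the group law at once.\<close>

lemma cinner_ser_ser:
  assumes x: "x \<in> D" and y: "y \<in> D"
  shows "cinner (ser s y) (ser (t + s) x) = cinner y (ser t x)"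
proof -
  define F where "F s = cinner (ser s y) (ser (t + s) x)" for s
  have "(F has_vector_derivative 0) (at s within UNIV)" for s
  proof -
    have 1: "((\<lambda>s. ser (t + s) x) has_vector_derivative \<i> *\<^sub>C ser (t + s) (T x)) (at s)"
    proof -
      have "((\<lambda>s. t + s) has_vector_derivative 1) (at s)" by (auto intro!: derivative_eq_intros)
      from vector_diff_chain_at[OF this ser_derivative[OF x, of "t + s"]]
      show ?thesis by (simp add: o_def)
    qed
    have "(F has_vector_derivative
        cinner (ser s y) (\<i> *\<^sub>C ser (t + s) (T x)) + cinner (\<i> *\<^sub>C ser s (T y)) (ser (t + s) x)) (at s)"
      unfolding F_def
      by (intro bounded_bilinear.has_vector_derivative[OF bounded_bilinear_cinner] 1 ser_derivative y)
    moreover have "cinner (ser s (T y)) (ser (t + s) x) = cinner (ser s y) (ser (t + s) (T x))"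
    proof (rule ser_adjoint[OF _ x])
      fix u assume u: "u \<in> D"
      have "cinner (T u) (ser s y) = cinner u (ser s (T y))"
        by (rule ser_adjoint[OF _ y]) (simp add: T_symmetric u)
      then show "cinner (ser s (T y)) u = cinner (ser s y) (T u)"
        by (metis cinner_commute)
    qed
    ultimately show ?thesis by (simp add: cinner_simps)
  qed
  then obtain c where "\<forall>s\<in>UNIV. F s = c"
    using has_vector_derivative_zero_constant[of UNIV F] by auto
  then have "F s = F 0" by simp
  then show ?thesis by (simp add: F_def ser_zero)
qed

lemma norm_ser: "x \<in> D \<Longrightarrow> norm (ser t x) = norm x"
proof -
  assume "x \<in> D"
  then have "cinner (ser t x) (ser t x) = cinner x x"
    using cinner_ser_ser[of x x t 0] by (simp add: ser_zero)
  then have "(norm (ser t x))\<^sup>2 = (norm x)\<^sup>2" by (metis Re_cinner_self)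
  then show ?thesis by simp
qed

definition V :: "real \<Rightarrow> 'h \<Rightarrow> 'h" where
  "V t = (SOME F. bounded_clinear F \<and> (\<forall>x\<in>D. F x = ser t x))"

lemma V: shows bounded_clinear_V: "bounded_clinear (V t)" and V_eq: "x \<in> D \<Longrightarrow> V t x = ser t x"
proof -
  have "\<exists>F. bounded_clinear F \<and> (\<forall>x\<in>D. F x = ser t x)"
    by (rule isometry_extend[OF D ser_linear norm_ser])
  from someI_ex[OF this] show "bounded_clinear (V t)" "x \<in> D \<Longrightarrow> V t x = ser t x"
    by (auto simp: V_def)
qed

lemma V_adj_comp: "adj (V s) \<circ> V (t + s) = V t"
proof (rule dense_bounded_clinear_eq[OF D(2)])
  fix x assume x: "x \<in> D"
  show "(adj (V s) \<circ> V (t + s)) x = V t x"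
  proof (rule dense_cinner_eq[OF D(2)])
    fix y assume "y \<in> D"
    then show "cinner y ((adj (V s) \<circ> V (t + s)) x) = cinner y (V t x)"
      using x by (simp add: cinner_adj_right bounded_clinear_V V_eq cinner_ser_ser)
  qed
qed (auto intro: bounded_clinear_comp bounded_clinear_V bounded_clinear_adj)

lemma V_zero: "V 0 = id"
  by (rule dense_bounded_clinear_eq[OF D(2) bounded_clinear_V]) (simp_all add: V_eq ser_zero)

lemma V_adj: "adj (V s) = V (- s)"
  using V_adj_comp[of s "- s"] by (simp add: V_zero)

lemma unitary_V: "unitary (V t)"
proof -
  have inv: "V (- s) \<circ> V s = id" for s
    using V_adj_comp[of s 0] by (simp add: V_zero V_adj)
  have "V (- t) \<circ> V t = id" "V t \<circ> V (- t) = id" using inv[of t] inv[of "- t"] by simp_all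
  then show ?thesis by (simp add: unitary_def bounded_clinear_V V_adj)
qed

lemma unitary_group_V: "unitary_group V"
  unfolding unitary_group_def
proof (intro conjI allI)
  fix s t
  have "V s \<circ> V t = V s \<circ> (adj (V s) \<circ> V (t + s))" by (simp only: V_adj_comp)
  also have "\<dots> = V (t + s)" using unitaryD(3)[OF unitary_V] by auto
  finally show "V (s + t) = V s \<circ> V t" by (simp add: add.commute)
next
  fix x
  show "continuous_on UNIV (\<lambda>t. V t x)"
    unfolding continuous_on_iff
  proof (intro ballI allI impI)
    fix t e :: real assume e: "e > 0"
    obtain y where y: "y \<in> D" "norm (x - y) < e / 3"
    proof -
      have "x \<in> closure D" using D(2) by simp
      then obtain y where "y \<in> D" "dist y x < e / 3"
        using e unfolding closure_approachable by (metis divide_pos_pos zero_less_numeral)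
      then show ?thesis using that by (simp add: dist_norm norm_minus_commute)
    qed
    have "isCont (\<lambda>t. ser t y) t"
      using ser_derivative[OF y(1), of t] has_vector_derivative_continuous by blast
    then obtain d where d: "d > 0" "\<And>s. \<bar>s - t\<bar> < d \<Longrightarrow> norm (V s y - V t y) < e / 3"
      using e unfolding continuous_at_eps_delta
      by (metis V_eq y(1) dist_norm real_norm_def divide_pos_pos zero_less_numeral)
    have "norm (V s x - V t x) < e" if "\<bar>s - t\<bar> < d" for s
    proof -
      have n: "norm (V s (x - y)) = norm (x - y)" for s by (rule unitaryD[OF unitary_V])
      have "V s x - V t x = V s (x - y) + (V s y - V t y) - V t (x - y)"
        by (simp add: bounded_clinearD[OF bounded_clinear_V])
      also have "norm \<dots> \<le> norm (V s (x - y)) + norm (V s y - V t y) + norm (V t (x - y))"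
        by (meson norm_triangle_ineq norm_triangle_ineq4 add_right_mono order_trans)
      finally show ?thesis using y(2) d(2)[OF that] by (simp add: n)
    qed
    then show "\<exists>d>0. \<forall>s\<in>UNIV. dist s t < d \<longrightarrow> dist (V s x) (V t x) < e"
      using d(1) by (auto simp: dist_norm)
  qed
qed (rule unitary_V)

lemma T_graph_generator: "T_graph \<subseteq> generator V"
proof -
  have "((\<lambda>t. V t x) has_vector_derivative \<i> *\<^sub>C T x) (at 0)" if "x \<in> D" for x
    using ser_derivative[OF that, of 0] by (simp add: V_eq that ser_zero)
  then show ?thesis by (auto simp: T_graph_def generator_def)
qed

text \<open>The core of essential self-adjointness. The first-order remainder of
  \<open>V t y\<close> is tested against \<open>x\<close> in \<open>D\<close>: the group is moved
  onto \<open>x\<close>, where it can be differentiated, and strong continuity of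
  \<open>V t w\<close> bounds the derivative by \<open>e * norm x\<close>, uniformly enough to
  remove \<open>x\<close> by density.\<close>

lemma adjoint_generator: "adjoint T_graph \<subseteq> generator V"
proof (clarify)
  fix y w assume "(y, w) \<in> adjoint T_graph"
  then have w: "cinner w x = cinner y (T x)" if "x \<in> D" for x
    using that by (auto simp: adjoint_def T_graph_def)
  have "((\<lambda>t. V t y) has_derivative (\<lambda>t. t *\<^sub>R \<i> *\<^sub>C w)) (at 0)"
    unfolding has_derivative_at_alt
  proof (intro conjI allI impI)
    show "bounded_linear (\<lambda>t. t *\<^sub>R \<i> *\<^sub>C w)" by (rule bounded_linear_scaleR_left)
    fix e :: real assume e: "e > 0"
    have "isCont (\<lambda>t. V t w) 0"
      using unitary_groupD(7)[OF unitary_group_V, of w]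
      by (simp add: continuous_on_eq_continuous_at)
    then obtain d where d: "d > 0" "\<And>s. \<bar>s\<bar> < d \<Longrightarrow> norm (V s w - w) < e"
      using e unfolding continuous_at_eps_delta by (metis V_zero dist_norm id_apply diff_zero real_norm_def)
    have "norm (V t y - y - t *\<^sub>R \<i> *\<^sub>C w) \<le> e * \<bar>t\<bar>" if t: "\<bar>t\<bar> < d" for t
    proof (rule dense_norm_le[OF D(2)])
      show "0 \<le> e * \<bar>t\<bar>" using e by simp
      fix x assume x: "x \<in> D"
      define h where "h s = cinner x (V s y - y - s *\<^sub>R \<i> *\<^sub>C w)" for s
      have h: "(h has_vector_derivative \<i> * cinner x (V s w - w)) (at s within S)" for s S
      proof -
        have eq: "cinner x (V s v) = cinner (ser (- s) x) v" for s v
          using V_adj[of s] by (metis V_eq bounded_clinear_V cinner_adj_left x)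
        have "((\<lambda>s. - s) has_vector_derivative -1) (at s)" by (auto intro!: derivative_eq_intros)
        from vector_diff_chain_at[OF this ser_derivative[OF x, of "- s"]]
        have "((\<lambda>s. ser (- s) x) has_vector_derivative - (\<i> *\<^sub>C ser (- s) (T x))) (at s)"
          by (simp add: o_def)
        then have "((\<lambda>s. cinner (ser (- s) x) y) has_vector_derivative
            cinner (- (\<i> *\<^sub>C ser (- s) (T x))) y) (at s)"
          by (rule bounded_linear.has_vector_derivative[OF
                bounded_bilinear.bounded_linear_left[OF bounded_bilinear_cinner]])
        moreover have "cinner (ser (- s) (T x)) y = cinner (ser (- s) x) w"
          using ser_adjoint[OF w x, of "- s"] by (metis cinner_commute)
        ultimately have "((\<lambda>s. cinner x (V s y)) has_vector_derivative \<i> * cinner x (V s w)) (at s)"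
          by (simp add: eq cinner_simps)
        moreover have "((\<lambda>s. cinner x y + s *\<^sub>R (\<i> * cinner x w)) has_vector_derivative
            \<i> * cinner x w) (at s)"
          by (auto intro!: derivative_eq_intros)
        ultimately have "((\<lambda>s. cinner x (V s y) - (cinner x y + s *\<^sub>R (\<i> * cinner x w)))
            has_vector_derivative \<i> * cinner x (V s w) - \<i> * cinner x w) (at s)"
          by (rule has_vector_derivative_diff)
        moreover have "(\<lambda>s. cinner x (V s y) - (cinner x y + s *\<^sub>R (\<i> * cinner x w))) = h"
          by (auto simp: h_def cinner_simps scaleR_conv_of_real algebra_simps simp flip: scaleC_of_real)
        ultimately show ?thesis
          by (simp add: cinner_simps algebra_simps has_vector_derivative_at_within)
      qed
      have "norm (h t - h 0) \<le> e * norm x * norm (t - 0)"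
      proof (rule differentiable_bound[where S = "{-\<bar>t\<bar>..\<bar>t\<bar>}"
            and f' = "\<lambda>s a. a *\<^sub>R (\<i> * cinner x (V s w - w))"])
        show "(h has_derivative (\<lambda>a. a *\<^sub>R (\<i> * cinner x (V s w - w)))) (at s within {-\<bar>t\<bar>..\<bar>t\<bar>})" for s
          using h by (simp add: has_vector_derivative_def)
        fix s assume "s \<in> {-\<bar>t\<bar>..\<bar>t\<bar>}"
        then have "norm (V s w - w) \<le> e" using d(2)[of s] t by fastforce
        then have "cmod (cinner x (V s w - w)) \<le> norm x * e"
          using cmod_cinner_le[of x "V s w - w"] mult_left_mono[of _ e "norm x"]
          by (meson norm_ge_zero order_trans)
        then show "onorm (\<lambda>a. a *\<^sub>R (\<i> * cinner x (V s w - w))) \<le> e * norm x"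
          by (intro onorm_bound)
            (use e in \<open>auto simp: norm_mult mult.commute intro!: mult_left_mono\<close>)
      qed auto
      then show "cmod (cinner x (V t y - y - t *\<^sub>R \<i> *\<^sub>C w)) \<le> e * \<bar>t\<bar> * norm x"
        by (simp add: h_def V_zero mult_ac)
    qed
    then show "\<exists>d>0. \<forall>t. norm (t - 0) < d \<longrightarrow>
        norm (V t y - V 0 y - (t - 0) *\<^sub>R \<i> *\<^sub>C w) \<le> e * norm (t - 0)"
      using d(1) by (intro exI[of _ d]) (auto simp: V_zero)
  qed
  then show "(y, w) \<in> generator V" by (simp add: generator_def has_vector_derivative_def)
qed

text \<open>A vector orthogonal to the range would be an eigenvector of the generator for the
  eigenvalue \<open>- \<i>\<close>, which symmetry excludes.\<close>

lemma range_T_sub_i_dense: "closure ((\<lambda>x. T x - \<i> *\<^sub>C x) ` D) = UNIV"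
proof (rule dense_of_orthogonal_trivial)
  show "csubspace ((\<lambda>x. T x - \<i> *\<^sub>C x) ` D)"
    unfolding csubspace_def
  proof (intro conjI ballI allI)
    show "0 \<in> (\<lambda>x. T x - \<i> *\<^sub>C x) ` D"
      using csubspaceD(1)[OF D(1)] by (intro image_eqI[of _ _ 0]) (simp_all add: T_zero)
    fix u v z assume "u \<in> (\<lambda>x. T x - \<i> *\<^sub>C x) ` D" "v \<in> (\<lambda>x. T x - \<i> *\<^sub>C x) ` D"
    then obtain x y where "x \<in> D" "y \<in> D" "u = T x - \<i> *\<^sub>C x" "v = T y - \<i> *\<^sub>C y" by auto
    then show "z *\<^sub>C u + v \<in> (\<lambda>x. T x - \<i> *\<^sub>C x) ` D"
      by (intro image_eqI[of _ _ "z *\<^sub>C x + y"])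
        (simp_all add: T_linear csubspaceD(2)[OF D(1)] scaleC_scaleC scaleC_add_right
          scaleC_diff_right mult.commute)
  qed
  fix y assume y: "\<And>x. x \<in> (\<lambda>x. T x - \<i> *\<^sub>C x) ` D \<Longrightarrow> cinner x y = 0"
  have "cinner (T x - \<i> *\<^sub>C x) y = 0" if "x \<in> D" for x using y that by blast
  then have "cinner (T x) y = - \<i> * cinner x y" if "x \<in> D" for x
    using that by (simp add: cinner_simps add_eq_0_iff2)
  then have "cnj (cinner y (T x)) = cnj (\<i> * cinner y x)" if "x \<in> D" for x
    using that by (metis cinner_commute complex_cnj_i complex_cnj_mult)
  then have "cinner y (T x) = \<i> * cinner y x" if "x \<in> D" for x
    using that complex_cnj_cancel_iff by blast
  then have "(y, (- \<i>) *\<^sub>C y) \<in> adjoint T_graph"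
    by (auto simp: adjoint_def T_graph_def cinner_simps)
  then have g: "(y, (- \<i>) *\<^sub>C y) \<in> generator V" using adjoint_generator by blast
  have "cinner ((- \<i>) *\<^sub>C y) y = cinner y ((- \<i>) *\<^sub>C y)"
    by (rule generator_symmetric[OF unitary_group_V g g])
  then have "\<i> * cinner y y = - (\<i> * cinner y y)" by (simp add: cinner_simps)
  then show "y = 0" by (simp add: eq_neg_iff_add_eq_0)
qed

text \<open>For one inclusion, \<open>w - \<i> *\<^sub>C x\<close> is approximated from the dense
  range of \<open>T - \<i>\<close>; symmetry splits the squared error into that of the vector and
  that of its image. For the other, the closure of the graph is still contained in the
  adjoint.\<close>

lemma generator_V: "generator V = closure T_graph"
proof
  show "generator V \<subseteq> closure T_graph"
  proof clarify
    fix x w assume x: "(x, w) \<in> generator V"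
    obtain s where s: "\<And>n. s n \<in> (\<lambda>x. T x - \<i> *\<^sub>C x) ` D" "s \<longlonglongrightarrow> w - \<i> *\<^sub>C x"
      using range_T_sub_i_dense by (metis UNIV_I closure_sequential)
    have "\<forall>n. \<exists>x. x \<in> D \<and> s n = T x - \<i> *\<^sub>C x" using s(1) by blast
    from choice[OF this] obtain u where u: "\<And>n. u n \<in> D" "\<And>n. s n = T (u n) - \<i> *\<^sub>C u n"
      by blast
    have ne: "(norm (s n - (w - \<i> *\<^sub>C x)))\<^sup>2 = (norm (T (u n) - w))\<^sup>2 + (norm (u n - x))\<^sup>2" for n
    proof -
      have "(u n, T (u n)) \<in> generator V" using T_graph_generator u(1) by (auto simp: T_graph_def)
      from generator_symmetric[OF unitary_group_V this this]
        generator_symmetric[OF unitary_group_V this x] generator_symmetric[OF unitary_group_V x this]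
        generator_symmetric[OF unitary_group_V x x]
      have "cinner (u n - x) (T (u n) - w) = cinner (T (u n) - w) (u n - x)"
        by (simp add: cinner_simps)
      from norm_sub_i_symmetric[OF this] show ?thesis
        by (simp add: u(2) scaleC_diff_right algebra_simps)
    qed
    have lim: "(\<lambda>n. norm (s n - (w - \<i> *\<^sub>C x))) \<longlonglongrightarrow> 0"
      using s(2) by (simp add: LIM_zero_iff tendsto_norm_zero_iff)
    have le1: "norm (T (u n) - w) \<le> norm (s n - (w - \<i> *\<^sub>C x))" for n
      by (rule power2_le_imp_le) (simp_all add: ne)
    have le2: "norm (u n - x) \<le> norm (s n - (w - \<i> *\<^sub>C x))" for n
      by (rule power2_le_imp_le) (simp_all add: ne)
    have "(\<lambda>n. T (u n) - w) \<longlonglongrightarrow> 0" "(\<lambda>n. u n - x) \<longlonglongrightarrow> 0"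
      using le1 le2 by (auto intro: Lim_null_comparison[OF always_eventually lim])
    then have "(\<lambda>n. (u n, T (u n))) \<longlonglongrightarrow> (x, w)"
      by (intro tendsto_Pair) (simp_all add: LIM_zero_iff)
    moreover have "(u n, T (u n)) \<in> T_graph" for n using u(1) by (auto simp: T_graph_def)
    ultimately show "(x, w) \<in> closure T_graph"
      unfolding closure_sequential by (intro exI[of _ "\<lambda>n. (u n, T (u n))"]) simp
  qed
  show "closure T_graph \<subseteq> generator V"
  proof clarify
    fix x w assume x: "(x, w) \<in> closure T_graph"
    have "cinner x (id y') = cinner w (id y)" if "(y, y') \<in> T_graph" for y y'
    proof (rule weak_intertwine_closure[where X = id and G = T_graph, OF _ _ _ x])
      show "(y, y') \<in> closure T_graph" using that closure_subset by blast
    qed (auto simp: T_graph_def T_symmetric)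
    then have "(x, w) \<in> adjoint T_graph" by (auto simp: adjoint_def)
    then show "(x, w) \<in> generator V" using adjoint_generator by blast
  qed
qed

text \<open>\<open>exp_i\<close> is applied to expressions on their maximal domains, which may
  exceed \<open>D\<close>. A symmetric extension lies between \<open>T\<close> and its adjoint,
  hence has the same closure and the same exponential.\<close>

lemma closure_symmetric_extension:
  assumes G: "T_graph \<subseteq> G"
    and sym: "\<And>x x' y y'. (x, x') \<in> G \<Longrightarrow> (y, y') \<in> G \<Longrightarrow> cinner x' y = cinner x y'"
  shows "closure G = closure T_graph" "exp_i G = V 1"
proof -
  have "G \<subseteq> adjoint T_graph" using G sym by (fastforce simp: adjoint_def)
  then have "G \<subseteq> closure T_graph" using adjoint_generator generator_V by blast
  then show eq: "closure G = closure T_graph" using G by (meson closure_mono closure_minimal closed_closure subset_antisym)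
  have "D \<subseteq> Domain G" using G by (auto simp: T_graph_def)
  then have "closure (Domain G) = UNIV" using D(2) by (metis closure_mono top.extremum_uniqueI)
  then show "exp_i G = V 1"
    by (intro exp_i_eqI unitary_group_V) (simp_all add: generator_V eq)
qed

text \<open>\<open>B\<close> acts as the adjoint of \<open>A\<close>. The vector
  \<open>V t x\<close> may leave \<open>D\<close>, where \<open>A\<close> is controlled, so
  commutation is expressed in matrix elements.\<close>

lemma V_weakly_commutes:
  assumes A: "\<And>x. x \<in> D \<Longrightarrow> A x \<in> D" "\<And>x. x \<in> D \<Longrightarrow> T (A x) = A (T x)"
    and B: "\<And>x y. x \<in> D \<Longrightarrow> y \<in> D \<Longrightarrow> cinner y (A x) = cinner (B y) x"
    and x: "x \<in> D" and y: "y \<in> D"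
  shows "cinner y (V t (A x)) = cinner (B y) (V t x)"
proof -
  have pow: "(T ^^ n) (A x) = A ((T ^^ n) x)" for n
    by (induction n) (simp_all add: A T_pow_mem x)
  have "cinner y (part n t (A x)) = cinner (B y) (part n t x)" for n
    by (induction n) (simp_all add: part_def exp_term_def pow cinner_simps B T_pow_mem x y)
  moreover have "(\<lambda>n. cinner y (part n t (A x))) \<longlonglongrightarrow> cinner y (V t (A x))"
    unfolding V_eq[OF A(1)[OF x]] by (intro tendsto_cinner tendsto_intros part_tendsto A x)
  moreover have "(\<lambda>n. cinner (B y) (part n t x)) \<longlonglongrightarrow> cinner (B y) (V t x)"
    unfolding V_eq[OF x] by (intro tendsto_cinner tendsto_intros part_tendsto x)
  ultimately show ?thesis using LIMSEQ_unique by simp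
qed

lemma V_eigenvector:
  assumes x: "x \<in> D" and k: "T x = complex_of_real k *\<^sub>C x"
  shows "V t x = cis (t * k) *\<^sub>C x"
proof -
  have pow: "(T ^^ n) x = (of_real k) ^ n *\<^sub>C x" for n
    by (induction n) (auto simp: T_scale x k scaleC_scaleC mult.commute)
  have "(\<lambda>n. ((\<i> * of_real (t * k)) ^ n /\<^sub>R fact n) *\<^sub>C x) sums (exp (\<i> * of_real (t * k)) *\<^sub>C x)"
    by (rule bounded_linear.sums[OF bounded_linear_scaleC_left exp_converges])
  moreover have "exp_term x n t = ((\<i> * of_real (t * k)) ^ n /\<^sub>R fact n) *\<^sub>C x" for n
    by (simp add: exp_term_def pow scaleC_scaleC scaleR_conv_of_real power_mult_distrib field_simps)
  ultimately have "(\<lambda>n. exp_term x n t) sums (exp (\<i> * of_real (t * k)) *\<^sub>C x)"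
    by (simp only:)
  then have "ser t x = exp (\<i> * of_real (t * k)) *\<^sub>C x"
    by (simp only: ser_def sums_iff)
  then show ?thesis by (simp add: V_eq x cis_conv_exp)
qed

end

section \<open>Fock modes on the finite-particle space\<close>

lemma mem_commutator:
  "(x, w) \<in> commutator S T \<longleftrightarrow>
    (\<exists>u v y z. (x, u) \<in> T \<and> (u, y) \<in> S \<and> (x, v) \<in> S \<and> (v, z) \<in> T \<and> w = y - z)"
  unfolding commutator_def op_minus_def op_comp_def by blast

lemma CAR_D:
  assumes "CAR I f" "i \<in> I" "j \<in> I"
  shows "bounded_clinear (f i)" "f i (f j x) = - f j (f i x)"
    "f i (adj (f j) x) = - adj (f j) (f i x) + (if i = j then x else 0)"
    "adj (f i) (adj (f j) x) = - adj (f j) (adj (f i) x)"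
proof -
  have b: "bounded_clinear (f i)" if "i \<in> I" for i using assms that by (auto simp: CAR_def)
  then show "bounded_clinear (f i)" using assms by blast
  have "f i (f j x) + f j (f i x) = 0" for x using assms by (auto simp: CAR_def)
  then show ff: "f i (f j x) = - f j (f i x)" for x by (simp add: eq_neg_iff_add_eq_0)
  have "f i (adj (f j) x) + adj (f j) (f i x) = (if i = j then x else 0)"
    using assms unfolding CAR_def by blast
  then show "f i (adj (f j) x) = - adj (f j) (f i x) + (if i = j then x else 0)"
    by (simp add: algebra_simps)
  show "adj (f i) (adj (f j) x) = - adj (f j) (adj (f i) x)"
  proof (rule cinner_ext)
    fix y
    show "cinner y (adj (f i) (adj (f j) x)) = cinner y (- adj (f j) (adj (f i) x))"
      using ff[of y] b assms by (simp add: cinner_adj_right)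
  qed
qed

lemma adjoint_graph:
  assumes X: "bounded_clinear X"
  shows "adjoint (graph X) = graph (adj X)"
proof -
  have "(y, w) \<in> adjoint (graph X) \<longleftrightarrow> w = adj X y" for y w
  proof
    assume "(y, w) \<in> adjoint (graph X)"
    then have eq: "cinner w x = cinner (adj X y) x" for x
      using X by (auto simp: adjoint_def graph_def cinner_adj_left)
    have "cinner x w = cinner x (adj X y)" for x using eq[of x] by (metis cinner_commute)
    then show "w = adj X y" by (rule cinner_ext)
  qed (use X in \<open>auto simp: adjoint_def graph_def cinner_adj_left\<close>)
  then show ?thesis by (auto simp: graph_def)
qed

text \<open>The sign for exchanging two mode operators: -1 exactly for a pair of fermions. It lets
  one formula cover the anticommutation, the commutation and the mixed relations.\<close>

definition sg :: "'a + 'b \<Rightarrow> 'c + 'd \<Rightarrow> complex" where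
  "sg m m' = (if isl m \<and> isl m' then -1 else 1)"

lemma sg_simps [simp]: "sg (Inl i) (Inl j) = -1" "sg (Inr i) m = 1" "sg m (Inr i) = 1"
  "cnj (sg m m') = sg m m'" "sg m m' * sg m m' = 1" "sg m m' *\<^sub>C sg m m' *\<^sub>C x = x"
  "sg m m' \<noteq> 0"
  by (auto simp: sg_def scaleC_scaleC)

lemma sg_commute: "sg m m' = sg m' m"
  by (auto simp: sg_def)

text \<open>A fermionic mode \<open>i\<close> is labelled \<open>Inl i\<close>, a bosonic one \<open>Inr i\<close>.\<close>

context fock_modes
begin

abbreviation D :: "'h set" where "D \<equiv> finite_particle I f q \<Omega>"

abbreviation modes :: "('i + 'i) set" where "modes \<equiv> I <+> I"

definition uop :: "'i + 'i \<Rightarrow> 'h uop" where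
  "uop = case_sum (\<lambda>i. graph (f i)) q"

text \<open>A total function in place of a graph; outside the domain of a bosonic operator its value
  is unspecified. On finite-particle vectors it is the operator.\<close>

definition an :: "'i + 'i \<Rightarrow> 'h \<Rightarrow> 'h" where
  "an m x = (THE y. (x, y) \<in> uop m)"

definition cr :: "'i + 'i \<Rightarrow> 'h \<Rightarrow> 'h" where
  "cr m x = (THE y. (x, y) \<in> adjoint (uop m))"

lemma fermion:
  assumes "i \<in> I"
  shows bounded_fermion: "bounded_clinear (f i)"
    and bounded_fermion_adj: "bounded_clinear (adj (f i))"
    and an_fermion: "an (Inl i) = f i" and cr_fermion: "cr (Inl i) = adj (f i)"
proof -
  show b: "bounded_clinear (f i)" using CAR_D(1)[OF fermion_CAR assms assms] .
  then show "bounded_clinear (adj (f i))" by (rule bounded_clinear_adj)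
  show "an (Inl i) = f i" by (rule ext) (simp add: an_def uop_def graph_def)
  show "cr (Inl i) = adj (f i)"
    by (rule ext) (simp add: cr_def uop_def adjoint_graph[OF b], simp add: graph_def)
qed

lemma D_subspace: "csubspace D"
proof -
  have "(-1) *\<^sub>C \<Omega> + \<Omega> \<in> D" by (intro finite_particle.intros)
  then show ?thesis by (auto simp: csubspace_def intro: finite_particle.lincomb)
qed

lemmas D_dense = vacuum_cyclic
lemmas D_simps = finite_particle.vacuum csubspaceD[OF D_subspace]

lemma norm_vacuum [simp]: "\<Omega> \<noteq> 0" "cinner \<Omega> \<Omega> = 1"
  using vacuum_norm by (auto simp: cinner_self)

lemma uop_linear:
  assumes "m \<in> modes"
  shows "(x, y) \<in> uop m \<Longrightarrow> (x, y') \<in> uop m \<Longrightarrow> y = y'"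
    "(x, y) \<in> uop m \<Longrightarrow> (x', y') \<in> uop m \<Longrightarrow> (z *\<^sub>C x + x', z *\<^sub>C y + y') \<in> uop m"
proof -
  have "linear_operator (uop m)"
  proof (cases m)
    case (Inl i)
    then show ?thesis using assms
      by (auto simp: uop_def linear_operator_def graph_def single_valued_def
          bounded_clinearD[OF bounded_fermion])
  qed (use assms boson_linear in \<open>auto simp: uop_def\<close>)
  then show "(x, y) \<in> uop m \<Longrightarrow> (x, y') \<in> uop m \<Longrightarrow> y = y'"
    "(x, y) \<in> uop m \<Longrightarrow> (x', y') \<in> uop m \<Longrightarrow> (z *\<^sub>C x + x', z *\<^sub>C y + y') \<in> uop m"
    by (auto simp: linear_operator_def single_valued_def)
qed

lemma boson_commutator:
  assumes "i \<in> I" "j \<in> I" "x \<in> D"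
  shows "\<exists>u v y z. (x, u) \<in> adjoint (q j) \<and> (u, y) \<in> q i \<and> (x, v) \<in> q i \<and> (v, z) \<in> adjoint (q j) \<and>
      y - z = (if i = j then x else 0)"
    and "\<exists>u v y. (x, u) \<in> q j \<and> (u, y) \<in> q i \<and> (x, v) \<in> q i \<and> (v, y) \<in> q j"
    and "\<exists>u v y. (x, u) \<in> adjoint (q j) \<and> (u, y) \<in> adjoint (q i) \<and> (x, v) \<in> adjoint (q i) \<and>
      (v, y) \<in> adjoint (q j)"
proof -
  have *: "(x, if i = j then x else 0) \<in> commutator (q i) (adjoint (q j))"
    "(x, 0) \<in> commutator (q i) (q j)" "(x, 0) \<in> commutator (adjoint (q i)) (adjoint (q j))"
    using boson_CCR assms unfolding CCR_on_def by blast+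
  from *(1) show "\<exists>u v y z. (x, u) \<in> adjoint (q j) \<and> (u, y) \<in> q i \<and> (x, v) \<in> q i \<and>
      (v, z) \<in> adjoint (q j) \<and> y - z = (if i = j then x else 0)"
    unfolding mem_commutator by (simp only: eq_commute)
  from *(2) show "\<exists>u v y. (x, u) \<in> q j \<and> (u, y) \<in> q i \<and> (x, v) \<in> q i \<and> (v, y) \<in> q j"
    unfolding mem_commutator by auto
  from *(3) show "\<exists>u v y. (x, u) \<in> adjoint (q j) \<and> (u, y) \<in> adjoint (q i) \<and> (x, v) \<in> adjoint (q i) \<and>
      (v, y) \<in> adjoint (q j)"
    unfolding mem_commutator by auto
qed

lemma an_uop: "m \<in> modes \<Longrightarrow> (x, y) \<in> uop m \<Longrightarrow> an m x = y"
  unfolding an_def by (rule the_equality) (use uop_linear(1) in blast)+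

lemma uop_an:
  assumes "m \<in> modes" "x \<in> D"
  shows "(x, an m x) \<in> uop m"
proof -
  have "\<exists>y. (x, y) \<in> uop m"
    using assms boson_commutator(1)[of _ _ x] by (fastforce simp: uop_def graph_def)
  then show ?thesis using an_uop[OF assms(1)] by auto
qed

lemma adjoint_uop_unique:
  assumes m: "m \<in> modes" and y: "(x, y) \<in> adjoint (uop m)" "(x, y') \<in> adjoint (uop m)"
  shows "y = y'"
proof (rule dense_cinner_eq[OF D_dense])
  fix v assume "v \<in> D"
  then have "cinner y v = cinner y' v"
    using y uop_an[OF m, of v] by (simp add: adjoint_def)
  then show "cinner v y = cinner v y'" by (metis cinner_commute)
qed

lemma cr_uop: "m \<in> modes \<Longrightarrow> (x, y) \<in> adjoint (uop m) \<Longrightarrow> cr m x = y"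
  unfolding cr_def by (rule the_equality) (use adjoint_uop_unique in blast)+

lemma uop_cr:
  assumes "m \<in> modes" "x \<in> D"
  shows "(x, cr m x) \<in> adjoint (uop m)"
proof -
  have "\<exists>y. (x, y) \<in> adjoint (uop m)"
    using assms boson_commutator(1)[of _ _ x] adjoint_graph[OF bounded_fermion]
    by (fastforce simp: uop_def graph_def)
  then show ?thesis using cr_uop[OF assms(1)] by auto
qed

lemma adjoint_uop_linear:
  "(x, y) \<in> adjoint T \<Longrightarrow> (x', y') \<in> adjoint T \<Longrightarrow> (z *\<^sub>C x + x', z *\<^sub>C y + y') \<in> adjoint T"
  by (auto simp: adjoint_def cinner_simps)

lemma cr_mem: "m \<in> modes \<Longrightarrow> x \<in> D \<Longrightarrow> cr m x \<in> D"
  using uop_cr[of m x] by (auto simp: uop_def cr_fermion intro: finite_particle.intros)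

text \<open>Merges the fermionic clause and the relational bosonic clause of
  \<open>finite_particle\<close> into the single case \<open>cr m\<close>.\<close>

lemma D_induct [consumes 1, case_names vacuum lincomb create]:
  assumes "x \<in> D" "P \<Omega>"
    and "\<And>z x y. x \<in> D \<Longrightarrow> y \<in> D \<Longrightarrow> P x \<Longrightarrow> P y \<Longrightarrow> P (z *\<^sub>C x + y)"
    and cr: "\<And>m x. m \<in> modes \<Longrightarrow> x \<in> D \<Longrightarrow> P x \<Longrightarrow> P (cr m x)"
  shows "P x"
  using assms(1)
proof induction
  case (fermion x i)
  then show ?case using cr[of "Inl i" x] by (simp add: cr_fermion InlI)
next
  case (boson x i y)
  then have "cr (Inr i) x = y" by (intro cr_uop) (auto simp: uop_def)
  then show ?case using cr[of "Inr i" x] boson by auto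
qed (use assms in auto)

lemma cinner_cr: "m \<in> modes \<Longrightarrow> x \<in> D \<Longrightarrow> y \<in> D \<Longrightarrow> cinner (cr m y) x = cinner y (an m x)"
  using uop_an[of m x] uop_cr[of m y] by (auto simp: adjoint_def)

lemma cinner_an: "m \<in> modes \<Longrightarrow> x \<in> D \<Longrightarrow> y \<in> D \<Longrightarrow> cinner (an m y) x = cinner y (cr m x)"
  using cinner_cr[of m y x] by (metis cinner_commute)

lemma an_vacuum: "m \<in> modes \<Longrightarrow> an m \<Omega> = 0"
  using boson_vacuum fermion_vacuum by (auto intro!: an_uop simp: uop_def graph_def)

lemma an_linear:
  assumes "m \<in> modes" "x \<in> D" "y \<in> D"
  shows "an m (z *\<^sub>C x + y) = z *\<^sub>C an m x + an m y"
  by (intro an_uop uop_linear(2) uop_an assms)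

lemma cr_linear:
  assumes "m \<in> modes" "x \<in> D" "y \<in> D"
  shows "cr m (z *\<^sub>C x + y) = z *\<^sub>C cr m x + cr m y"
  by (intro cr_uop adjoint_uop_linear uop_cr assms)

lemma fermion_boson:
  assumes i: "i \<in> I" and j: "j \<in> I"
  shows "(x, y) \<in> q j \<Longrightarrow> (f i x, f i y) \<in> q j"
    "(x, y) \<in> q j \<Longrightarrow> (adj (f i) x, adj (f i) y) \<in> q j"
    "(x, y) \<in> adjoint (q j) \<Longrightarrow> (f i x, f i y) \<in> adjoint (q j)"
    "(x, y) \<in> adjoint (q j) \<Longrightarrow> (adj (f i) x, adj (f i) y) \<in> adjoint (q j)"
proof -
  show q: "(x, y) \<in> q j \<Longrightarrow> (f i x, f i y) \<in> q j"
    "(x, y) \<in> q j \<Longrightarrow> (adj (f i) x, adj (f i) y) \<in> q j" for x y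
    using boson_fermion_commute[OF i j] by (auto simp: commutes_with_def)
  note ad = cinner_adj_left[OF bounded_fermion[OF i]] cinner_adj_right[OF bounded_fermion[OF i]]
  show "(x, y) \<in> adjoint (q j) \<Longrightarrow> (f i x, f i y) \<in> adjoint (q j)"
    unfolding adjoint_def by (auto simp flip: ad dest: q)
  show "(x, y) \<in> adjoint (q j) \<Longrightarrow> (adj (f i) x, adj (f i) y) \<in> adjoint (q j)"
    unfolding adjoint_def by (auto simp: ad dest: q)
qed

lemma an_cr:
  assumes m: "m \<in> modes" "m' \<in> modes" and x: "x \<in> D"
  shows "an m (cr m' x) = sg m m' *\<^sub>C cr m' (an m x) + (if m = m' then x else 0)"
proof (cases m; cases m')
  fix i j assume eq: "m = Inl i" "m' = Inl j"
  then have ij: "i \<in> I" "j \<in> I" using m by auto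
  show ?thesis unfolding eq using CAR_D(3)[OF fermion_CAR ij, of x] ij
    by (simp add: an_fermion cr_fermion)
next
  fix i j assume eq: "m = Inl i" "m' = Inr j"
  have "cr m' (f i x) = f i (cr m' x)"
    using uop_cr[OF m(2) x] m eq by (intro cr_uop) (auto simp: uop_def fermion_boson)
  then show ?thesis using m eq by (auto simp: an_fermion)
next
  fix i j assume eq: "m = Inr i" "m' = Inl j"
  have "an m (adj (f j) x) = adj (f j) (an m x)"
    using uop_an[OF m(1) x] m eq by (intro an_uop) (auto simp: uop_def fermion_boson)
  then show ?thesis using m eq by (auto simp: cr_fermion)
next
  fix i j assume eq: "m = Inr i" "m' = Inr j"
  then obtain u v y z where *: "(x, u) \<in> adjoint (q j)" "(u, y) \<in> q i" "(x, v) \<in> q i"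
      "(v, z) \<in> adjoint (q j)" "y - z = (if i = j then x else 0)"
    using boson_commutator(1)[of i j x] m x by auto
  then have "cr m' x = u" "an m u = y" "an m x = v" "cr m' v = z"
    using eq m by (auto intro!: cr_uop an_uop simp: uop_def)
  then show ?thesis using *(5) eq by (simp add: algebra_simps)
qed

text \<open>An annihilator is moved past the creators by the exchange relation until it meets the
  vacuum.\<close>

lemma an_mem: "x \<in> D \<Longrightarrow> m \<in> modes \<Longrightarrow> an m x \<in> D"
proof (induction rule: D_induct)
  case (create m' x)
  have "an m x \<in> D" by (rule create(3)[OF create(4)])
  then have "sg m m' *\<^sub>C cr m' (an m x) \<in> D" by (rule D_simps(4)[OF cr_mem[OF create(1)]])
  moreover have "(if m = m' then x else 0) \<in> D" using create(2) D_simps(2) by simp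
  ultimately show ?case unfolding an_cr[OF create(4,1,2)] by (rule D_simps(5))
next
  case (lincomb z x y)
  then show ?case unfolding an_linear[OF lincomb(5,1,2)] using D_simps(3) by blast
qed (simp add: an_vacuum D_simps(2))

lemma an_an:
  assumes m: "m \<in> modes" "m' \<in> modes" and x: "x \<in> D"
  shows "an m (an m' x) = sg m m' *\<^sub>C an m' (an m x)"
proof (cases m; cases m')
  fix i j assume eq: "m = Inl i" "m' = Inl j"
  then have ij: "i \<in> I" "j \<in> I" using m by auto
  show ?thesis unfolding eq using CAR_D(2)[OF fermion_CAR ij, of x] ij by (simp add: an_fermion)
next
  fix i j assume eq: "m = Inl i" "m' = Inr j"
  have "an m' (f i x) = f i (an m' x)"
    using uop_an[OF m(2) x] m eq by (intro an_uop) (auto simp: uop_def fermion_boson)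
  then show ?thesis using m eq by (auto simp: an_fermion)
next
  fix i j assume eq: "m = Inr i" "m' = Inl j"
  have "an m (f j x) = f j (an m x)"
    using uop_an[OF m(1) x] m eq by (intro an_uop) (auto simp: uop_def fermion_boson)
  then show ?thesis using m eq by (auto simp: an_fermion)
next
  fix i j assume eq: "m = Inr i" "m' = Inr j"
  then obtain u v y where *: "(x, u) \<in> q j" "(u, y) \<in> q i" "(x, v) \<in> q i" "(v, y) \<in> q j"
    using boson_commutator(2)[of i j x] m x by auto
  then have "an m' x = u" "an m u = y" "an m x = v" "an m' v = y"
    using eq m by (auto intro!: an_uop simp: uop_def)
  then show ?thesis using eq by simp
qed

lemma cr_cr:
  assumes m: "m \<in> modes" "m' \<in> modes" and x: "x \<in> D"
  shows "cr m (cr m' x) = sg m m' *\<^sub>C cr m' (cr m x)"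
proof (rule dense_cinner_eq[OF D_dense])
  fix y assume y: "y \<in> D"
  have "cinner y (cr m (cr m' x)) = cinner (an m' (an m y)) x"
    using m x y by (simp add: cinner_an an_mem cr_mem)
  also have "\<dots> = sg m m' * cinner (an m (an m' y)) x"
    unfolding an_an[OF m(2,1) y] sg_commute[of m' m] by (simp add: cinner_simps)
  also have "\<dots> = cinner y (sg m m' *\<^sub>C cr m' (cr m x))"
    using m x y by (simp add: cinner_an an_mem cr_mem cinner_simps)
  finally show "cinner y (cr m (cr m' x)) = cinner y (sg m m' *\<^sub>C cr m' (cr m x))" .
qed

lemma an_simps:
  assumes "m \<in> modes"
  shows "x \<in> D \<Longrightarrow> y \<in> D \<Longrightarrow> an m (x + y) = an m x + an m y"
    "x \<in> D \<Longrightarrow> y \<in> D \<Longrightarrow> an m (x - y) = an m x - an m y"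
    "x \<in> D \<Longrightarrow> an m (z *\<^sub>C x) = z *\<^sub>C an m x" "an m 0 = 0"
proof -
  show 0: "an m 0 = 0" using an_linear[OF assms, of 0 0 "-1"] D_simps(2) by simp
  show "x \<in> D \<Longrightarrow> y \<in> D \<Longrightarrow> an m (x + y) = an m x + an m y"
    using an_linear[OF assms, of x y 1] by simp
  show "x \<in> D \<Longrightarrow> y \<in> D \<Longrightarrow> an m (x - y) = an m x - an m y"
    using an_linear[OF assms, of y x "-1"] by simp
  show "x \<in> D \<Longrightarrow> an m (z *\<^sub>C x) = z *\<^sub>C an m x"
    using an_linear[OF assms, of x 0 z] D_simps(2) 0 by simp
qed

lemma cr_simps:
  assumes "m \<in> modes"
  shows "x \<in> D \<Longrightarrow> y \<in> D \<Longrightarrow> cr m (x + y) = cr m x + cr m y"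
    "x \<in> D \<Longrightarrow> y \<in> D \<Longrightarrow> cr m (x - y) = cr m x - cr m y"
    "x \<in> D \<Longrightarrow> cr m (z *\<^sub>C x) = z *\<^sub>C cr m x" "cr m 0 = 0"
proof -
  show 0: "cr m 0 = 0" using cr_linear[OF assms, of 0 0 "-1"] D_simps(2) by simp
  show "x \<in> D \<Longrightarrow> y \<in> D \<Longrightarrow> cr m (x + y) = cr m x + cr m y"
    using cr_linear[OF assms, of x y 1] by simp
  show "x \<in> D \<Longrightarrow> y \<in> D \<Longrightarrow> cr m (x - y) = cr m x - cr m y"
    using cr_linear[OF assms, of y x "-1"] by simp
  show "x \<in> D \<Longrightarrow> cr m (z *\<^sub>C x) = z *\<^sub>C cr m x"
    using cr_linear[OF assms, of x 0 z] D_simps(2) 0 by simp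
qed

subsection \<open>Eigenvector decompositions\<close>

text \<open>Being an entire vector is stable under linear combinations, so growth estimates are
  needed only for eigenvectors of a suitable number operator.\<close>

inductive_set eigenspan :: "('h \<Rightarrow> 'h) \<Rightarrow> 'h set" for T where
  eigen: "x \<in> D \<Longrightarrow> T x = complex_of_real (of_int k) *\<^sub>C x \<Longrightarrow> x \<in> eigenspan T"
| lincomb: "x \<in> eigenspan T \<Longrightarrow> y \<in> eigenspan T \<Longrightarrow> z *\<^sub>C x + y \<in> eigenspan T"

lemma eigenspan_mem: "x \<in> eigenspan T \<Longrightarrow> x \<in> D"
  by (induction rule: eigenspan.induct) (auto intro: D_simps)

lemma D_subset_eigenspan:
  assumes vac: "T \<Omega> = 0"
    and cr: "\<And>m k x. m \<in> modes \<Longrightarrow> x \<in> D \<Longrightarrow> T x = complex_of_real (of_int k) *\<^sub>C x \<Longrightarrow>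
      cr m x \<in> eigenspan T"
    and x: "x \<in> D"
  shows "x \<in> eigenspan T"
  using x
proof (induction rule: D_induct)
  case vacuum
  show ?case using vac by (intro eigenspan.eigen[of _ _ 0]) (simp_all add: D_simps)
next
  case (create m x)
  from create(3) show ?case
  proof induction
    case (lincomb x y z)
    then show ?case
      using create(1) by (simp add: cr_linear eigenspan_mem eigenspan.lincomb)
  qed (use create(1) cr in auto)
qed (rule eigenspan.lincomb)

end

text \<open>The square root is the growth caused by \<open>n\<close> field operators on a state with
  \<open>k\<close> particles; dividing by \<open>fact n\<close> leaves a ratio of order
  \<open>1 / sqrt n\<close>.\<close>

lemma summable_power_sqrt_fact:
  assumes "c \<ge> 0"
  shows "summable (\<lambda>n. c ^ n * sqrt (fact (k + n) / fact k) / fact n :: real)"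
proof -
  define a where "a n = c ^ n * sqrt (fact (k + n) / fact k) / fact n" for n
  \<comment> \<open>From \<open>k\<close> on, \<open>k + Suc n\<close> is at most
    \<open>2 * Suc n\<close>, so the squared ratio is at most \<open>2 * c\<^sup>2 / Suc n\<close>;
    beyond \<open>8 * c\<^sup>2\<close> this is at most 1/4.\<close>
  define N where "N = max k (nat \<lceil>8 * c\<^sup>2\<rceil>)"
  have "norm (a (Suc n)) \<le> 1 / 2 * norm (a n)" if "n \<ge> N" for n
  proof -
    have "(2 * c * sqrt (real (k + Suc n)))\<^sup>2 = 4 * c\<^sup>2 * real (k + Suc n)"
      by (simp add: power_mult_distrib)
    also have "\<dots> \<le> 4 * c\<^sup>2 * (2 * real (Suc n))"
      using that by (intro mult_left_mono) (auto simp: N_def)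
    also have "\<dots> = 8 * c\<^sup>2 * real (Suc n)" by simp
    also have "\<dots> \<le> real (Suc n) * real (Suc n)"
      using that by (intro mult_right_mono) (auto simp: N_def)
    finally have "(2 * c * sqrt (real (k + Suc n)))\<^sup>2 \<le> (real (Suc n))\<^sup>2"
      by (simp add: power2_eq_square)
    then have "2 * c * sqrt (real (k + Suc n)) \<le> real (Suc n)" by (rule power2_le_imp_le) simp
    then have le: "c * sqrt (real (k + Suc n)) / real (Suc n) \<le> 1 / 2"
      by (simp add: field_simps del: of_nat_Suc)
    have "(fact (k + Suc n) / fact k :: real) = real (k + Suc n) * (fact (k + n) / fact k)"
      by simp
    then have s: "sqrt (fact (k + Suc n) / fact k) = sqrt (real (k + Suc n)) * sqrt (fact (k + n) / fact k)"
      by (simp only: real_sqrt_mult)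
    have "a (Suc n) = (c * sqrt (real (k + Suc n)) / real (Suc n)) * a n"
      unfolding a_def s fact_Suc[of n] by (simp add: field_simps del: of_nat_Suc)
    then have "norm (a (Suc n)) = (c * sqrt (real (k + Suc n)) / real (Suc n)) * norm (a n)"
      using assms by (simp add: abs_mult del: of_nat_Suc)
    also have "\<dots> \<le> 1 / 2 * norm (a n)" using le by (intro mult_right_mono) auto
    finally show ?thesis .
  qed
  then have "summable a" by (intro summable_ratio_test[where c = "1/2" and N = N]) auto
  then show ?thesis unfolding a_def .
qed

context fock_modes
begin

definition entire :: "('h \<Rightarrow> 'h) \<Rightarrow> 'h \<Rightarrow> bool" where
  "entire T x \<longleftrightarrow> (\<forall>r\<ge>0. summable (\<lambda>n. r ^ n / fact n * norm ((T ^^ n) x)))"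

text \<open>\<open>N\<close> is an auxiliary operator whose eigenvectors span \<open>D\<close>,
  possibly different from \<open>T\<close>; for a field it is the number operator of the
  mode.\<close>

lemma entire_symmetricI:
  assumes mem: "\<And>x. x \<in> D \<Longrightarrow> T x \<in> D"
    and lin: "\<And>x y z. x \<in> D \<Longrightarrow> y \<in> D \<Longrightarrow> T (z *\<^sub>C x + y) = z *\<^sub>C T x + T y"
    and sym: "\<And>x y. x \<in> D \<Longrightarrow> y \<in> D \<Longrightarrow> cinner (T x) y = cinner x (T y)"
    and N: "\<And>x. x \<in> D \<Longrightarrow> x \<in> eigenspan N"
    and ent: "\<And>x k. x \<in> D \<Longrightarrow> N x = complex_of_real (of_int k) *\<^sub>C x \<Longrightarrow> entire T x"
  shows "entire_symmetric D T"
proof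
  fix x :: 'h and r :: real assume "x \<in> D" "0 \<le> r"
  have "entire T x" if "x \<in> eigenspan N" for x
    using that
  proof induction
    case (lincomb x y z)
    have xy: "x \<in> D" "y \<in> D" using lincomb eigenspan_mem by auto
    have pm: "(T ^^ n) x \<in> D" if "x \<in> D" for n x using that by (induction n) (auto intro: mem)
    have pow: "(T ^^ n) (z *\<^sub>C x + y) = z *\<^sub>C (T ^^ n) x + (T ^^ n) y" for n
      by (induction n) (auto simp: lin pm xy)
    show ?case
      unfolding entire_def
    proof (intro allI impI)
      fix r :: real assume r: "r \<ge> 0"
      have "summable (\<lambda>n. cmod z * (r ^ n / fact n * norm ((T ^^ n) x)) + r ^ n / fact n * norm ((T ^^ n) y))"
        using lincomb r by (intro summable_add summable_mult) (auto simp: entire_def)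
      moreover have "norm (r ^ n / fact n * norm ((T ^^ n) (z *\<^sub>C x + y)))
          \<le> cmod z * (r ^ n / fact n * norm ((T ^^ n) x)) + r ^ n / fact n * norm ((T ^^ n) y)" for n
      proof -
        have "norm ((T ^^ n) (z *\<^sub>C x + y)) \<le> cmod z * norm ((T ^^ n) x) + norm ((T ^^ n) y)"
          unfolding pow using norm_triangle_ineq[of "z *\<^sub>C (T ^^ n) x"] by simp
        then have "r ^ n / fact n * norm ((T ^^ n) (z *\<^sub>C x + y))
            \<le> r ^ n / fact n * (cmod z * norm ((T ^^ n) x) + norm ((T ^^ n) y))"
          using r by (intro mult_left_mono) auto
        then show ?thesis using r by (simp add: abs_mult algebra_simps)
      qed
      ultimately show "summable (\<lambda>n. r ^ n / fact n * norm ((T ^^ n) (z *\<^sub>C x + y)))"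
        by (rule summable_comparison_test'[where N = 0]) 
    qed
  qed (use ent in blast)
  then show "summable (\<lambda>n. r ^ n / fact n * norm ((T ^^ n) x))"
    using N[OF \<open>x \<in> D\<close>] \<open>0 \<le> r\<close> by (auto simp: entire_def)
qed (use mem lin sym D_subspace D_dense in auto)

subsection \<open>Weyl operators\<close>

definition field :: "'i \<Rightarrow> complex \<Rightarrow> 'h \<Rightarrow> 'h" where
  "field i z x = z *\<^sub>C cr (Inr i) x + cnj z *\<^sub>C an (Inr i) x"

definition field_op :: "'i \<Rightarrow> complex \<Rightarrow> 'h uop" where
  "field_op i z = op_plus (op_scale z (adjoint (q i))) (op_scale (cnj z) (q i))"

lemma number_eigenvector:
  assumes b: "b \<in> modes" "\<not> isl b" and x: "x \<in> D" and k: "cr b (an b x) = of_nat k *\<^sub>C x"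
  shows "(norm (an b x))\<^sup>2 = real k * (norm x)\<^sup>2" "(norm (cr b x))\<^sup>2 = real (Suc k) * (norm x)\<^sup>2"
    "cr b (an b (cr b x)) = of_nat (Suc k) *\<^sub>C cr b x"
    "k > 0 \<Longrightarrow> cr b (an b (an b x)) = of_nat (k - 1) *\<^sub>C an b x"
proof -
  have sg: "sg b b = 1" using b by (simp add: sg_def)
  have anx: "an b x \<in> D" using an_mem x b by blast
  note cc = an_cr[OF b(1) b(1), unfolded sg, simplified]
  have "cinner (an b x) (an b x) = of_nat k * cinner x x"
    using cinner_an[OF b(1) anx x] k by (simp add: cinner_simps)
  then show "(norm (an b x))\<^sup>2 = real k * (norm x)\<^sup>2"
    unfolding cinner_self by (simp flip: of_real_eq_iff[where 'a = complex])
  have "cinner (cr b x) (cr b x) = of_nat (Suc k) * cinner x x"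
    using cinner_cr[OF b(1) cr_mem[OF b(1) x] x] k cc[OF x] by (simp add: cinner_simps algebra_simps)
  then show "(norm (cr b x))\<^sup>2 = real (Suc k) * (norm x)\<^sup>2"
    unfolding cinner_self by (simp flip: of_real_eq_iff[where 'a = complex])
  show "cr b (an b (cr b x)) = of_nat (Suc k) *\<^sub>C cr b x"
    using x by (simp add: cc k cr_simps[OF b(1)] D_simps scaleC_add_left)
  assume "k > 0"
  have "an b (cr b (an b x)) = cr b (an b (an b x)) + an b x" by (rule cc[OF anx])
  then show "cr b (an b (an b x)) = of_nat (k - 1) *\<^sub>C an b x"
    using \<open>k > 0\<close> x by (simp add: k an_simps[OF b(1)] of_nat_diff scaleC_diff_left algebra_simps)
qed

lemma number_eigenspan:
  assumes b: "b \<in> modes" "\<not> isl b" and x: "x \<in> D"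
  shows "x \<in> eigenspan (\<lambda>x. cr b (an b x))"
proof (rule D_subset_eigenspan[OF _ _ x])
  show "cr b (an b \<Omega>) = 0" using b by (simp add: an_vacuum cr_simps)
  fix m k x assume m: "m \<in> modes" and x: "x \<in> D" and k: "cr b (an b x) = complex_of_real (of_int k) *\<^sub>C x"
  have sg: "sg b m = 1" "sg m b = 1" using b by (simp_all add: sg_def)
  have anx: "an b x \<in> D" using an_mem x b by blast
  show "cr m x \<in> eigenspan (\<lambda>x. cr b (an b x))"
  proof (rule eigenspan.eigen)
    show "cr m x \<in> D" using m x by (rule cr_mem)
    have "cr b (cr m (an b x)) = cr m (cr b (an b x))"
      using cr_cr[OF b(1) m anx] by (simp add: sg)
    then show "cr b (an b (cr m x)) = complex_of_real (of_int (if m = b then k + 1 else k)) *\<^sub>C cr m x"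
      using m b x anx by (simp add: an_cr sg k cr_linear cr_simps cr_mem scaleC_add_left)
  qed
qed

text \<open>The first field operator branches into creation and annihilation, and the induction
  hypothesis is applied with the shifted particle number. The two branches account for the 2 in
  \<open>2 * cmod z\<close>.\<close>

lemma field_power_bound:
  assumes i: "i \<in> I"
  shows "x \<in> D \<Longrightarrow> cr (Inr i) (an (Inr i) x) = of_nat k *\<^sub>C x \<Longrightarrow>
    norm ((field i z ^^ n) x) \<le> (2 * cmod z) ^ n * sqrt (fact (k + n) / fact k) * norm x"
proof (induction n arbitrary: k x)
  case (Suc n)
  let ?b = "Inr i :: 'i + 'i"
  have b: "?b \<in> modes" "\<not> isl ?b" using i by auto
  note ev = number_eigenvector[OF b Suc.prems]
  define c where "c = (2 * cmod z) ^ n"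
  have c0: "c \<ge> 0" by (simp add: c_def)
  have an: "an ?b x \<in> D" and cr: "cr ?b x \<in> D" using Suc.prems b by (auto intro: an_mem cr_mem)
  have fm: "field i z y \<in> D" if "y \<in> D" for y
    using that b unfolding field_def by (intro D_simps an_mem cr_mem)
  have pm: "(field i z ^^ n) y \<in> D" if "y \<in> D" for n y using that by (induction n) (auto intro: fm)
  have lin: "field i z (w *\<^sub>C y + y') = w *\<^sub>C field i z y + field i z y'" if "y \<in> D" "y' \<in> D" for w y y'
    using that b by (simp add: field_def cr_linear an_linear scaleC_add_right scaleC_scaleC mult_ac)
  have pow: "(field i z ^^ n) (w *\<^sub>C y + y') = w *\<^sub>C (field i z ^^ n) y + (field i z ^^ n) y'"
    if "y \<in> D" "y' \<in> D" for n w y y'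
    using that by (induction n) (auto simp: lin pm)
  have ncr: "norm (cr ?b x) = sqrt (real (Suc k)) * norm x"
    using arg_cong[OF ev(2), of sqrt] by (simp add: real_sqrt_mult)
  have nan: "norm (an ?b x) = sqrt (real k) * norm x"
    using arg_cong[OF ev(1), of sqrt] by (simp add: real_sqrt_mult)
  have B: "norm ((field i z ^^ n) (cr ?b x)) \<le> c * sqrt (fact (k + Suc n) / fact k) * norm x"
  proof -
    have "norm ((field i z ^^ n) (cr ?b x)) \<le> c * sqrt (fact (Suc k + n) / fact (Suc k)) * norm (cr ?b x)"
      unfolding c_def by (rule Suc.IH[OF cr ev(3)])
    also have "\<dots> = c * sqrt (fact (Suc k + n) / fact (Suc k) * real (Suc k)) * norm x"
      by (simp only: ncr real_sqrt_mult mult.assoc)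
    also have "(fact (Suc k + n) / fact (Suc k) * real (Suc k) :: real) = fact (k + Suc n) / fact k"
      unfolding fact_Suc[of k] by simp
    finally show ?thesis .
  qed
  \<comment> \<open>The annihilated vector has \<open>k - 1\<close> particles. It vanishes for
    \<open>k = 0\<close>; otherwise its radicand is smaller than that of the creation
    branch.\<close>
  have A: "norm ((field i z ^^ n) (an ?b x)) \<le> c * sqrt (fact (k + Suc n) / fact k) * norm x"
  proof (cases k)
    case 0
    then have "an ?b x = 0" using nan by simp
    moreover have "(field i z ^^ n) 0 = 0" using pow[of 0 0 n "-1"] D_simps(2) by simp
    ultimately show ?thesis using c0 by simp
  next
    case (Suc l)
    have "cr ?b (an ?b (an ?b x)) = of_nat l *\<^sub>C an ?b x" using ev(4) Suc by simp
    from Suc.IH[OF an this]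
    have "norm ((field i z ^^ n) (an ?b x)) \<le> c * sqrt (fact (l + n) / fact l) * norm (an ?b x)"
      by (simp add: c_def)
    also have "\<dots> = c * sqrt (fact (l + n) / fact l * real k) * norm x"
      by (simp only: nan real_sqrt_mult mult.assoc)
    also have "\<dots> \<le> c * sqrt (fact (k + Suc n) / fact k) * norm x"
    proof (intro mult_right_mono mult_left_mono real_sqrt_le_mono c0 norm_ge_zero)
      have "real k * real k \<le> real (k + Suc n) * real (k + n)"
        by (intro mult_mono) auto
      then have "fact (l + n) * (real k * real k) \<le> fact (l + n) * (real (k + Suc n) * real (k + n))"
        by (intro mult_left_mono) auto
      also have "\<dots> = fact (k + Suc n)"
      proof -
        have "k + Suc n = Suc (Suc (l + n))" "k + n = Suc (l + n)" using Suc by simp_all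
        then show ?thesis by (simp only: fact_Suc mult_ac)
      qed
      finally have "fact (l + n) * (real k * real k) / fact k \<le> fact (k + Suc n) / fact k"
        by (intro divide_right_mono) auto
      moreover have "fact (l + n) * (real k * real k) / fact k = fact (l + n) / fact l * real k"
        using Suc by (simp add: field_simps del: of_nat_Suc)
      ultimately show "fact (l + n) / fact l * real k \<le> fact (k + Suc n) / fact k" by simp
    qed
    finally show ?thesis .
  qed
  have "(field i z ^^ Suc n) x = (field i z ^^ n) (z *\<^sub>C cr ?b x + cnj z *\<^sub>C an ?b x)"
    by (simp add: funpow_swap1 field_def)
  also have "\<dots> = z *\<^sub>C (field i z ^^ n) (cr ?b x) + cnj z *\<^sub>C (field i z ^^ n) (an ?b x)"
    using pow[OF cr, of "cnj z *\<^sub>C an ?b x" n z] pow[OF an, of 0 n "cnj z"] pow[of 0 0 n "-1"] an D_simps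
    by simp
  finally have "norm ((field i z ^^ Suc n) x)
      \<le> cmod z * norm ((field i z ^^ n) (cr ?b x)) + cmod z * norm ((field i z ^^ n) (an ?b x))"
    by (metis complex_mod_cnj norm_scaleC norm_triangle_ineq)
  also have "\<dots> \<le> cmod z * (c * sqrt (fact (k + Suc n) / fact k) * norm x)
      + cmod z * (c * sqrt (fact (k + Suc n) / fact k) * norm x)"
    by (intro add_mono mult_left_mono A B) auto
  also have "\<dots> = (2 * cmod z) ^ Suc n * sqrt (fact (k + Suc n) / fact k) * norm x"
    by (simp add: c_def)
  finally show ?case .
qed simp

lemma field_entire: "i \<in> I \<Longrightarrow> entire_symmetric D (field i z)"
proof (rule entire_symmetricI[where N = "\<lambda>x. cr (Inr i) (an (Inr i) x)"])
  let ?b = "Inr i :: 'i + 'i"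
  assume i: "i \<in> I"
  then have b: "?b \<in> modes" by auto
  show "field i z x \<in> D" if "x \<in> D" for x
    using that b unfolding field_def by (intro D_simps an_mem cr_mem)
  show "field i z (w *\<^sub>C x + y) = w *\<^sub>C field i z x + field i z y" if "x \<in> D" "y \<in> D" for w x y
    using that b by (simp add: field_def cr_linear an_linear scaleC_add_right scaleC_scaleC mult_ac)
  show "cinner (field i z x) y = cinner x (field i z y)" if "x \<in> D" "y \<in> D" for x y
    using that b by (simp add: field_def cinner_simps cinner_cr cinner_an)
  show "x \<in> eigenspan (\<lambda>x. cr ?b (an ?b x))" if "x \<in> D" for x
    using that b by (intro number_eigenspan) auto
  fix x k assume x: "x \<in> D" and k: "cr ?b (an ?b x) = complex_of_real (of_int k) *\<^sub>C x"
  show "entire (field i z) x"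
  proof (cases "x = 0")
    case True
    have "field i z 0 = 0" using b by (simp add: field_def an_simps cr_simps)
    then have "(field i z ^^ n) 0 = 0" for n by (induction n) auto
    then show ?thesis using True by (simp add: entire_def)
  next
    case False
    \<comment> \<open>\<open>eigenspan\<close> provides an integer eigenvalue only; being a ratio of
      squared norms, it is a natural number.\<close>
    have "cinner (an ?b x) (an ?b x) = of_int k * cinner x x"
      using cinner_an[OF b an_mem[OF x b] x] k by (simp add: cinner_simps)
    then have "(norm (an ?b x))\<^sup>2 = of_int k * (norm x)\<^sup>2"
      unfolding cinner_self by (simp flip: of_real_eq_iff[where 'a = complex])
    then have "0 \<le> of_int k * (norm x)\<^sup>2" by (metis zero_le_power2)
    then have "k \<ge> 0" using False by (simp add: zero_le_mult_iff)
    then have k': "cr ?b (an ?b x) = of_nat (nat k) *\<^sub>C x" using k by simp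
    show ?thesis
      unfolding entire_def
    proof (intro allI impI)
      fix r :: real assume r: "r \<ge> 0"
      define c where "c = 2 * cmod z * r"
      have "summable (\<lambda>n. c ^ n * sqrt (fact (nat k + n) / fact (nat k)) / fact n * norm x)"
        using r by (intro summable_mult2 summable_power_sqrt_fact) (simp add: c_def)
      then show "summable (\<lambda>n. r ^ n / fact n * norm ((field i z ^^ n) x))"
      proof (rule summable_comparison_test'[where N = 0])
        fix n
        have "r ^ n / fact n * norm ((field i z ^^ n) x)
          \<le> r ^ n / fact n * ((2 * cmod z) ^ n * sqrt (fact (nat k + n) / fact (nat k)) * norm x)"
          using r by (intro mult_left_mono field_power_bound[OF i x k']) auto
        then show "norm (r ^ n / fact n * norm ((field i z ^^ n) x))
          \<le> c ^ n * sqrt (fact (nat k + n) / fact (nat k)) / fact n * norm x"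
          using r by (simp add: c_def power_mult_distrib mult_ac abs_mult)
      qed
    qed
  qed
qed

lemma weyl_field:
  assumes i: "i \<in> I"
  shows "weyl (q i) z = entire_symmetric.V D (field i z) 1"
proof -
  interpret E: entire_symmetric D "field i z" by (rule field_entire[OF i])
  have b: "Inr i \<in> modes" using i by auto
  have "exp_i (field_op i z) = E.V 1"
  proof (rule E.closure_symmetric_extension(2))
    show "E.T_graph \<subseteq> field_op i z"
    proof
      fix p assume "p \<in> E.T_graph"
      then obtain x where p: "p = (x, field i z x)" "x \<in> D" by (auto simp: E.T_graph_def)
      then have "(x, z *\<^sub>C cr (Inr i) x) \<in> op_scale z (adjoint (q i))"
        "(x, cnj z *\<^sub>C an (Inr i) x) \<in> op_scale (cnj z) (q i)"
        using uop_an[OF b p(2)] uop_cr[OF b p(2)] by (auto simp: op_scale_def uop_def)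
      then show "p \<in> field_op i z"
        unfolding field_op_def op_plus_def p(1) field_def by blast
    qed
    fix x x' y y' assume "(x, x') \<in> field_op i z" "(y, y') \<in> field_op i z"
    then obtain u v u' v' where
      x: "(x, u) \<in> adjoint (q i)" "(x, v) \<in> q i" "x' = z *\<^sub>C u + cnj z *\<^sub>C v" and
      y: "(y, u') \<in> adjoint (q i)" "(y, v') \<in> q i" "y' = z *\<^sub>C u' + cnj z *\<^sub>C v'"
      by (auto simp: field_op_def op_plus_def op_scale_def)
    have "cinner u y = cinner x v'" "cinner u' x = cinner y v" using x y by (auto simp: adjoint_def)
    moreover from this(2) have "cinner v y = cinner x u'" by (metis cinner_commute)
    ultimately show "cinner x' y = cinner x y'" using x(3) y(3) by (simp add: cinner_simps)
  qed
  then show ?thesis by (simp add: weyl_def field_op_def)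
qed

text \<open>Each Weyl operator is defined by an exponential of its own. Collecting those along a ray
  into one unitary group makes them differentiable, which recovers the field.\<close>

lemma weyl_real_multiple:
  assumes i: "i \<in> I"
  shows "weyl (q i) (of_real t * z) = entire_symmetric.V D (field i z) t"
proof -
  interpret E: entire_symmetric D "field i z" by (rule field_entire[OF i])
  interpret E': entire_symmetric D "field i (of_real t * z)" by (rule field_entire[OF i])
  have "E'.V 1 = E.V t"
  proof (rule dense_bounded_clinear_eq[OF D_dense])
    fix x assume x: "x \<in> D"
    have t: "field i (of_real t * z) x = of_real t *\<^sub>C field i z x" for x
      by (simp add: field_def scaleC_add_right scaleC_scaleC)
    have "(field i (of_real t * z) ^^ n) x = of_real (t ^ n) *\<^sub>C (field i z ^^ n) x" for n
    proof (induction n)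
      case (Suc n)
      then show ?case using E.T_pow_mem[OF x, of n]
        by (simp add: t E.T_scale scaleC_scaleC)
    qed simp
    then have "E'.exp_term x n 1 = E.exp_term x n t" for n
      by (simp add: E'.exp_term_def E.exp_term_def scaleC_scaleC power_mult_distrib)
    then show "E'.V 1 x = E.V t x" using x by (simp add: E.V_eq E'.V_eq E.ser_def E'.ser_def)
  qed (rule E.bounded_clinear_V E'.bounded_clinear_V)+
  then show ?thesis using weyl_field[OF i] by simp
qed

lemma weyl:
  assumes i: "i \<in> I"
  shows unitary_weyl: "unitary (weyl (q i) z)" and adj_weyl: "adj (weyl (q i) z) = weyl (q i) (- z)"
    and weyl_derivative: "x \<in> D \<Longrightarrow>
      ((\<lambda>t. weyl (q i) (of_real t * z) x) has_vector_derivative \<i> *\<^sub>C field i z x) (at 0)"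
    and weyl_zero: "weyl (q i) 0 = id"
proof -
  interpret E: entire_symmetric D "field i z" by (rule field_entire[OF i])
  have w: "weyl (q i) (of_real t * z) = E.V t" for t by (rule weyl_real_multiple[OF i])
  show "unitary (weyl (q i) z)" using w[of 1] E.unitary_V by simp
  show "adj (weyl (q i) z) = weyl (q i) (- z)" using w[of 1] w[of "-1"] E.V_adj by simp
  show "weyl (q i) 0 = id" using w[of 0] E.V_zero by simp
  show "((\<lambda>t. weyl (q i) (of_real t * z) x) has_vector_derivative \<i> *\<^sub>C field i z x) (at 0)" if x: "x \<in> D"
    using E.ser_derivative[OF x, of 0] by (simp add: w E.V_eq[OF x] E.ser_zero)
qed

subsection \<open>Weak commutation\<close>

text \<open>The relations \<open>X a = a' X\<close> for annihilators and creators, tested on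
  \<open>D\<close> with the left factor moved to its adjoint, since \<open>X x\<close> need not lie
  in any domain.\<close>

definition weakly_intertwines :: "('h \<Rightarrow> 'h) \<Rightarrow> 'i + 'i \<Rightarrow> 'i + 'i \<Rightarrow> bool" where
  "weakly_intertwines X m m' \<longleftrightarrow> (\<forall>x\<in>D. \<forall>y\<in>D.
     cinner y (X (an m x)) = cinner (cr m' y) (X x) \<and> cinner y (X (cr m x)) = cinner (an m' y) (X x))"

lemma weakly_intertwinesD:
  assumes "weakly_intertwines X m m'" "x \<in> D" "y \<in> D"
  shows "cinner y (X (an m x)) = cinner (cr m' y) (X x)" "cinner y (X (cr m x)) = cinner (an m' y) (X x)"
  using assms by (auto simp: weakly_intertwines_def)

lemma weakly_intertwines_weyl:
  assumes X: "bounded_clinear X" and i: "i \<in> I" "j \<in> I"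
    and w: "weakly_intertwines X (Inr i) (Inr j)"
  shows "X \<circ> weyl (q i) z = weyl (q j) z \<circ> X"
proof -
  interpret E: entire_symmetric D "field i z" by (rule field_entire[OF i(1)])
  interpret E': entire_symmetric D "field j z" by (rule field_entire[OF i(2)])
  have dom: "Domain E.T_graph = D" "Domain E'.T_graph = D"
    by (auto simp: E.T_graph_def E'.T_graph_def)
  have "X \<circ> E.V 1 = E'.V 1 \<circ> X"
  proof (rule unitary_group_intertwine[OF E.unitary_group_V E.generator_V _
        E'.unitary_group_V E'.generator_V _ X])
    fix x x' y y' assume "(x, x') \<in> E.T_graph" "(y, y') \<in> E'.T_graph"
    then have *: "x \<in> D" "y \<in> D" "x' = field i z x" "y' = field j z y"
      by (auto simp: E.T_graph_def E'.T_graph_def)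
    show "cinner y (X x') = cinner y' (X x)"
      using weakly_intertwinesD[OF w *(1,2)]
      by (simp add: *(3,4) field_def bounded_clinearD[OF X] cinner_simps)
  qed (simp_all add: dom D_dense)
  then show ?thesis by (simp add: weyl_field[OF i(1)] weyl_field[OF i(2)])
qed

text \<open>Differentiation at 0 gives weak commutation with every field. The fields for
  \<open>1\<close> and \<open>\<i>\<close> are the sum and \<open>\<i>\<close> times the difference
  of creator and annihilator, so both can be isolated.\<close>

lemma commute_weyl_weak:
  assumes X: "bounded_clinear X" and i: "i \<in> I"
    and c: "\<And>z. X \<circ> weyl (q i) z = weyl (q i) z \<circ> X"
  shows "weakly_intertwines X (Inr i) (Inr i)"
  unfolding weakly_intertwines_def
proof (intro ballI)
  fix x y assume x: "x \<in> D" and y: "y \<in> D"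
  have eq: "cinner y (X (field i z x)) = cinner (field i z y) (X x)" for z
  proof -
    have "((\<lambda>t. cinner y (X (weyl (q i) (of_real t * z) x))) has_vector_derivative
        cinner y (X (\<i> *\<^sub>C field i z x))) (at 0)"
      by (intro bounded_linear.has_vector_derivative[OF
            bounded_bilinear.bounded_linear_right[OF bounded_bilinear_cinner]]
          bounded_linear.has_vector_derivative[OF bounded_clinear_bounded_linear[OF X]]
          weyl_derivative i x)
    moreover have "cinner y (X (weyl (q i) (of_real t * z) x)) = cinner (weyl (q i) (of_real t * - z) y) (X x)" for t
    proof -
      have "X (weyl (q i) (of_real t * z) x) = weyl (q i) (of_real t * z) (X x)"
        using c[of "of_real t * z"] by (metis comp_apply)
      moreover have "weyl (q i) (of_real t * - z) = adj (weyl (q i) (of_real t * z))"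
        using adj_weyl[OF i] by simp
      ultimately show ?thesis
        using unitaryD(1)[OF unitary_weyl[OF i]] by (simp add: cinner_adj_left)
    qed
    moreover have "((\<lambda>t. cinner (weyl (q i) (of_real t * - z) y) (X x)) has_vector_derivative
        cinner (\<i> *\<^sub>C field i (- z) y) (X x)) (at 0)"
      by (intro bounded_linear.has_vector_derivative[OF
            bounded_bilinear.bounded_linear_left[OF bounded_bilinear_cinner]] weyl_derivative i y)
    ultimately have "cinner y (X (\<i> *\<^sub>C field i z x)) = cinner (\<i> *\<^sub>C field i (- z) y) (X x)"
      using vector_derivative_unique_at by force
    then have "\<i> * cinner y (X (field i z x)) = \<i> * cinner (field i z y) (X x)"
      by (simp add: bounded_clinearD[OF X] field_def cinner_simps algebra_simps)
    then show ?thesis by (simp only: mult_cancel_left) simp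
  qed
  show "cinner y (X (an (Inr i) x)) = cinner (cr (Inr i) y) (X x) \<and>
      cinner y (X (cr (Inr i) x)) = cinner (an (Inr i) y) (X x)"
    using eq[of 1] eq[of \<i>]
    by (simp add: bounded_clinearD[OF X] field_def cinner_simps complex_eq_iff)
qed

lemma weakly_intertwines_fermion:
  assumes X: "bounded_clinear X" and i: "i \<in> I" "j \<in> I"
  shows "weakly_intertwines X (Inl i) (Inl j) \<longleftrightarrow>
    X \<circ> f i = f j \<circ> X \<and> X \<circ> adj (f i) = adj (f j) \<circ> X"
proof
  assume w: "weakly_intertwines X (Inl i) (Inl j)"
  note b = bounded_fermion bounded_fermion_adj
  note w' = weakly_intertwinesD[OF w, unfolded an_fermion[OF i(1)] an_fermion[OF i(2)]
      cr_fermion[OF i(1)] cr_fermion[OF i(2)]]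
  show "X \<circ> f i = f j \<circ> X \<and> X \<circ> adj (f i) = adj (f j) \<circ> X"
  proof (intro conjI dense_bounded_clinear_eq[OF D_dense])
    fix x assume x: "x \<in> D"
    show "(X \<circ> f i) x = (f j \<circ> X) x"
      by (rule dense_cinner_eq[OF D_dense]) (use x w' in \<open>simp add: cinner_adj_left b i\<close>)
    show "(X \<circ> adj (f i)) x = (adj (f j) \<circ> X) x"
      by (rule dense_cinner_eq[OF D_dense]) (use x w' in \<open>simp add: cinner_adj_right b i\<close>)
  qed (use X b i in \<open>auto intro: bounded_clinear_comp\<close>)
next
  assume *: "X \<circ> f i = f j \<circ> X \<and> X \<circ> adj (f i) = adj (f j) \<circ> X"
  then have "X (f i x) = f j (X x)" "X (adj (f i) x) = adj (f j) (X x)" for x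
    by (metis comp_apply)+
  then show "weakly_intertwines X (Inl i) (Inl j)"
    using i by (simp add: weakly_intertwines_def an_fermion cr_fermion cinner_adj_left cinner_adj_right
        bounded_fermion)
qed

end

section \<open>Second-quantized permutations and signs\<close>

context fock_modes
begin

text \<open>\<open>X\<close> is the second quantization of the one-particle map that sends the mode \<open>m\<close> to \<open>s m\<close>
  times the mode \<open>\<tau> m\<close>.\<close>

definition second_quant :: "('i + 'i \<Rightarrow> complex) \<Rightarrow> ('i + 'i \<Rightarrow> 'i + 'i) \<Rightarrow> ('h \<Rightarrow> 'h) \<Rightarrow> bool" where
  "second_quant s \<tau> X \<longleftrightarrow> bounded_clinear X \<and> X \<Omega> = \<Omega> \<and>
     (\<forall>x\<in>D. X x \<in> D \<and> (\<forall>m\<in>modes. X (cr m x) = s m *\<^sub>C cr (\<tau> m) (X x)))"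

lemma second_quantD:
  assumes "second_quant s \<tau> X"
  shows "bounded_clinear X" "X \<Omega> = \<Omega>" "x \<in> D \<Longrightarrow> X x \<in> D"
    "x \<in> D \<Longrightarrow> m \<in> modes \<Longrightarrow> X (cr m x) = s m *\<^sub>C cr (\<tau> m) (X x)"
  using assms by (auto simp: second_quant_def)

lemma second_quant_unique:
  assumes X: "second_quant s \<tau> X" and Y: "second_quant s' \<tau>' Y"
    and eq: "\<And>m. m \<in> modes \<Longrightarrow> s m = s' m" "\<And>m. m \<in> modes \<Longrightarrow> \<tau> m = \<tau>' m"
  shows "X = Y"
proof (rule dense_bounded_clinear_eq[OF D_dense])
  note b = bounded_clinearD[OF second_quantD(1)[OF X]] bounded_clinearD[OF second_quantD(1)[OF Y]]
  show "X x = Y x" if "x \<in> D" for x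
    using that
    by (induction rule: D_induct) (simp_all add: b second_quantD[OF X] second_quantD[OF Y] eq)
qed (rule second_quantD[OF X] second_quantD[OF Y])+

lemma second_quant_id: "second_quant (\<lambda>_. 1) id id"
  by (auto simp: second_quant_def)

lemma second_quant_comp:
  assumes X: "second_quant s \<tau> X" and Y: "second_quant s' \<tau>' Y"
    and \<tau>': "\<And>m. m \<in> modes \<Longrightarrow> \<tau>' m \<in> modes"
  shows "second_quant (\<lambda>m. s' m * s (\<tau>' m)) (\<tau> \<circ> \<tau>') (X \<circ> Y)"
  using second_quantD[OF X] second_quantD[OF Y] \<tau>'
  by (auto simp: second_quant_def bounded_clinear_comp bounded_clinearD scaleC_scaleC)

text \<open>\<open>second_quant\<close> speaks of creators only; self-adjointness of
  \<open>X\<close> and the involutive \<open>\<tau>\<close> transfer the rule to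
  annihilators.\<close>

lemma second_quant_weakly_intertwines:
  assumes X: "second_quant s \<tau> X" "adj X = X"
    and m: "m \<in> modes" "\<tau> m \<in> modes" "\<tau> (\<tau> m) = m" "s m = 1" "s (\<tau> m) = 1"
  shows "weakly_intertwines X m (\<tau> m)"
  unfolding weakly_intertwines_def
proof (intro ballI conjI)
  note sq = second_quantD[OF X(1)]
  have ad: "cinner y (X x) = cinner (X y) x" for x y
    using cinner_adj_left[OF sq(1)] X(2) by simp
  fix x y assume x: "x \<in> D" and y: "y \<in> D"
  have "cinner y (X (an m x)) = cinner (cr m (X y)) x"
    using x y sq m by (simp add: ad cinner_cr)
  also have "cr m (X y) = X (cr (\<tau> m) y)" using sq(4)[OF y m(2)] m by simp
  also have "cinner (X (cr (\<tau> m) y)) x = cinner (cr (\<tau> m) y) (X x)" by (simp add: ad)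
  finally show "cinner y (X (an m x)) = cinner (cr (\<tau> m) y) (X x)" .
  show "cinner y (X (cr m x)) = cinner (an (\<tau> m) y) (X x)"
    using x y sq m by (simp add: cinner_an)
qed

subsection \<open>Swaps of two modes\<close>

definition diff_an :: "'i + 'i \<Rightarrow> 'i + 'i \<Rightarrow> 'h \<Rightarrow> 'h" where
  "diff_an p p' x = an p' x - an p x"

definition diff_cr :: "'i + 'i \<Rightarrow> 'i + 'i \<Rightarrow> 'h \<Rightarrow> 'h" where
  "diff_cr p p' x = cr p' x - cr p x"

text \<open>The number operator of the normalized antisymmetric mode
  \<open>(p' - p) / sqrt 2\<close>; the exponent of a swap is \<open>pi\<close> times it.\<close>

definition diff_number :: "'i + 'i \<Rightarrow> 'i + 'i \<Rightarrow> 'h \<Rightarrow> 'h" where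
  "diff_number p p' x = (1/2) *\<^sub>C diff_cr p p' (diff_an p p' x)"

context
  fixes p p' :: "'i + 'i"
  assumes p: "p \<in> modes" "p' \<in> modes" "p \<noteq> p'" "isl p = isl p'"
begin

lemma diff_an_mem: "x \<in> D \<Longrightarrow> diff_an p p' x \<in> D"
  unfolding diff_an_def by (intro D_simps(6) an_mem p)

lemma diff_cr_mem: "x \<in> D \<Longrightarrow> diff_cr p p' x \<in> D"
  unfolding diff_cr_def by (intro D_simps(6) cr_mem p)

lemma diff_an_linear:
  "x \<in> D \<Longrightarrow> y \<in> D \<Longrightarrow> diff_an p p' (z *\<^sub>C x + y) = z *\<^sub>C diff_an p p' x + diff_an p p' y"
  using p by (simp add: diff_an_def an_linear scaleC_diff_right)

lemma diff_cr_linear: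
  "x \<in> D \<Longrightarrow> y \<in> D \<Longrightarrow> diff_cr p p' (z *\<^sub>C x + y) = z *\<^sub>C diff_cr p p' x + diff_cr p p' y"
  using p by (simp add: diff_cr_def cr_linear scaleC_diff_right)

lemma diff_number_linear:
  "x \<in> D \<Longrightarrow> y \<in> D \<Longrightarrow>
    diff_number p p' (z *\<^sub>C x + y) = z *\<^sub>C diff_number p p' x + diff_number p p' y"
  using diff_an_mem by (simp add: diff_number_def diff_an_linear diff_cr_linear scaleC_add_right
      scaleC_scaleC mult.commute)

lemma diff_cr_scale: "x \<in> D \<Longrightarrow> diff_cr p p' (z *\<^sub>C x) = z *\<^sub>C diff_cr p p' x"
  using p by (simp add: diff_cr_def cr_simps scaleC_diff_right)

lemma diff_adjoint:
  assumes "x \<in> D" "y \<in> D"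
  shows "cinner (diff_cr p p' x) y = cinner x (diff_an p p' y)"
    "cinner x (diff_cr p p' y) = cinner (diff_an p p' x) y"
  using assms p by (simp_all add: diff_cr_def diff_an_def cinner_simps cinner_cr cinner_an)

lemma diff_number_vacuum: "diff_number p p' \<Omega> = 0"
  using p by (simp add: diff_number_def diff_an_def diff_cr_def an_vacuum cr_simps)

text \<open>The sign is the same for \<open>p\<close> and \<open>p'\<close> and arises twice, once
  from the annihilator and once from the creator, so it cancels.\<close>

lemma diff_number_other:
  assumes m: "m \<in> modes" "m \<noteq> p" "m \<noteq> p'" and x: "x \<in> D"
  shows "diff_number p p' (cr m x) = cr m (diff_number p p' x)"
proof -
  have sg: "sg p m = sg p' m" using p by (simp add: sg_def)
  let ?u = "diff_an p p' x"
  have u: "?u \<in> D" using x by (rule diff_an_mem)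
  have "diff_an p p' (cr m x) = sg p' m *\<^sub>C cr m ?u"
    using m p x by (simp add: diff_an_def an_cr sg cr_simps an_mem scaleC_diff_right)
  then have "diff_number p p' (cr m x) = (1/2) *\<^sub>C (sg p' m *\<^sub>C diff_cr p p' (cr m ?u))"
    using u m by (simp add: diff_number_def diff_cr_scale cr_mem)
  also have "diff_cr p p' (cr m ?u) = sg p' m *\<^sub>C cr m (diff_cr p p' ?u)"
    using cr_cr[OF p(1) m(1) u] cr_cr[OF p(2) m(1) u] p m u
    by (simp add: diff_cr_def sg cr_simps cr_mem scaleC_diff_right)
  also have "(1/2) *\<^sub>C (sg p' m *\<^sub>C sg p' m *\<^sub>C cr m (diff_cr p p' ?u)) = cr m (diff_number p p' x)"
    using m u by (simp add: diff_number_def cr_simps diff_cr_mem)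
  finally show ?thesis .
qed

lemma diff_number_diff_cr:
  assumes x: "x \<in> D"
  shows "diff_number p p' (diff_cr p p' x)
    = sg p p' *\<^sub>C diff_cr p p' (diff_number p p' x) + diff_cr p p' x"
proof -
  have sg: "sg p p = sg p p'" "sg p' p' = sg p p'" "sg p' p = sg p p'"
    using p by (simp_all add: sg_def)
  let ?s = "sg p p'"
  have a: "an p x \<in> D" "an p' x \<in> D" using p x by (auto intro: an_mem)
  \<comment> \<open>The term \<open>x + x\<close> collects one unit from the relation of each mode
    with its own creator; the factor 1/2 in \<open>diff_number\<close> compensates it.\<close>
  have "diff_an p p' (diff_cr p p' x) = ?s *\<^sub>C diff_cr p p' (diff_an p p' x) + (x + x)"
    using p x a by (simp add: diff_an_def diff_cr_def an_cr an_simps cr_simps cr_mem sg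
        scaleC_diff_right scaleC_add_right algebra_simps)
  then have "diff_number p p' (diff_cr p p' x)
      = (1/2) *\<^sub>C diff_cr p p' (?s *\<^sub>C diff_cr p p' (diff_an p p' x) + (x + x))"
    by (simp add: diff_number_def)
  also have "\<dots> = (1/2) *\<^sub>C (?s *\<^sub>C diff_cr p p' (diff_cr p p' (diff_an p p' x)) + (diff_cr p p' x + diff_cr p p' x))"
    using x diff_cr_linear[of x x 1]
    by (simp add: diff_cr_linear diff_an_mem diff_cr_mem D_simps)
  also have "\<dots> = ?s *\<^sub>C diff_cr p p' ((1/2) *\<^sub>C diff_cr p p' (diff_an p p' x)) + diff_cr p p' x"
    using x by (simp add: diff_cr_scale diff_cr_mem diff_an_mem scaleC_add_right scaleC_scaleC
        mult.commute flip: scaleC_add_left)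
  finally show ?thesis by (simp add: diff_number_def)
qed

text \<open>The symmetric and the antisymmetric combination are orthogonal: the units contributed by
  \<open>p\<close> and \<open>p'\<close> cancel, and only signs remain.\<close>

lemma diff_number_sum_cr:
  assumes x: "x \<in> D"
  shows "diff_number p p' (cr p' x + cr p x)
    = cr p' (diff_number p p' x) + cr p (diff_number p p' x)"
proof -
  have sg: "sg p p = sg p p'" "sg p' p' = sg p p'" "sg p' p = sg p p'"
    using p by (simp_all add: sg_def)
  let ?s = "sg p p'" and ?u = "diff_an p p' x"
  have a: "an p x \<in> D" "an p' x \<in> D" using p x by (auto intro: an_mem)
  have u: "?u \<in> D" using x by (rule diff_an_mem)
  have "diff_an p p' (cr p' x + cr p x) = ?s *\<^sub>C (cr p' ?u + cr p ?u)"
    using p x a by (simp add: diff_an_def an_cr an_simps cr_simps cr_mem sg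
        scaleC_diff_right scaleC_add_right algebra_simps)
  then have "diff_number p p' (cr p' x + cr p x) = (1/2) *\<^sub>C ?s *\<^sub>C diff_cr p p' (cr p' ?u + cr p ?u)"
    using p u by (simp add: diff_number_def diff_cr_scale cr_mem D_simps)
  also have "diff_cr p p' (cr p' ?u + cr p ?u)
      = ?s *\<^sub>C (cr p' (diff_cr p p' ?u) + cr p (diff_cr p p' ?u))"
    using p u cr_cr[OF p(1,1) u] cr_cr[OF p(2,2) u] cr_cr[OF p(1,2) u] cr_cr[OF p(2,1) u]
    by (cases "isl p")
      (simp_all add: diff_cr_def cr_simps cr_mem D_simps sg_def scaleC_diff_right
        scaleC_add_right algebra_simps)
  also have "(1/2) *\<^sub>C ?s *\<^sub>C ?s *\<^sub>C (cr p' (diff_cr p p' ?u) + cr p (diff_cr p p' ?u))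
      = cr p' (diff_number p p' x) + cr p (diff_number p p' x)"
    using p u by (simp add: diff_number_def cr_simps diff_cr_mem scaleC_add_right)
  finally show ?thesis .
qed

lemma cr_as_diff:
  "cr p' x = (1/2) *\<^sub>C (cr p' x + cr p x) + (1/2) *\<^sub>C diff_cr p p' x"
  "cr p x = (1/2) *\<^sub>C (cr p' x + cr p x) - (1/2) *\<^sub>C diff_cr p p' x"
  by (simp_all add: diff_cr_def scaleC_add_right scaleC_diff_right flip: scaleC_add_left)

text \<open>For fermions the eigenvalue \<open>k\<close> becomes \<open>1 - k\<close>, for bosons \<open>1 + k\<close>. The exchange operator
  only depends on its parity, so integer eigenvalues treat both kinds of modes alike.\<close>

lemma diff_number_eigenvectors:
  assumes x: "x \<in> D" and k: "diff_number p p' x = complex_of_real (of_int k) *\<^sub>C x"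
  shows "m \<in> modes \<Longrightarrow> m \<noteq> p \<Longrightarrow> m \<noteq> p' \<Longrightarrow>
      diff_number p p' (cr m x) = complex_of_real (of_int k) *\<^sub>C cr m x"
    and "diff_number p p' (cr p' x + cr p x) = complex_of_real (of_int k) *\<^sub>C (cr p' x + cr p x)"
    and "diff_number p p' (diff_cr p p' x)
      = complex_of_real (of_int (if isl p then 1 - k else 1 + k)) *\<^sub>C diff_cr p p' x"
proof -
  show "diff_number p p' (cr m x) = complex_of_real (of_int k) *\<^sub>C cr m x"
    if "m \<in> modes" "m \<noteq> p" "m \<noteq> p'"
    using that x by (simp add: diff_number_other k cr_simps)
  show "diff_number p p' (cr p' x + cr p x) = complex_of_real (of_int k) *\<^sub>C (cr p' x + cr p x)"
    using p x by (simp add: diff_number_sum_cr k cr_simps scaleC_add_right)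
  show "diff_number p p' (diff_cr p p' x)
      = complex_of_real (of_int (if isl p then 1 - k else 1 + k)) *\<^sub>C diff_cr p p' x"
    using p(4) x by (simp add: diff_number_diff_cr k diff_cr_scale sg_def scaleC_add_left
        scaleC_diff_left)
qed

lemma diff_number_eigenspan:
  assumes x: "x \<in> D"
  shows "x \<in> eigenspan (diff_number p p')"
proof (rule D_subset_eigenspan[where T = "diff_number p p'", OF diff_number_vacuum _ x])
  fix m k x assume m: "m \<in> modes" and x: "x \<in> D"
    and k: "diff_number p p' x = complex_of_real (of_int k) *\<^sub>C x"
  note ev = diff_number_eigenvectors[OF x k]
  have 1: "cr p' x + cr p x \<in> eigenspan (diff_number p p')"
    using p x by (intro eigenspan.eigen[where T = "diff_number p p'", OF _ ev(2)] D_simps cr_mem)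
  have 2: "diff_cr p p' x \<in> eigenspan (diff_number p p')"
    using x by (intro eigenspan.eigen[where T = "diff_number p p'", OF _ ev(3)] diff_cr_mem)
  have 0: "0 \<in> eigenspan (diff_number p p')"
    using eigenspan.lincomb[OF 2 2, of "-1"] by simp
  have "c *\<^sub>C (cr p' x + cr p x) + d *\<^sub>C diff_cr p p' x \<in> eigenspan (diff_number p p')" for c d
    using eigenspan.lincomb[OF 1 eigenspan.lincomb[OF 2 0, of d], of c] by simp
  from this[of "1/2" "1/2"] this[of "1/2" "-1/2"]
  have "cr p' x \<in> eigenspan (diff_number p p')" "cr p x \<in> eigenspan (diff_number p p')"
    using cr_as_diff[of x] by simp_all
  moreover have "cr m x \<in> eigenspan (diff_number p p')" if "m \<noteq> p" "m \<noteq> p'"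
    using m x by (intro eigenspan.eigen[where T = "diff_number p p'", OF _ ev(1)] cr_mem that)
  ultimately show "cr m x \<in> eigenspan (diff_number p p')" by blast
qed

abbreviation diff_generator :: "'h \<Rightarrow> 'h" where
  "diff_generator x \<equiv> complex_of_real pi *\<^sub>C diff_number p p' x"

lemma diff_generator_entire: "entire_symmetric D diff_generator"
proof (rule entire_symmetricI[where N = "diff_number p p'"])
  have mem: "diff_number p p' x \<in> D" if "x \<in> D" for x
    unfolding diff_number_def using that by (intro D_simps(4) diff_cr_mem diff_an_mem)
  then show "diff_generator x \<in> D" if "x \<in> D" for x using that by (intro D_simps(4))
  show lin: "diff_generator (z *\<^sub>C x + y) = z *\<^sub>C diff_generator x + diff_generator y"
    if "x \<in> D" "y \<in> D" for x y z
    using that by (simp add: diff_number_linear scaleC_add_right scaleC_scaleC mult.commute)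
  show "cinner (diff_generator x) y = cinner x (diff_generator y)" if "x \<in> D" "y \<in> D" for x y
    using that by (simp add: diff_number_def cinner_simps diff_adjoint diff_an_mem)
  show "x \<in> eigenspan (diff_number p p')" if "x \<in> D" for x using that by (rule diff_number_eigenspan)
  fix x k assume x: "x \<in> D" and k: "diff_number p p' x = complex_of_real (of_int k) *\<^sub>C x"
  have sc: "diff_number p p' (z *\<^sub>C x) = z *\<^sub>C diff_number p p' x" for z
    using diff_number_linear[OF x D_simps(2), of z] diff_number_linear[OF D_simps(2) D_simps(2), of "-1"]
    by simp
  have pow: "(diff_generator ^^ n) x = complex_of_real (pi * of_int k) ^ n *\<^sub>C x" for n
    by (induction n) (simp_all add: sc k scaleC_scaleC mult_ac)
  show "entire diff_generator x"
    unfolding entire_def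
  proof (intro allI impI)
    fix r :: real assume r: "r \<ge> 0"
    have "summable (\<lambda>n. inverse (fact n) * (r * \<bar>pi * of_int k\<bar>) ^ n * norm x)"
      by (intro summable_mult2 summable_exp)
    moreover have "inverse (fact n) * (r * \<bar>pi * of_int k\<bar>) ^ n * norm x
        = r ^ n / fact n * norm ((diff_generator ^^ n) x)" for n
      unfolding pow norm_scaleC norm_power norm_of_real
      by (simp add: power_mult_distrib divide_inverse mult_ac)
    ultimately show "summable (\<lambda>n. r ^ n / fact n * norm ((diff_generator ^^ n) x))" by simp
  qed
qed

definition exchange :: "'h \<Rightarrow> 'h" where
  "exchange = swap (uop p) (uop p')"

lemma exchange_eq: "exchange = entire_symmetric.V D diff_generator 1"
proof -
  interpret E: entire_symmetric D diff_generator by (rule diff_generator_entire)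
  let ?G = "op_scale (complex_of_real (pi / 2))
     (op_comp (op_minus (adjoint (uop p')) (adjoint (uop p))) (op_minus (uop p') (uop p)))"
  have "exp_i ?G = E.V 1"
  proof (rule E.closure_symmetric_extension(2))
    show "E.T_graph \<subseteq> ?G"
    proof
      fix w assume "w \<in> E.T_graph"
      then obtain x where w: "w = (x, diff_generator x)" and x: "x \<in> D" by (auto simp: E.T_graph_def)
      let ?u = "diff_an p p' x"
      have "(x, ?u) \<in> op_minus (uop p') (uop p)"
        using uop_an[OF p(1) x] uop_an[OF p(2) x] unfolding op_minus_def diff_an_def by blast
      moreover have "(?u, diff_cr p p' ?u) \<in> op_minus (adjoint (uop p')) (adjoint (uop p))"
        using uop_cr[OF p(1) diff_an_mem[OF x]] uop_cr[OF p(2) diff_an_mem[OF x]]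
        unfolding op_minus_def diff_cr_def by blast
      moreover have "diff_generator x = complex_of_real (pi / 2) *\<^sub>C diff_cr p p' ?u"
        by (simp add: diff_number_def scaleC_scaleC)
      ultimately show "w \<in> ?G" unfolding w op_scale_def op_comp_def by blast
    qed
    have G: "\<exists>u a b c d. x' = complex_of_real (pi / 2) *\<^sub>C (c - d) \<and> u = a - b \<and> (x, a) \<in> uop p' \<and>
        (x, b) \<in> uop p \<and> (u, c) \<in> adjoint (uop p') \<and> (u, d) \<in> adjoint (uop p)"
      if "(x, x') \<in> ?G" for x x'
      using that by (auto simp: op_scale_def op_comp_def op_minus_def)
    fix x x' y y' assume "(x, x') \<in> ?G" "(y, y') \<in> ?G"
    from G[OF this(1)] G[OF this(2)] obtain u a b c d v a' b' c' d' where
      x: "x' = complex_of_real (pi / 2) *\<^sub>C (c - d)" "u = a - b" "(x, a) \<in> uop p'" "(x, b) \<in> uop p"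
        "(u, c) \<in> adjoint (uop p')" "(u, d) \<in> adjoint (uop p)" and
      y: "y' = complex_of_real (pi / 2) *\<^sub>C (c' - d')" "v = a' - b'" "(y, a') \<in> uop p'" "(y, b') \<in> uop p"
        "(v, c') \<in> adjoint (uop p')" "(v, d') \<in> adjoint (uop p)"
      by (elim exE conjE)
    have "cinner c y = cinner u a'" "cinner d y = cinner u b'" using x y by (auto simp: adjoint_def)
    then have 1: "cinner (c - d) y = cinner u v" using y(2) by (simp add: cinner_simps)
    have "cinner c' x = cinner v a" "cinner d' x = cinner v b" using x y by (auto simp: adjoint_def)
    then have "cinner (c' - d') x = cinner v u" using x(2) by (simp add: cinner_simps)
    then have 2: "cinner x (c' - d') = cinner u v" by (metis cinner_commute)
    show "cinner x' y = cinner x y'"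
      unfolding x(1) y(1) by (simp only: cinner_scaleC_left cinner_scaleC_right 1 2) simp
  qed
  then show ?thesis by (simp add: exchange_def swap_def)
qed

lemma exchange_eigenvector:
  assumes x: "x \<in> D" and k: "diff_number p p' x = complex_of_real (of_int k) *\<^sub>C x"
  shows "exchange x = (if even k then x else - x)"
proof -
  interpret E: entire_symmetric D diff_generator by (rule diff_generator_entire)
  have "exchange x = cis (1 * (pi * of_int k)) *\<^sub>C x"
    unfolding exchange_eq using x k by (intro E.V_eigenvector) (simp_all add: scaleC_scaleC)
  also have "cis (1 * (pi * of_int k)) = (if even k then 1 else -1)"
    by (simp add: complex_eq_iff)
  finally show ?thesis by auto
qed

lemma unitary_exchange: "unitary exchange"
proof -
  interpret E: entire_symmetric D diff_generator by (rule diff_generator_entire)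
  show ?thesis unfolding exchange_eq by (rule E.unitary_V)
qed

text \<open>On an eigenvector, the symmetric combination of creators keeps the parity of the
  eigenvalue and the antisymmetric one reverses it. Hence the exchange operator fixes the first and
  negates the second, relative to its value on the eigenvector itself.\<close>

lemma second_quant_exchange: "second_quant (\<lambda>_. 1) (Transposition.transpose p p') exchange"
proof -
  have b: "bounded_clinear exchange" using unitary_exchange by (rule unitaryD)
  note bs = bounded_clinearD[OF b]
  have mem: "exchange x \<in> D" if "x \<in> eigenspan (diff_number p p')" for x
    using that
  proof induction
    case (eigen x k)
    then show ?case using D_simps(4)[of x "-1"] by (simp add: exchange_eigenvector)
  qed (simp add: bs D_simps)
  have main: "exchange (cr m x) = cr (Transposition.transpose p p' m) (exchange x)"
    if m: "m \<in> modes" and "x \<in> eigenspan (diff_number p p')" for m x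
    using that(2)
  proof induction
    case (lincomb x y z)
    then have "Transposition.transpose p p' m \<in> modes" "x \<in> D" "y \<in> D" "exchange x \<in> D" "exchange y \<in> D"
      using m p eigenspan_mem mem by (auto simp: Transposition.transpose_def)
    then show ?case using lincomb m by (simp add: cr_linear bs)
  next
    case (eigen x k)
    note ev = diff_number_eigenvectors[OF eigen]
    have "- x = (-1) *\<^sub>C x" by simp
    then have neg: "cr m (- x) = - cr m x" if "m \<in> modes" for m
      using cr_simps(3)[OF that eigen(1), of "-1"] by simp
    have 0: "exchange x = (if even k then x else - x)" by (rule exchange_eigenvector[OF eigen])
    have plus: "exchange (cr p' x + cr p x) = (if even k then cr p' x + cr p x else - (cr p' x + cr p x))"
      using p eigen(1) by (intro exchange_eigenvector[OF _ ev(2)] D_simps cr_mem)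
    have minus: "exchange (diff_cr p p' x) = (if even k then - diff_cr p p' x else diff_cr p p' x)"
      using exchange_eigenvector[OF diff_cr_mem[OF eigen(1)] ev(3)] by (cases "even k") auto
    define S G where "S = cr p' x + cr p x" and "G = diff_cr p p' x"
    have c: "cr p' x = (1/2) *\<^sub>C S + (1/2) *\<^sub>C G" "cr p x = (1/2) *\<^sub>C S - (1/2) *\<^sub>C G"
      using cr_as_diff[of x] by (simp_all add: S_def G_def)
    have ex: "exchange S = (if even k then S else - S)" "exchange G = (if even k then - G else G)"
      unfolding S_def G_def by (rule plus minus)+
    have "exchange (cr p x) = (if even k then cr p' x else - cr p' x)"
      "exchange (cr p' x) = (if even k then cr p x else - cr p x)"
      unfolding c by (simp_all add: bs ex)
    note swapped = this
    consider "m = p" | "m = p'" | "m \<noteq> p" "m \<noteq> p'" by blast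
    then show ?case
    proof cases
      case 1
      then show ?thesis using p by (simp add: 0 neg swapped)
    next
      case 2
      then show ?thesis using p by (simp add: 0 neg swapped)
    next
      case 3
      have "exchange (cr m x) = (if even k then cr m x else - cr m x)"
        using m eigen(1) 3 by (intro exchange_eigenvector[OF _ ev(1)] cr_mem)
      then show ?thesis using 3 m by (simp add: 0 neg Transposition.transpose_apply_other)
    qed
  qed
  have "exchange \<Omega> = \<Omega>"
    using exchange_eigenvector[OF finite_particle.vacuum, of 0] diff_number_vacuum by simp
  then show ?thesis
    using b mem main diff_number_eigenspan by (simp add: second_quant_def)
qed

text \<open>On \<open>D\<close> the generator is a product of two operators that preserve
  \<open>D\<close>, so weak commutation is applied to one factor at a time and then exponentiated.
  This is what makes a swap local.\<close>

lemma commute_exchange: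
  assumes X: "bounded_clinear X" and w: "weakly_intertwines X p p" "weakly_intertwines X p' p'"
  shows "X \<circ> exchange = exchange \<circ> X"
proof -
  interpret E: entire_symmetric D diff_generator by (rule diff_generator_entire)
  have dom: "Domain E.T_graph = D" by (auto simp: E.T_graph_def)
  note ww = weakly_intertwinesD[OF w(1)] weakly_intertwinesD[OF w(2)]
  have c: "cinner y (X (diff_cr p p' x)) = cinner (diff_an p p' y) (X x)"
    "cinner y (X (diff_an p p' x)) = cinner (diff_cr p p' y) (X x)" if "x \<in> D" "y \<in> D" for x y
    using that ww by (simp_all add: diff_an_def diff_cr_def bounded_clinearD[OF X] cinner_simps)
  show ?thesis
    unfolding exchange_eq
  proof (rule unitary_group_intertwine[OF E.unitary_group_V E.generator_V _
        E.unitary_group_V E.generator_V _ X])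
    fix x x' y y' assume "(x, x') \<in> E.T_graph" "(y, y') \<in> E.T_graph"
    then have *: "x \<in> D" "y \<in> D" "x' = diff_generator x" "y' = diff_generator y"
      by (auto simp: E.T_graph_def)
    have "cinner y (X (diff_cr p p' (diff_an p p' x))) = cinner (diff_cr p p' (diff_an p p' y)) (X x)"
      using * by (simp add: c diff_an_mem)
    then show "cinner y (X x') = cinner y' (X x)"
      by (simp add: *(3,4) diff_number_def bounded_clinearD[OF X] cinner_simps)
  qed (simp_all add: dom D_dense)
qed

end

subsection \<open>Klein operators\<close>

definition klein_sign :: "'i set \<Rightarrow> 'i + 'i \<Rightarrow> complex" where
  "klein_sign J m = (if m \<in> Inl ` J then -1 else 1)"

definition commutes_fermion :: "('h \<Rightarrow> 'h) \<Rightarrow> 'i \<Rightarrow> bool" where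
  "commutes_fermion X i \<longleftrightarrow> X \<circ> f i = f i \<circ> X \<and> X \<circ> adj (f i) = adj (f i) \<circ> X"

lemma commutes_fermionD:
  assumes "commutes_fermion X i"
  shows "X (f i x) = f i (X x)" "X (adj (f i) x) = adj (f i) (X x)"
  using assms unfolding commutes_fermion_def by (metis comp_apply)+

lemma commutes_fermion_weakly:
  "bounded_clinear X \<Longrightarrow> i \<in> I \<Longrightarrow> commutes_fermion X i \<longleftrightarrow> weakly_intertwines X (Inl i) (Inl i)"
  by (simp add: commutes_fermion_def weakly_intertwines_fermion)

text \<open>\<open>1 - 2 n\<close> equals \<open>(-1)^n\<close> because the occupation number
  \<open>n\<close> of a fermionic mode is 0 or 1.\<close>

definition site_parity :: "'i \<Rightarrow> 'h \<Rightarrow> 'h" where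
  "site_parity i x = x - 2 *\<^sub>C adj (f i) (f i x)"

lemma site_parity:
  assumes i: "i \<in> I"
  shows "bounded_clinear (site_parity i)" "adj (site_parity i) = site_parity i"
    "second_quant (klein_sign {i}) id (site_parity i)"
    "j \<in> I \<Longrightarrow> j \<noteq> i \<Longrightarrow> commutes_fermion (site_parity i) j"
    "bounded_clinear X \<Longrightarrow> commutes_fermion X i \<Longrightarrow> X \<circ> site_parity i = site_parity i \<circ> X"
proof -
  note b = bounded_fermion[OF i] bounded_fermion_adj[OF i]
  have b2: "bounded_clinear (\<lambda>x. adj (f i) (f i x))"
    using bounded_clinear_comp[OF b(2,1)] by (simp add: comp_def)
  show bR: "bounded_clinear (site_parity i)"
    unfolding site_parity_def by (intro bounded_clinear_diff bounded_clinear_scaleC b2 bounded_clinear_id)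
  show "adj (site_parity i) = site_parity i"
    by (rule adj_eqI) (simp add: site_parity_def cinner_simps cinner_adj_left cinner_adj_right b)
  show comm: "bounded_clinear X \<Longrightarrow> commutes_fermion X i \<Longrightarrow> X \<circ> site_parity i = site_parity i \<circ> X" for X
    by (auto simp: fun_eq_iff site_parity_def bounded_clinearD commutes_fermionD)
  show "commutes_fermion (site_parity i) j" if j: "j \<in> I" "j \<noteq> i"
    unfolding commutes_fermion_def
  proof (intro conjI ext)
    fix x
    note bj = bounded_fermion[OF j(1)] bounded_fermion_adj[OF j(1)]
    have "f i (f j x) = - f j (f i x)" "adj (f i) (f j (f i x)) = - f j (adj (f i) (f i x))"
      "f i (adj (f j) x) = - adj (f j) (f i x)"
      "adj (f i) (adj (f j) (f i x)) = - adj (f j) (adj (f i) (f i x))"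
      using CAR_D[OF fermion_CAR i j(1)] CAR_D(3)[OF fermion_CAR j(1) i, of "f i x"] j(2) by auto
    then show "(site_parity i \<circ> f j) x = (f j \<circ> site_parity i) x"
      "(site_parity i \<circ> adj (f j)) x = (adj (f j) \<circ> site_parity i) x"
      by (simp_all add: site_parity_def bounded_clinearD[OF bj(1)] bounded_clinearD[OF bj(2)]
          bounded_clinearD[OF b(1)] bounded_clinearD[OF b(2)])
  qed
  let ?i = "Inl i :: 'i + 'i"
  have im: "?i \<in> modes" using i by auto
  have R: "site_parity i x = x - 2 *\<^sub>C cr ?i (an ?i x)" for x
    by (simp add: site_parity_def an_fermion cr_fermion i)
  show "second_quant (klein_sign {i}) id (site_parity i)"
    unfolding second_quant_def
  proof (intro conjI ballI)
    show "site_parity i \<Omega> = \<Omega>" using im by (simp add: R an_vacuum cr_simps)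
    fix x assume x: "x \<in> D"
    then show "site_parity i x \<in> D" using im by (simp add: R an_mem cr_mem D_simps)
    fix m assume m: "m \<in> modes"
    show "site_parity i (cr m x) = klein_sign {i} m *\<^sub>C cr (id m) (site_parity i x)"
    proof (cases "m = ?i")
      case True
      have cc: "cr ?i (cr ?i y) = 0" if "y \<in> D" for y
      proof -
        have "cr ?i (cr ?i y) = - cr ?i (cr ?i y)" using cr_cr[OF im im that] by simp
        then have "cr ?i (cr ?i y) + cr ?i (cr ?i y) = 0" by (simp only: eq_neg_iff_add_eq_0)
        then have "2 *\<^sub>R cr ?i (cr ?i y) = 0" by (simp only: scaleR_2)
        then show ?thesis by simp
      qed
      have "an ?i (cr ?i x) = - cr ?i (an ?i x) + x" using an_cr[OF im im x] by simp
      then have "site_parity i (cr ?i x) = cr ?i x - 2 *\<^sub>C cr ?i (x - cr ?i (an ?i x))"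
        by (simp add: R)
      also have "\<dots> = - cr ?i (site_parity i x)"
        using x im by (simp add: R cr_simps an_mem cr_mem D_simps cc scaleC_add_left[of 1 1, simplified])
      finally show ?thesis using True by (simp add: klein_sign_def)
    next
      case False
      have "cr ?i (cr m (an ?i x)) = sg ?i m *\<^sub>C cr m (cr ?i (an ?i x))"
        using x im m by (intro cr_cr an_mem)
      then have "site_parity i (cr m x) = cr m (site_parity i x)"
        using x im m False by (simp add: R an_cr cr_simps an_mem cr_mem D_simps)
      then show ?thesis using False by (auto simp: klein_sign_def)
    qed
  qed (rule bR)
qed

text \<open>The parity of the fermions in \<open>J\<close>. The last clause says that it is built
  from these fermions.\<close>

definition klein_operator :: "'i set \<Rightarrow> ('h \<Rightarrow> 'h) \<Rightarrow> bool" where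
  "klein_operator J \<kappa> \<longleftrightarrow> second_quant (klein_sign J) id \<kappa> \<and> adj \<kappa> = \<kappa> \<and>
     (\<forall>X. bounded_clinear X \<longrightarrow> (\<forall>i\<in>J. commutes_fermion X i) \<longrightarrow> X \<circ> \<kappa> = \<kappa> \<circ> X)"

text \<open>A product of site parities; the factors commute, so the product is again
  self-adjoint.\<close>

lemma klein_operator_exists: "finite J \<Longrightarrow> J \<subseteq> I \<Longrightarrow> \<exists>\<kappa>. klein_operator J \<kappa>"
proof (induction rule: finite_induct)
  case empty
  have "klein_operator {} id"
    unfolding klein_operator_def
    by (intro conjI allI impI) (simp_all add: second_quant_def klein_sign_def)
  then show ?case by blast
next
  case (insert i J)
  then obtain \<kappa> where \<kappa>: "second_quant (klein_sign J) id \<kappa>" "adj \<kappa> = \<kappa>"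
    "\<And>X. bounded_clinear X \<Longrightarrow> (\<And>i. i \<in> J \<Longrightarrow> commutes_fermion X i) \<Longrightarrow> X \<circ> \<kappa> = \<kappa> \<circ> X"
    by (auto simp: klein_operator_def)
  have i: "i \<in> I" using insert by auto
  note R = site_parity[OF i]
  have com: "site_parity i \<circ> \<kappa> = \<kappa> \<circ> site_parity i"
    using insert by (intro \<kappa>(3) R(1) R(4)) auto
  have "second_quant (\<lambda>m. klein_sign J m * klein_sign {i} (id m)) (id \<circ> id) (site_parity i \<circ> \<kappa>)"
    by (rule second_quant_comp[OF R(3) \<kappa>(1)]) auto
  moreover have "(\<lambda>m. klein_sign J m * klein_sign {i} (id m)) = klein_sign (insert i J)"
    using insert(2) by (auto simp: klein_sign_def fun_eq_iff)
  moreover have "adj (site_parity i \<circ> \<kappa>) = site_parity i \<circ> \<kappa>"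
    using second_quantD(1)[OF \<kappa>(1)] R(1,2) \<kappa>(2) com by (simp add: adj_comp)
  moreover have "X \<circ> (site_parity i \<circ> \<kappa>) = site_parity i \<circ> \<kappa> \<circ> X"
    if X: "bounded_clinear X" "\<forall>j\<in>insert i J. commutes_fermion X j" for X
  proof -
    have "X \<circ> site_parity i = site_parity i \<circ> X" "X \<circ> \<kappa> = \<kappa> \<circ> X"
      using X by (auto intro!: R(5) \<kappa>(3))
    then show ?thesis by (metis comp_assoc)
  qed
  ultimately show ?case by (auto simp: klein_operator_def)
qed

lemma klein_operator_involution: "klein_operator J \<kappa> \<Longrightarrow> \<kappa> \<circ> \<kappa> = id"
proof -
  assume "klein_operator J \<kappa>"
  then have \<kappa>: "second_quant (klein_sign J) id \<kappa>" by (simp add: klein_operator_def)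
  from second_quant_comp[OF this this]
  have "second_quant (\<lambda>m. klein_sign J m * klein_sign J (id m)) (id \<circ> id) (\<kappa> \<circ> \<kappa>)" by simp
  then show ?thesis by (rule second_quant_unique[OF _ second_quant_id]) (auto simp: klein_sign_def)
qed

lemma klein_operator_fermion:
  assumes \<kappa>: "klein_operator J \<kappa>" and i: "i \<in> I"
  shows "\<kappa> (f i x) = klein_sign J (Inl i) *\<^sub>C f i (\<kappa> x)"
    "\<kappa> (adj (f i) x) = klein_sign J (Inl i) *\<^sub>C adj (f i) (\<kappa> x)"
proof -
  let ?s = "klein_sign J (Inl i)"
  have sq: "second_quant (klein_sign J) id \<kappa>" and ad: "adj \<kappa> = \<kappa>"
    using \<kappa> by (auto simp: klein_operator_def)
  note b = bounded_fermion[OF i] bounded_fermion_adj[OF i] second_quantD(1)[OF sq]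
  have "\<kappa> \<circ> adj (f i) = (\<lambda>x. ?s *\<^sub>C (adj (f i) \<circ> \<kappa>) x)"
  proof (rule dense_bounded_clinear_eq[OF D_dense])
    fix x assume "x \<in> D"
    then show "(\<kappa> \<circ> adj (f i)) x = ?s *\<^sub>C (adj (f i) \<circ> \<kappa>) x"
      using second_quantD(4)[OF sq, of x "Inl i"] i by (simp add: cr_fermion InlI)
  qed (intro bounded_clinear_scaleC bounded_clinear_comp b)+
  then show *: "\<kappa> (adj (f i) x) = ?s *\<^sub>C adj (f i) (\<kappa> x)" for x
    by (simp add: fun_eq_iff)
  have kk: "cinner (\<kappa> x) y = cinner x (\<kappa> y)" for x y
    using cinner_adj_left[OF b(3)] ad by simp
  show "\<kappa> (f i x) = ?s *\<^sub>C f i (\<kappa> x)"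
  proof (rule cinner_ext)
    fix y
    have "cinner y (\<kappa> (f i x)) = cinner (adj (f i) (\<kappa> y)) x"
      by (simp add: cinner_adj_left b flip: kk)
    also have "\<dots> = ?s * cinner (\<kappa> (adj (f i) y)) x"
      by (simp add: * cinner_simps klein_sign_def)
    also have "\<dots> = cinner y (?s *\<^sub>C f i (\<kappa> x))"
      by (simp add: kk cinner_adj_left b cinner_simps)
    finally show "cinner y (\<kappa> (f i x)) = cinner y (?s *\<^sub>C f i (\<kappa> x))" .
  qed
qed

lemma klein_operator_boson:
  assumes \<kappa>: "klein_operator J \<kappa>" and i: "i \<in> I"
  shows "weakly_intertwines \<kappa> (Inr i) (Inr i)"
proof -
  have "second_quant (klein_sign J) id \<kappa>" "adj \<kappa> = \<kappa>" using \<kappa> by (auto simp: klein_operator_def)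
  from second_quant_weakly_intertwines[OF this, of "Inr i"] show ?thesis
    using i by (simp add: klein_sign_def InrI image_iff)
qed

end

section \<open>Algebras of regions\<close>

lemma commutantD:
  "X \<in> commutant M \<Longrightarrow> bounded_clinear X"
  "X \<in> commutant M \<Longrightarrow> Y \<in> M \<Longrightarrow> X \<circ> Y = Y \<circ> X"
  "X \<in> commutant M \<Longrightarrow> Y \<in> M \<Longrightarrow> X (Y x) = Y (X x)"
  by (auto simp: commutant_def fun_eq_iff)

lemma commutantI:
  "bounded_clinear X \<Longrightarrow> (\<And>Y. Y \<in> M \<Longrightarrow> X \<circ> Y = Y \<circ> X) \<Longrightarrow> X \<in> commutant M"
  by (auto simp: commutant_def)

lemma commutant_id: "id \<in> commutant M"
  by (auto simp: commutant_def)

lemma commutant_comp: "X \<in> commutant M \<Longrightarrow> Y \<in> commutant M \<Longrightarrow> X \<circ> Y \<in> commutant M"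
  by (auto simp: commutant_def bounded_clinear_comp fun_eq_iff)

lemma commutant_add:
  assumes "\<And>Z. Z \<in> M \<Longrightarrow> bounded_clinear Z" "X \<in> commutant M" "Y \<in> commutant M"
  shows "(\<lambda>x. X x + Y x) \<in> commutant M"
  using assms by (auto simp: commutant_def bounded_clinear_add fun_eq_iff bounded_clinearD)

lemma commutant_scaleC:
  assumes "\<And>Z. Z \<in> M \<Longrightarrow> bounded_clinear Z" "X \<in> commutant M"
  shows "(\<lambda>x. z *\<^sub>C X x) \<in> commutant M"
  using assms by (auto simp: commutant_def bounded_clinear_scaleC fun_eq_iff bounded_clinearD)

lemma commutant_adj:
  assumes M: "\<And>Z. Z \<in> M \<Longrightarrow> bounded_clinear Z" "\<And>Z. Z \<in> M \<Longrightarrow> adj Z \<in> M" and X: "X \<in> commutant M"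
  shows "adj X \<in> commutant M"
proof (rule commutantI)
  show "bounded_clinear (adj X)" using X by (intro bounded_clinear_adj commutantD(1))
  fix Y assume Y: "Y \<in> M"
  have "adj X \<circ> adj (adj Y) = adj (adj Y) \<circ> adj X"
    by (intro commute_adj commutantD(1)[OF X] commutantD(2)[OF X] M Y bounded_clinear_adj)
  then show "adj X \<circ> Y = Y \<circ> adj X" using M Y by simp
qed

context fock_modes
begin

text \<open>The commutant of the generators of \<open>J\<close>, with the Weyl operators replaced by
  weak commutation with the mode operators, the form that can be used on \<open>D\<close>.\<close>

definition com :: "'i set \<Rightarrow> ('h \<Rightarrow> 'h) set" where
  "com J = {X. bounded_clinear X \<and>
     (\<forall>i\<in>J. commutes_fermion X i \<and> weakly_intertwines X (Inr i) (Inr i))}"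

lemma weakly_intertwines_iff_weyl:
  assumes "bounded_clinear X" "i \<in> I"
  shows "weakly_intertwines X (Inr i) (Inr i) \<longleftrightarrow> (\<forall>z. X \<circ> weyl (q i) z = weyl (q i) z \<circ> X)"
  using assms commute_weyl_weak weakly_intertwines_weyl by blast

lemma commutant_generators:
  assumes J: "J \<subseteq> I"
  defines "G \<equiv> f ` J \<union> {weyl (q i) z | i z. i \<in> J}"
  shows "commutant (G \<union> adj ` G) = com J"
proof (intro equalityI subsetI)
  fix X assume X: "X \<in> commutant (G \<union> adj ` G)"
  have "X \<circ> f i = f i \<circ> X" "X \<circ> adj (f i) = adj (f i) \<circ> X" "X \<circ> weyl (q i) z = weyl (q i) z \<circ> X"
    if "i \<in> J" for i z
    using that by (intro commutantD(2)[OF X]; auto simp: G_def)+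
  then show "X \<in> com J"
    using commutantD(1)[OF X] J
    by (auto simp: com_def commutes_fermion_def weakly_intertwines_iff_weyl subset_iff)
next
  fix X assume X: "X \<in> com J"
  then have b: "bounded_clinear X" by (simp add: com_def)
  show "X \<in> commutant (G \<union> adj ` G)"
  proof (rule commutantI[OF b])
    have w: "X \<circ> weyl (q i) z = weyl (q i) z \<circ> X" if "i \<in> J" for i z
      using X that J weakly_intertwines_iff_weyl[OF b] by (auto simp: com_def)
    have fe: "X \<circ> f i = f i \<circ> X" "X \<circ> adj (f i) = adj (f i) \<circ> X" if "i \<in> J" for i
      using X that by (auto simp: com_def commutes_fermion_def)
    fix Y assume "Y \<in> G \<union> adj ` G"
    then consider i where "i \<in> J" "Y = f i" | i z where "i \<in> J" "Y = weyl (q i) z"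
      | i where "i \<in> J" "Y = adj (f i)" | i z where "i \<in> J" "Y = adj (weyl (q i) z)"
      unfolding G_def by blast
    then show "X \<circ> Y = Y \<circ> X"
      by cases (use w fe J adj_weyl in \<open>auto simp: subset_iff\<close>)
  qed
qed

lemma mode_algebra_commutant: "J \<subseteq> I \<Longrightarrow> mode_algebra J f q = commutant (com J)"
  unfolding mode_algebra_def vN_generated_def by (simp only: commutant_generators)

lemma com_bounded: "X \<in> com J \<Longrightarrow> bounded_clinear X"
  by (simp add: com_def)

lemma com_adj:
  assumes "J \<subseteq> I"
  shows "X \<in> com J \<Longrightarrow> adj X \<in> com J"
proof -
  define G where "G = f ` J \<union> {weyl (q i) z | i z. i \<in> J}"
  have com: "com J = commutant (G \<union> adj ` G)" using commutant_generators[OF assms] by (simp add: G_def)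
  have b: "bounded_clinear Z" if "Z \<in> G" for Z
    using that assms by (auto simp: G_def bounded_fermion subset_iff intro: unitaryD(1)[OF unitary_weyl])
  have b': "bounded_clinear Z" if "Z \<in> G \<union> adj ` G" for Z
    using that b by (auto intro: bounded_clinear_adj)
  have "adj Z \<in> G \<union> adj ` G" if "Z \<in> G \<union> adj ` G" for Z
    using that b by auto
  with b' show "X \<in> com J \<Longrightarrow> adj X \<in> com J" unfolding com by (rule commutant_adj)
qed

lemma com_weakly:
  "J \<subseteq> I \<Longrightarrow> X \<in> com J \<Longrightarrow> m \<in> J <+> J \<Longrightarrow> weakly_intertwines X m m"
  by (auto simp: com_def commutes_fermion_weakly subset_iff)

lemma weakly_intertwinesI:
  assumes "\<And>x. x \<in> D \<Longrightarrow> X x \<in> D" "\<And>x. x \<in> D \<Longrightarrow> X (an m x) = an m (X x)"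
    "\<And>x. x \<in> D \<Longrightarrow> X (cr m x) = cr m (X x)" "m \<in> modes"
  shows "weakly_intertwines X m m"
  using assms by (auto simp: weakly_intertwines_def cinner_cr cinner_an)

lemma fermion_weakly_boson:
  assumes "i \<in> I" "j \<in> I"
  shows "weakly_intertwines (f i) (Inr j) (Inr j)" "weakly_intertwines (adj (f i)) (Inr j) (Inr j)"
proof -
  have m: "Inl i \<in> modes" "Inr j \<in> modes" using assms by auto
  have "weakly_intertwines (an (Inl i)) (Inr j) (Inr j)"
    using m by (intro weakly_intertwinesI) (auto simp: an_mem an_an[of "Inl i"] an_cr)
  then show "weakly_intertwines (f i) (Inr j) (Inr j)" using assms by (simp add: an_fermion)
  have "weakly_intertwines (cr (Inl i)) (Inr j) (Inr j)"
    using m by (intro weakly_intertwinesI) (auto simp: cr_mem cr_cr[of "Inl i"] an_cr)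
  then show "weakly_intertwines (adj (f i)) (Inr j) (Inr j)" using assms by (simp add: cr_fermion)
qed

subsection \<open>Vacuum spaces\<close>

text \<open>Orthogonality to all created vectors expresses being killed by the annihilators in
  \<open>L\<close> in a form that makes sense off \<open>D\<close> and is visibly closed.\<close>

definition vac_space :: "('i + 'i) set \<Rightarrow> 'h set" where
  "vac_space L = {u. \<forall>m\<in>L. \<forall>y\<in>D. cinner (cr m y) u = 0}"

inductive_set excited :: "('i + 'i) set \<Rightarrow> 'h set" for L where
  create: "m \<in> L \<Longrightarrow> y \<in> D \<Longrightarrow> cr m y \<in> excited L"
| lincomb: "x \<in> excited L \<Longrightarrow> y \<in> excited L \<Longrightarrow> z *\<^sub>C x + y \<in> excited L"
| zero: "0 \<in> excited L"

lemma vac_space_closed: "csubspace (vac_space L)" "closed (vac_space L)"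
proof -
  show "csubspace (vac_space L)" by (auto simp: csubspace_def vac_space_def cinner_simps)
  have "vac_space L = (\<Inter>m\<in>L. \<Inter>y\<in>D. {u. cinner (cr m y) u = 0})" by (auto simp: vac_space_def)
  moreover have "closed {u. cinner v u = 0}" for v :: 'h
    by (intro closed_Collect_eq continuous_on_cinner continuous_intros)
  ultimately show "closed (vac_space L)" by (simp add: closed_INT)
qed

lemma excited_orthogonal: "x \<in> excited L \<Longrightarrow> u \<in> vac_space L \<Longrightarrow> cinner x u = 0"
  by (induction rule: excited.induct) (auto simp: vac_space_def cinner_simps)

lemma vac_spaceI: "L \<subseteq> modes \<Longrightarrow> x \<in> D \<Longrightarrow> (\<And>m. m \<in> L \<Longrightarrow> an m x = 0) \<Longrightarrow> x \<in> vac_space L"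
  by (auto simp: vac_space_def cinner_cr subset_iff)

text \<open>The splitting never leaves \<open>D\<close>: a creator from \<open>L\<close> makes the
  whole vector excited, and a creator outside \<open>L\<close> respects both parts.\<close>

lemma vacuum_decomposition:
  assumes L: "L \<subseteq> modes" and x: "x \<in> D"
  shows "\<exists>x0 x1. x = x0 + x1 \<and> x0 \<in> D \<and> (\<forall>m\<in>L. an m x0 = 0) \<and> x1 \<in> excited L"
  using x
proof (induction rule: D_induct)
  case vacuum
  show ?case using L by (intro exI[of _ \<Omega>] exI[of _ 0])
      (auto simp: an_vacuum subset_iff intro: excited.zero finite_particle.vacuum)
next
  case (lincomb z x y)
  then obtain x0 x1 y0 y1 where x: "x = x0 + x1" "x0 \<in> D" "\<forall>m\<in>L. an m x0 = 0" "x1 \<in> excited L"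
    and y: "y = y0 + y1" "y0 \<in> D" "\<forall>m\<in>L. an m y0 = 0" "y1 \<in> excited L" by blast
  have "z *\<^sub>C x + y = (z *\<^sub>C x0 + y0) + (z *\<^sub>C x1 + y1)" by (simp add: x y scaleC_add_right)
  moreover have "z *\<^sub>C x0 + y0 \<in> D" using x y by (intro D_simps)
  moreover have "\<forall>m\<in>L. an m (z *\<^sub>C x0 + y0) = 0" using x y L by (auto simp: an_linear subset_iff)
  moreover have "z *\<^sub>C x1 + y1 \<in> excited L" using x y by (intro excited.lincomb)
  ultimately show ?case by blast
next
  case (create m x)
  show ?case
  proof (cases "m \<in> L")
    case True
    then show ?thesis using create L
      by (intro exI[of _ 0] exI[of _ "cr m x"]) (auto simp: an_simps subset_iff D_simps intro: excited.create)
  next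
    case False
    obtain x0 x1 where x: "x = x0 + x1" "x0 \<in> D" "\<forall>m\<in>L. an m x0 = 0" "x1 \<in> excited L"
      using create by blast
    have eD: "y \<in> D" if "y \<in> excited L" for y
      using that L by induction (auto simp: D_simps cr_mem subset_iff)
    have "cr m y \<in> excited L" if "y \<in> excited L" for y
      using that
    proof induction
      case (create m' y)
      then have "cr m (cr m' y) = sg m m' *\<^sub>C cr m' (cr m y) + 0"
        using L \<open>m \<in> modes\<close> by (simp add: cr_cr[of m] subset_iff)
      moreover have "sg m m' *\<^sub>C cr m' (cr m y) + 0 \<in> excited L"
        using create \<open>m \<in> modes\<close> by (intro excited.intros cr_mem)
      ultimately show ?case by simp
    next
      case (lincomb x y z)
      then show ?case using \<open>m \<in> modes\<close> eD by (auto simp: cr_linear intro: excited.lincomb)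
    qed (use create(1) in \<open>auto simp: cr_simps intro: excited.zero\<close>)
    moreover have "an m' (cr m x0) = 0" if "m' \<in> L" for m'
      using that x L create(1) False by (auto simp: an_cr cr_simps subset_iff)
    moreover have "cr m x = cr m x0 + cr m x1" using x create(1) eD by (simp add: cr_simps)
    ultimately show ?thesis using x create(1) cr_mem by blast
  qed
qed

text \<open>Dropping the excited part of an approximant brings it no farther from \<open>u\<close>,
  since that part is orthogonal to the vacuum space.\<close>

lemma vac_space_approx:
  assumes L: "L \<subseteq> modes" and u: "u \<in> vac_space L"
  shows "\<exists>s. (\<forall>n. s n \<in> D \<and> (\<forall>m\<in>L. an m (s n) = 0)) \<and> s \<longlonglongrightarrow> u"
proof -
  obtain s where s: "\<And>n. s n \<in> D" "s \<longlonglongrightarrow> u"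
    using D_dense by (metis UNIV_I closure_sequential)
  have "\<forall>n. \<exists>x0. (x0 \<in> D \<and> (\<forall>m\<in>L. an m x0 = 0)) \<and> norm (x0 - u) \<le> norm (s n - u)"
  proof
    fix n
    obtain x0 x1 where x: "s n = x0 + x1" "x0 \<in> D" "\<forall>m\<in>L. an m x0 = 0" "x1 \<in> excited L"
      using vacuum_decomposition[OF L s(1)] by blast
    have "x0 - u \<in> vac_space L"
      using x by (intro csubspaceD(5)[OF vac_space_closed(1) _ u] vac_spaceI[OF L]) auto
    then have "cinner x1 (x0 - u) = 0" using x(4) excited_orthogonal by blast
    then have "(norm (x1 + (x0 - u)))\<^sup>2 = (norm x1)\<^sup>2 + (norm (x0 - u))\<^sup>2" by (rule pythagoras)
    moreover have "x1 + (x0 - u) = s n - u" using x(1) by simp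
    ultimately have "(norm (x0 - u))\<^sup>2 \<le> (norm (s n - u))\<^sup>2" by simp
    then have "norm (x0 - u) \<le> norm (s n - u)" by (rule power2_le_imp_le) simp
    then show "\<exists>x0. (x0 \<in> D \<and> (\<forall>m\<in>L. an m x0 = 0)) \<and> norm (x0 - u) \<le> norm (s n - u)"
      using x by blast
  qed
  from choice[OF this] obtain t where t: "\<And>n. t n \<in> D \<and> (\<forall>m\<in>L. an m (t n) = 0)"
    "\<And>n. norm (t n - u) \<le> norm (s n - u)" by blast
  have "(\<lambda>n. norm (s n - u)) \<longlonglongrightarrow> 0" using s(2) by (simp add: LIM_zero_iff tendsto_norm_zero_iff)
  then have "(\<lambda>n. t n - u) \<longlonglongrightarrow> 0"
    by (rule Lim_null_comparison[rotated]) (use t(2) in simp)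
  then have "t \<longlonglongrightarrow> u" by (simp add: LIM_zero_iff)
  then show ?thesis using t(1) by blast
qed

lemma vac_space_invariant:
  assumes L: "L \<subseteq> modes" and X: "bounded_clinear X"
    and inv: "\<And>x. x \<in> D \<Longrightarrow> (\<And>m. m \<in> L \<Longrightarrow> an m x = 0) \<Longrightarrow> X x \<in> vac_space L"
    and u: "u \<in> vac_space L"
  shows "X u \<in> vac_space L"
proof -
  obtain s where s: "\<And>n. s n \<in> D" "\<And>n m. m \<in> L \<Longrightarrow> an m (s n) = 0" "s \<longlonglongrightarrow> u"
    using vac_space_approx[OF L u] by blast
  have "(\<lambda>n. X (s n)) \<longlonglongrightarrow> X u"
    by (rule bounded_linear.tendsto[OF bounded_clinear_bounded_linear[OF X] s(3)])
  moreover have "X (s n) \<in> vac_space L" for n using inv s by blast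
  ultimately show ?thesis
    using closed_sequentially[OF vac_space_closed(2), of "\<lambda>n. X (s n)" L "X u"] by blast
qed

lemma vac_space_all:
  assumes "u \<in> vac_space modes"
  shows "u = cinner \<Omega> u *\<^sub>C \<Omega>"
proof -
  let ?v = "u - cinner \<Omega> u *\<^sub>C \<Omega>"
  have "\<Omega> \<in> vac_space modes"
    by (intro vac_spaceI) (auto intro: finite_particle.vacuum an_vacuum)
  then have v: "?v \<in> vac_space modes"
    using assms by (intro csubspaceD(3,5)[OF vac_space_closed(1)])
  have "cinner x ?v = cinner x 0" if "x \<in> D" for x
    using that
  proof (induction rule: D_induct)
    case (create m x)
    then show ?case using v by (simp add: vac_space_def)
  qed (simp_all add: cinner_simps algebra_simps)
  then have "?v = 0" by (rule dense_cinner_eq[OF D_dense])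
  then show ?thesis by simp
qed

definition vac_proj :: "'i set \<Rightarrow> 'h \<Rightarrow> 'h" where
  "vac_proj J = proj (vac_space (J <+> J))"

lemma vac_proj:
  shows bounded_vac_proj: "bounded_clinear (vac_proj J)" and adj_vac_proj: "adj (vac_proj J) = vac_proj J"
    and vac_proj_mem: "vac_proj J x \<in> vac_space (J <+> J)"
    and vac_proj_idem: "vac_proj J (vac_proj J x) = vac_proj J x"
    and vac_proj_fix: "x \<in> vac_space (J <+> J) \<Longrightarrow> vac_proj J x = x"
  unfolding vac_proj_def
  by (simp_all add: bounded_clinear_proj adj_proj proj vac_space_closed)

lemma vac_proj_vacuum: "J \<subseteq> I \<Longrightarrow> vac_proj J \<Omega> = \<Omega>"
  by (intro vac_proj_fix vac_spaceI) (auto intro: finite_particle.vacuum an_vacuum)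

lemma com_vac_space:
  assumes J: "J \<subseteq> I" and X: "X \<in> com J" and u: "u \<in> vac_space (J <+> J)"
  shows "X u \<in> vac_space (J <+> J)"
proof (rule vac_space_invariant[OF _ com_bounded[OF X] _ u])
  show "J <+> J \<subseteq> modes" using J by auto
  fix x assume x: "x \<in> D" "\<And>m. m \<in> J <+> J \<Longrightarrow> an m x = 0"
  have "cinner (cr m y) (X x) = 0" if "m \<in> J <+> J" "y \<in> D" for m y
  proof -
    have "cinner (cr m y) (X x) = cinner y (X (an m x))"
      using weakly_intertwinesD(1)[OF com_weakly[OF J X that(1)] x(1) that(2)] by simp
    then show ?thesis using x(2)[OF that(1)] bounded_clinearD(3)[OF com_bounded[OF X]] by simp
  qed
  then show "X x \<in> vac_space (J <+> J)" by (simp add: vac_space_def)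
qed

lemma vac_proj_mode_algebra: "J \<subseteq> I \<Longrightarrow> vac_proj J \<in> commutant (com J)"
proof (rule commutantI[OF bounded_vac_proj])
  fix X assume J: "J \<subseteq> I" and X: "X \<in> com J"
  have "X \<circ> vac_proj J = vac_proj J \<circ> X"
    unfolding vac_proj_def
    by (rule proj_commute[OF vac_space_closed com_bounded[OF X]])
      (auto intro: com_vac_space[OF J] X com_adj[OF J])
  then show "vac_proj J \<circ> X = X \<circ> vac_proj J" by simp
qed

text \<open>Irreducibility of the Fock representation in the form needed for totality: an operator
  commuting with all modes is determined by its value at the vacuum.\<close>

lemma com_all_vanish:
  assumes E: "E \<in> com I" "E \<Omega> = 0"
  shows "E x = 0"
proof -
  have "E x = 0" if "x \<in> D" for x
    using that
  proof (induction rule: D_induct)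
    case (create m x)
    show ?case
    proof (rule dense_cinner_eq[OF D_dense])
      fix y assume "y \<in> D"
      then show "cinner y (E (cr m x)) = cinner y 0"
        using weakly_intertwinesD(2)[OF com_weakly[OF order.refl E(1)], of m x y] create by simp
    qed
  qed (simp_all add: E bounded_clinearD[OF com_bounded[OF E(1)]])
  then have "E = (\<lambda>x. 0)"
    by (intro dense_bounded_clinear_eq[OF D_dense]) (auto intro: com_bounded E)
  then show ?thesis by simp
qed

end

text \<open>Carries a vanishing derivative from the orbit of one vector to matrix elements at
  another, when only a comparison of norms is available.\<close>

lemma zero_derivative_of_bound:
  fixes g :: "real \<Rightarrow> 'a::real_normed_vector" and h :: "real \<Rightarrow> 'b::real_normed_vector"
  assumes g: "(g has_vector_derivative 0) (at 0)"
    and le: "\<And>t. norm (h t - h 0) \<le> C * norm (g t - g 0)"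
  shows "(h has_vector_derivative 0) (at 0)"
proof -
  have "((\<lambda>t. norm (g t - g 0) / norm t) \<longlongrightarrow> 0) (at 0)"
    using g by (simp add: has_vector_derivative_def has_derivative_iff_norm)
  then have "((\<lambda>t. C * (norm (g t - g 0) / norm t)) \<longlongrightarrow> C * 0) (at 0)"
    by (rule tendsto_mult_left)
  then have "((\<lambda>t. C * (norm (g t - g 0) / norm t)) \<longlongrightarrow> 0) (at 0)" by simp
  then have "((\<lambda>t. norm (h t - h 0) / norm t) \<longlongrightarrow> 0) (at 0)"
  proof (rule Lim_null_comparison[rotated])
    show "\<forall>\<^sub>F t in at 0. norm (norm (h t - h 0) / norm t) \<le> C * (norm (g t - g 0) / norm t)"
      using le by (intro always_eventually allI) (simp add: divide_right_mono)
  qed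
  then show ?thesis by (simp add: has_vector_derivative_def has_derivative_iff_norm)
qed

section \<open>Twisted duality and automorphisms of a region algebra\<close>

context fock_modes
begin

context
  fixes J :: "'i set" and \<kappa> :: "'h \<Rightarrow> 'h"
  assumes J: "J \<subseteq> I" and \<kappa>: "klein_operator J \<kappa>"
begin

text \<open>The Klein operator turns the fermions outside \<open>J\<close>, which anticommute with those in \<open>J\<close>,
  into operators commuting with them.\<close>

definition twisted_com :: "('h \<Rightarrow> 'h) set" where
  "twisted_com = {X. bounded_clinear X \<and> (\<forall>j\<in>I - J.
     X \<circ> (f j \<circ> \<kappa>) = (f j \<circ> \<kappa>) \<circ> X \<and> X \<circ> (adj (f j) \<circ> \<kappa>) = (adj (f j) \<circ> \<kappa>) \<circ> X \<and>
     weakly_intertwines X (Inr j) (Inr j))}"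

lemma klein:
  shows bounded_klein: "bounded_clinear \<kappa>" and klein_klein: "\<kappa> (\<kappa> x) = x"
    and adj_klein: "adj \<kappa> = \<kappa>"
    and klein_outer: "j \<in> I - J \<Longrightarrow> \<kappa> (f j x) = f j (\<kappa> x)" "j \<in> I - J \<Longrightarrow> \<kappa> (adj (f j) x) = adj (f j) (\<kappa> x)"
    and klein_inner: "j \<in> J \<Longrightarrow> \<kappa> (f j x) = - f j (\<kappa> x)" "j \<in> J \<Longrightarrow> \<kappa> (adj (f j) x) = - adj (f j) (\<kappa> x)"
proof -
  show "bounded_clinear \<kappa>" "adj \<kappa> = \<kappa>" using \<kappa> second_quantD(1) by (auto simp: klein_operator_def)
  show "\<kappa> (\<kappa> x) = x" using klein_operator_involution[OF \<kappa>] by (metis comp_apply id_apply)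
  note kf = klein_operator_fermion[OF \<kappa>]
  show "j \<in> I - J \<Longrightarrow> \<kappa> (f j x) = f j (\<kappa> x)" "j \<in> I - J \<Longrightarrow> \<kappa> (adj (f j) x) = adj (f j) (\<kappa> x)"
    using kf[of j x] by (auto simp: klein_sign_def)
  show "j \<in> J \<Longrightarrow> \<kappa> (f j x) = - f j (\<kappa> x)" "j \<in> J \<Longrightarrow> \<kappa> (adj (f j) x) = - adj (f j) (\<kappa> x)"
    using kf[of j x] J by (auto simp: klein_sign_def subset_iff)
qed

lemma klein_mem: "\<kappa> \<in> commutant (com J)"
  using \<kappa> by (auto simp: commutant_def klein_operator_def com_def bounded_klein)

text \<open>An outer fermion and the Klein operator each anticommute with an inner fermion; the two
  signs cancel.\<close>

lemma twisted_fermion_com: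
  assumes j: "j \<in> I - J"
  shows "f j \<circ> \<kappa> \<in> com J" "adj (f j) \<circ> \<kappa> \<in> com J"
proof -
  have jI: "j \<in> I" using j by simp
  note b = bounded_fermion[OF jI] bounded_fermion_adj[OF jI] bounded_klein
  note bs = bounded_clinearD[OF b(1)] bounded_clinearD[OF b(2)]
  have 1: "commutes_fermion (f j \<circ> \<kappa>) i \<and> commutes_fermion (adj (f j) \<circ> \<kappa>) i" if i: "i \<in> J" for i
  proof -
    have iI: "i \<in> I" and ne: "i \<noteq> j" "j \<noteq> i" using i j J by auto
    have "f j (f i x) = - f i (f j x)" "f j (adj (f i) x) = - adj (f i) (f j x)"
      "adj (f j) (f i x) = - f i (adj (f j) x)" "adj (f j) (adj (f i) x) = - adj (f i) (adj (f j) x)" for x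
      using CAR_D(2,3,4)[OF fermion_CAR jI iI, of x] CAR_D(3)[OF fermion_CAR iI jI, of x] ne by simp_all
    then show ?thesis
      unfolding commutes_fermion_def by (auto simp: fun_eq_iff klein_inner[OF i] bs)
  qed
  have 2: "weakly_intertwines (f j \<circ> \<kappa>) (Inr i) (Inr i) \<and> weakly_intertwines (adj (f j) \<circ> \<kappa>) (Inr i) (Inr i)"
    if i: "i \<in> I" for i
  proof -
    have "\<kappa> \<circ> weyl (q i) z = weyl (q i) z \<circ> \<kappa>" "f j \<circ> weyl (q i) z = weyl (q i) z \<circ> f j"
      "adj (f j) \<circ> weyl (q i) z = weyl (q i) z \<circ> adj (f j)" for z
      using klein_operator_boson[OF \<kappa> i] fermion_weakly_boson[OF jI i] b i
      by (simp_all add: weakly_intertwines_iff_weyl)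
    then show ?thesis
      using b i by (auto simp: weakly_intertwines_iff_weyl bounded_clinear_comp fun_eq_iff)
  qed
  show "f j \<circ> \<kappa> \<in> com J" "adj (f j) \<circ> \<kappa> \<in> com J"
    using 1 2 J b by (auto simp: com_def bounded_clinear_comp subset_iff)
qed

lemma weyl_com:
  assumes j: "j \<in> I - J"
  shows "weyl (q j) z \<in> com J"
proof -
  have jI: "j \<in> I" using j by simp
  have b: "bounded_clinear (weyl (q j) z)" by (rule unitaryD(1)[OF unitary_weyl[OF jI]])
  have "commutes_fermion (weyl (q j) z) i" if "i \<in> J" for i
  proof -
    have i: "i \<in> I" using that J by auto
    have "f i \<circ> weyl (q j) z = weyl (q j) z \<circ> f i" "adj (f i) \<circ> weyl (q j) z = weyl (q j) z \<circ> adj (f i)"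
      using fermion_weakly_boson[OF i jI] i jI
      by (simp_all add: weakly_intertwines_iff_weyl bounded_fermion bounded_fermion_adj)
    then show ?thesis by (simp add: commutes_fermion_def)
  qed
  moreover have "weakly_intertwines (weyl (q j) z) (Inr i) (Inr i)" if "i \<in> J" for i
  proof -
    have i: "i \<in> I" "i \<noteq> j" using that J j by auto
    let ?i = "Inr i :: 'i + 'i" and ?j = "Inr j :: 'i + 'i"
    have m: "?i \<in> modes" "?j \<in> modes" "?i \<noteq> ?j" using i jI by auto
    have "weyl (q i) w \<circ> weyl (q j) z = weyl (q j) z \<circ> weyl (q i) w" for w
    \<comment> \<open>Commutation of two fields on \<open>D\<close> does not by itself pass to their
      exponentials, so one is exponentiated at a time: the entire series handles mode
      \<open>i\<close>, then the intertwining lemma handles mode \<open>j\<close>.\<close>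
    proof (rule weakly_intertwines_weyl[OF unitaryD(1)[OF unitary_weyl[OF i(1)]] jI jI])
      interpret E: entire_symmetric D "field i w" by (rule field_entire[OF i(1)])
      have fw: "field i w x \<in> D" if "x \<in> D" for x by (rule E.T_mem[OF that])
      have fa: "field i w (an ?j x) = an ?j (field i w x)" "field i w (cr ?j x) = cr ?j (field i w x)"
        if "x \<in> D" for x
        using that m an_an[OF m(1,2) that] an_cr[OF m(1,2) that] an_cr[OF m(2,1) that]
          cr_cr[OF m(1,2) that]
        by (simp_all add: field_def an_linear cr_linear an_simps cr_simps an_mem cr_mem D_simps)
      show "weakly_intertwines (weyl (q i) w) ?j ?j"
        unfolding weakly_intertwines_def weyl_field[OF i(1)]
      proof (intro ballI conjI)
        fix x y assume "x \<in> D" "y \<in> D"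
        then show "cinner y (E.V 1 (an ?j x)) = cinner (cr ?j y) (E.V 1 x)"
          "cinner y (E.V 1 (cr ?j x)) = cinner (an ?j y) (E.V 1 x)"
          using m by (intro E.V_weakly_commutes; simp add: an_mem cr_mem fa cinner_cr cinner_an)+
      qed
    qed
    then show ?thesis using b i by (simp add: weakly_intertwines_iff_weyl)
  qed
  ultimately show ?thesis using b by (simp add: com_def)
qed

lemma twisted_com_bounded: "X \<in> twisted_com \<Longrightarrow> bounded_clinear X"
  by (simp add: twisted_com_def)

lemma twisted_com_adj:
  assumes X: "X \<in> twisted_com"
  shows "adj X \<in> twisted_com"
proof -
  have b: "bounded_clinear X" using X by (rule twisted_com_bounded)
  have "adj X \<circ> (f j \<circ> \<kappa>) = (f j \<circ> \<kappa>) \<circ> adj X \<and> adj X \<circ> (adj (f j) \<circ> \<kappa>) = (adj (f j) \<circ> \<kappa>) \<circ> adj X \<and>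
     weakly_intertwines (adj X) (Inr j) (Inr j)" if j: "j \<in> I - J" for j
  proof -
    have jI: "j \<in> I" using j by simp
    note bf = bounded_fermion[OF jI] bounded_fermion_adj[OF jI] bounded_klein
    have "adj (f j \<circ> \<kappa>) = adj (f j) \<circ> \<kappa>" "adj (adj (f j) \<circ> \<kappa>) = f j \<circ> \<kappa>"
      using bf klein_outer[OF j] by (auto simp: adj_comp adj_klein)
    moreover have "X \<circ> (f j \<circ> \<kappa>) = (f j \<circ> \<kappa>) \<circ> X" "X \<circ> (adj (f j) \<circ> \<kappa>) = (adj (f j) \<circ> \<kappa>) \<circ> X"
      and w: "weakly_intertwines X (Inr j) (Inr j)"
      using X j by (auto simp: twisted_com_def)
    moreover have "adj X \<circ> weyl (q j) z = weyl (q j) z \<circ> adj X" for z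
    proof -
      have "X \<circ> adj (weyl (q j) z) = adj (weyl (q j) z) \<circ> X"
        unfolding adj_weyl[OF jI] by (rule weakly_intertwines_weyl[OF b jI jI w])
      from commute_adj[OF b _ this] show ?thesis
        using unitaryD(1)[OF unitary_weyl[OF jI]] by (simp add: bounded_clinear_adj)
    qed
    ultimately show ?thesis
      using commute_adj[OF b, of "f j \<circ> \<kappa>"] commute_adj[OF b, of "adj (f j) \<circ> \<kappa>"] bf jI
      by (simp add: bounded_clinear_comp weakly_intertwines_iff_weyl bounded_clinear_adj b)
  qed
  then show ?thesis using b by (simp add: twisted_com_def bounded_clinear_adj)
qed

text \<open>The easy half of twisted duality. It already makes \<open>M\<close> and \<open>N\<close>
  below commute, which the converse half relies on.\<close>

lemma mode_algebra_twisted_com: "commutant (com J) \<subseteq> twisted_com"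
proof
  fix X assume X: "X \<in> commutant (com J)"
  have "X \<circ> weyl (q j) z = weyl (q j) z \<circ> X" if "j \<in> I - J" for j z
    by (rule commutantD(2)[OF X weyl_com[OF that]])
  then show "X \<in> twisted_com"
    using commutantD(1)[OF X] commutantD(2)[OF X] twisted_fermion_com
    by (auto simp: twisted_com_def weakly_intertwines_iff_weyl)
qed

lemma twisted_com_vac_space:
  assumes X: "X \<in> twisted_com" and u: "u \<in> vac_space ((I - J) <+> (I - J))"
  shows "X u \<in> vac_space ((I - J) <+> (I - J))"
proof (rule vac_space_invariant[OF _ twisted_com_bounded[OF X] _ u])
  show "(I - J) <+> (I - J) \<subseteq> modes" by auto
  note bX = twisted_com_bounded[OF X]
  fix x assume x: "x \<in> D" "\<And>m. m \<in> (I - J) <+> (I - J) \<Longrightarrow> an m x = 0"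
  have "cinner (cr m y) (X x) = 0" if m: "m \<in> (I - J) <+> (I - J)" and y: "y \<in> D" for m y
  proof (cases m)
    case (Inl j)
    then have j: "j \<in> I - J" using m by auto
    then have jI: "j \<in> I" by simp
    have "X \<circ> (f j \<circ> \<kappa>) = (f j \<circ> \<kappa>) \<circ> X" using X j by (auto simp: twisted_com_def)
    then have "\<kappa> (f j (X x)) = X (\<kappa> (f j x))"
      by (simp add: fun_eq_iff klein_outer[OF j])
    also have "f j x = 0" using x(2)[OF m] Inl jI by (simp add: an_fermion)
    finally have "\<kappa> (\<kappa> (f j (X x))) = 0"
      by (simp add: bounded_clinearD[OF bounded_klein] bounded_clinearD[OF bX])
    then have "f j (X x) = 0" by (simp add: klein_klein)
    then show ?thesis using Inl jI by (simp add: cr_fermion cinner_adj_left bounded_fermion)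
  next
    case (Inr j)
    then have j: "j \<in> I - J" using m by auto
    then have "weakly_intertwines X m m" using X Inr by (simp add: twisted_com_def)
    from weakly_intertwinesD(1)[OF this x(1) y] show ?thesis
      using x(2)[OF m] by (simp add: bounded_clinearD[OF bX])
  qed
  then show "X x \<in> vac_space ((I - J) <+> (I - J))" by (simp add: vac_space_def)
qed

text \<open>\<open>M\<close> is the algebra of \<open>J\<close>, and \<open>N\<close> is the
  bicommutant of the outer bosons and the twisted outer fermions. Each contains the projection onto
  its own vacuum space.\<close>

private abbreviation "P \<equiv> vac_proj J"
private abbreviation "P' \<equiv> vac_proj (I - J)"
private abbreviation "M \<equiv> commutant (com J)"
private abbreviation "N \<equiv> commutant twisted_com"

lemma outer_vac_proj_mem: "P' \<in> N"
proof (rule commutantI[OF bounded_vac_proj])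
  fix X assume X: "X \<in> twisted_com"
  have "X \<circ> P' = P' \<circ> X"
    unfolding vac_proj_def
    by (rule proj_commute[OF vac_space_closed twisted_com_bounded[OF X]])
      (auto intro: twisted_com_vac_space X twisted_com_adj)
  then show "P' \<circ> X = X \<circ> P'" by simp
qed

lemma inner_vac_proj_mem: "P \<in> M"
  by (rule vac_proj_mode_algebra[OF J])

lemma M_N_commute: "X \<in> M \<Longrightarrow> Y \<in> N \<Longrightarrow> X (Y x) = Y (X x)"
  using mode_algebra_twisted_com commutantD(3)[of Y twisted_com X x] by auto

lemma M_adj: "X \<in> M \<Longrightarrow> adj X \<in> M"
  by (rule commutant_adj) (auto intro: com_bounded com_adj[OF J])

lemma N_adj: "X \<in> N \<Longrightarrow> adj X \<in> N"
  by (rule commutant_adj) (auto intro: twisted_com_bounded twisted_com_adj)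

text \<open>The projections commute, so the product lands in both vacuum spaces, whose intersection
  is the line of the vacuum.\<close>

lemma vac_projs: "P (P' v) = cinner \<Omega> v *\<^sub>C \<Omega>"
proof -
  let ?w = "P (P' v)"
  have "?w \<in> vac_space (J <+> J)" by (rule vac_proj_mem)
  moreover have "?w \<in> vac_space ((I - J) <+> (I - J))"
    unfolding M_N_commute[OF inner_vac_proj_mem outer_vac_proj_mem] by (rule vac_proj_mem)
  ultimately have "?w \<in> vac_space modes"
    unfolding vac_space_def using J by blast
  then have "?w = cinner \<Omega> ?w *\<^sub>C \<Omega>" by (rule vac_space_all)
  also have "cinner \<Omega> ?w = cinner (P' (P \<Omega>)) v"
    using cinner_adj_left[OF bounded_vac_proj, of J \<Omega>] cinner_adj_left[OF bounded_vac_proj, of "I - J" "P \<Omega>"]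
    by (simp add: adj_vac_proj)
  also have "P' (P \<Omega>) = \<Omega>" using vac_proj_vacuum J by simp
  finally show ?thesis .
qed

text \<open>The orthogonal complement of the vectors \<open>G (F \<Omega>)\<close> is invariant
  under \<open>M\<close> and \<open>N\<close>, so its projection commutes with all modes. It kills
  the vacuum and therefore vanishes.\<close>

lemma total:
  assumes v: "\<And>G F. G \<in> M \<Longrightarrow> F \<in> N \<Longrightarrow> cinner (G (F \<Omega>)) v = 0"
  shows "v = 0"
proof -
  define K where "K = {v. \<forall>G\<in>M. \<forall>F\<in>N. cinner (G (F \<Omega>)) v = 0}"
  have K: "csubspace K" "closed K"
  proof -
    show "csubspace K" by (auto simp: csubspace_def K_def cinner_simps)
    have "K = (\<Inter>G\<in>M. \<Inter>F\<in>N. {v. cinner (G (F \<Omega>)) v = 0})" by (auto simp: K_def)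
    moreover have "closed {v. cinner u v = 0}" for u :: 'h
      by (intro closed_Collect_eq continuous_on_cinner continuous_intros)
    ultimately show "closed K" by (simp add: closed_INT)
  qed
  have invM: "A v \<in> K" if A: "A \<in> M" and v: "v \<in> K" for A v
  proof -
    have "cinner (G (F \<Omega>)) (A v) = 0" if "G \<in> M" "F \<in> N" for G F
    proof -
      have "adj A \<circ> G \<in> M" using A that by (intro commutant_comp M_adj)
      then have "cinner ((adj A \<circ> G) (F \<Omega>)) v = 0" using v that by (auto simp: K_def)
      then show ?thesis by (simp add: cinner_adj_left[OF commutantD(1)[OF A]])
    qed
    then show ?thesis by (simp add: K_def)
  qed
  have invN: "A v \<in> K" if A: "A \<in> N" and v: "v \<in> K" for A v
  proof -
    have "cinner (G (F \<Omega>)) (A v) = 0" if GF: "G \<in> M" "F \<in> N" for G F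
    proof -
      have "adj A \<circ> F \<in> N" using A GF by (intro commutant_comp N_adj)
      then have "cinner (G ((adj A \<circ> F) \<Omega>)) v = 0" using v GF unfolding K_def by blast
      then have "cinner (adj A (G (F \<Omega>))) v = 0"
        by (simp add: M_N_commute[OF GF(1) N_adj[OF A]])
      then show ?thesis by (simp add: cinner_adj_left[OF commutantD(1)[OF A]])
    qed
    then show ?thesis by (simp add: K_def)
  qed
  let ?E = "proj K"
  have bE: "bounded_clinear ?E" by (rule bounded_clinear_proj[OF K])
  have EM: "?E \<circ> A = A \<circ> ?E" if "A \<in> M \<or> A \<in> N" for A
    using proj_commute[OF K, of A] that invM invN M_adj N_adj commutantD(1) by metis
  have "?E \<in> com I"
    unfolding com_def
  proof (intro CollectI conjI ballI bE)
    fix i assume i: "i \<in> I"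
    show "commutes_fermion ?E i"
    proof (cases "i \<in> J")
      case True
      have "f i \<in> M" "adj (f i) \<in> M"
        using True i by (auto simp: commutant_def com_def commutes_fermion_def bounded_fermion
            bounded_fermion_adj)
      then show ?thesis using EM by (simp add: commutes_fermion_def)
    next
      case False
      have "f i \<circ> \<kappa> \<in> N" "adj (f i) \<circ> \<kappa> \<in> N"
        using False i by (auto simp: commutant_def twisted_com_def intro!: bounded_clinear_comp
            bounded_fermion bounded_fermion_adj bounded_klein)
      then have "?E \<circ> (f i \<circ> \<kappa>) = (f i \<circ> \<kappa>) \<circ> ?E" "?E \<circ> (adj (f i) \<circ> \<kappa>) = (adj (f i) \<circ> \<kappa>) \<circ> ?E"
        using EM by blast+
      then have 1: "?E (f i (\<kappa> x)) = f i (\<kappa> (?E x))" "?E (adj (f i) (\<kappa> x)) = adj (f i) (\<kappa> (?E x))" for x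
        by (metis comp_apply)+
      \<comment> \<open>\<open>\<kappa>\<close> lies in \<open>M\<close>, so commuting with the
        twisted fermion and with \<open>\<kappa>\<close> gives commuting with the fermion
        itself.\<close>
      have 2: "?E (\<kappa> x) = \<kappa> (?E x)" for x using EM klein_mem by (metis comp_apply)
      have "?E (f i x) = f i (?E x)" "?E (adj (f i) x) = adj (f i) (?E x)" for x
        using 1[of "\<kappa> x"] 2[of x] by (simp_all add: klein_klein)
      then show ?thesis by (auto simp: commutes_fermion_def)
    qed
    have "?E \<circ> weyl (q i) z = weyl (q i) z \<circ> ?E" for z
    proof (rule EM, cases "i \<in> J")
      note b = unitaryD(1)[OF unitary_weyl[OF i]]
      case True
      then show "weyl (q i) z \<in> M \<or> weyl (q i) z \<in> N"
        using b i by (auto simp: commutant_def com_def weakly_intertwines_iff_weyl)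
    next
      note b = unitaryD(1)[OF unitary_weyl[OF i]]
      case False
      then show "weyl (q i) z \<in> M \<or> weyl (q i) z \<in> N"
        using b i by (auto simp: commutant_def twisted_com_def weakly_intertwines_iff_weyl)
    qed
    then show "weakly_intertwines ?E (Inr i) (Inr i)" using bE i by (simp add: weakly_intertwines_iff_weyl)
  qed
  moreover have "?E \<Omega> = 0"
  proof (rule proj_orth[OF K])
    fix y assume "y \<in> K"
    then have "cinner (id (id \<Omega>)) y = 0" unfolding K_def using commutant_id by blast
    then show "cinner y \<Omega> = 0" using cinner_commute[of y \<Omega>] by simp
  qed
  ultimately have "?E v = 0" by (rule com_all_vanish)
  moreover have "v \<in> K" using v by (simp add: K_def)
  ultimately show ?thesis using proj_mem[OF K] by simp
qed

lemma total_eq: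
  assumes X: "bounded_clinear X" and Y: "bounded_clinear Y"
    and eq: "\<And>G F. G \<in> M \<Longrightarrow> F \<in> N \<Longrightarrow> X (G (F \<Omega>)) = Y (G (F \<Omega>))"
  shows "X = Y"
proof
  fix x
  let ?Z = "\<lambda>x. X x - Y x"
  have bZ: "bounded_clinear ?Z" using X Y by (rule bounded_clinear_diff)
  have "adj ?Z y = 0" for y
  proof (rule total)
    fix G F assume "G \<in> M" "F \<in> N"
    then show "cinner (G (F \<Omega>)) (adj ?Z y) = 0"
      unfolding cinner_adj_right[OF bZ] by (simp add: eq)
  qed
  then have "cinner y (?Z x) = cinner y 0" for y
    using cinner_adj_left[OF bZ, of y x] by simp
  then have "?Z x = 0" by (rule cinner_ext)
  then show "X x = Y x" by simp
qed

text \<open>Twisted Haag duality. With \<open>\<zeta> = Y F \<Omega>\<close> and \<open>\<eta> = X G \<Omega>\<close>, both orders of the product have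
  the matrix elements \<open>\<langle>F'\<Omega>, \<zeta>\<rangle> \<langle>G'\<Omega>, \<eta>\<rangle>\<close>, because \<open>P P'\<close> is the projection onto \<open>\<Omega>\<close>.\<close>

lemma twisted_duality:
  assumes X: "X \<in> twisted_com" and Y: "Y \<in> com J"
  shows "X \<circ> Y = Y \<circ> X"
proof (rule total_eq)
  note bX = twisted_com_bounded[OF X] and bY = com_bounded[OF Y]
  show "bounded_clinear (X \<circ> Y)" "bounded_clinear (Y \<circ> X)" using bX bY by (auto intro: bounded_clinear_comp)
  have XN: "X (F v) = F (X v)" if "F \<in> N" for F v using commutantD(3)[OF that X, of v] by simp
  have YM: "Y (G v) = G (Y v)" if "G \<in> M" for G v using commutantD(3)[OF that Y, of v] by simp
  have P'_vac: "P' \<Omega> = \<Omega>" and P_vac: "P \<Omega> = \<Omega>" using J by (auto intro: vac_proj_vacuum)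
  have PP': "P' (P v) = cinner \<Omega> v *\<^sub>C \<Omega>" for v
    using vac_projs M_N_commute[OF inner_vac_proj_mem outer_vac_proj_mem] by simp
  have P'G: "P' (G v) = G (P' v)" if "G \<in> M" for G v
    using M_N_commute[OF that outer_vac_proj_mem] by simp
  have PF: "P (F v) = F (P v)" if "F \<in> N" for F v
    using M_N_commute[OF inner_vac_proj_mem that] by simp
  have P'_ad: "cinner (P' u) v = cinner u (P' v)" and P_ad: "cinner (P u) v = cinner u (P v)" for u v
    using cinner_adj_left[OF bounded_vac_proj] by (simp_all add: adj_vac_proj)
  fix G F assume G: "G \<in> M" and F: "F \<in> N"
  have "X (Y (G (F \<Omega>))) - Y (X (G (F \<Omega>))) = 0"
  proof (rule total)
    fix G' F' assume G': "G' \<in> M" and F': "F' \<in> N"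
    note bG' = commutantD(1)[OF G'] and bF' = commutantD(1)[OF F'] and bG = commutantD(1)[OF G]
      and bF = commutantD(1)[OF F]
    let ?\<zeta> = "Y (F \<Omega>)" and ?\<eta> = "X (G \<Omega>)"
    \<comment> \<open>\<open>Y\<close> and \<open>F\<close> both commute with \<open>P\<close>,
      which fixes the vacuum.\<close>
    have "?\<zeta> = P ?\<zeta>" using YM[OF inner_vac_proj_mem] PF[OF F] P_vac by metis
    then have 1: "P' (adj F' ?\<zeta>) = cinner (F' \<Omega>) ?\<zeta> *\<^sub>C \<Omega>"
      using PP' PF[OF N_adj[OF F']] cinner_adj_right[OF bF'] by metis
    have "cinner (G' (F' \<Omega>)) (X (Y (G (F \<Omega>)))) = cinner (F' (G' \<Omega>)) (X (G ?\<zeta>))"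
      using M_N_commute[OF G' F'] YM[OF G] by simp
    also have "\<dots> = cinner (G' \<Omega>) (X (G (adj F' ?\<zeta>)))"
      using XN[OF N_adj[OF F']] M_N_commute[OF G N_adj[OF F']] cinner_adj_right[OF bF'] by metis
    \<comment> \<open>\<open>P'\<close> fixes the vacuum on the left and commutes with
      \<open>G'\<close>, \<open>X\<close> and \<open>G\<close>, so it can be inserted to the right
      of them.\<close>
    also have "\<dots> = cinner (G' \<Omega>) (X (G (P' (adj F' ?\<zeta>))))"
      using P'_vac P'G[OF G'] P'_ad XN[OF outer_vac_proj_mem] P'G[OF G] by metis
    also have "\<dots> = cinner (F' \<Omega>) ?\<zeta> * cinner (G' \<Omega>) ?\<eta>"
      unfolding 1 by (simp add: bounded_clinearD[OF bG] bounded_clinearD[OF bX] cinner_simps)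
    finally have XY: "cinner (G' (F' \<Omega>)) (X (Y (G (F \<Omega>)))) = cinner (F' \<Omega>) ?\<zeta> * cinner (G' \<Omega>) ?\<eta>" .
    have "?\<eta> = P' ?\<eta>" using XN[OF outer_vac_proj_mem] P'G[OF G] P'_vac by metis
    then have 2: "P (adj G' ?\<eta>) = cinner (G' \<Omega>) ?\<eta> *\<^sub>C \<Omega>"
      using vac_projs P'G[OF M_adj[OF G']] cinner_adj_right[OF bG'] by metis
    have "cinner (G' (F' \<Omega>)) (Y (X (G (F \<Omega>)))) = cinner (G' (F' \<Omega>)) (Y (F ?\<eta>))"
      using M_N_commute[OF G F] XN[OF F] by simp
    also have "\<dots> = cinner (F' \<Omega>) (Y (F (adj G' ?\<eta>)))"
      using YM[OF M_adj[OF G']] M_N_commute[OF M_adj[OF G'] F] cinner_adj_right[OF bG'] by metis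
    also have "\<dots> = cinner (F' \<Omega>) (Y (F (P (adj G' ?\<eta>))))"
      using P_vac PF[OF F'] P_ad YM[OF inner_vac_proj_mem] PF[OF F] by metis
    also have "\<dots> = cinner (F' \<Omega>) ?\<zeta> * cinner (G' \<Omega>) ?\<eta>"
      unfolding 2 by (simp add: bounded_clinearD[OF bF] bounded_clinearD[OF bY] cinner_simps)
    finally show "cinner (G' (F' \<Omega>)) (X (Y (G (F \<Omega>))) - Y (X (G (F \<Omega>)))) = 0"
      using XY by (simp add: cinner_diff_right)
  qed
  then show "(X \<circ> Y) (G (F \<Omega>)) = (Y \<circ> X) (G (F \<Omega>))" by simp
qed

lemma twisted_com_mode_algebra: "X \<in> twisted_com \<Longrightarrow> X \<in> M"
  by (rule commutantI) (auto intro: twisted_com_bounded twisted_duality)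

text \<open>\<open>F\<close> commutes with \<open>P\<close>, and \<open>G \<Omega>\<close> lies in
  the outer vacuum space, so \<open>P\<close> reduces it to its vacuum component.\<close>

lemma vac_proj_orbit: "G \<in> M \<Longrightarrow> F \<in> N \<Longrightarrow> P (G (F \<Omega>)) = cinner \<Omega> (G \<Omega>) *\<^sub>C F \<Omega>"
proof -
  assume G: "G \<in> M" and F: "F \<in> N"
  have "P (G (F \<Omega>)) = F (P (G \<Omega>))"
    using M_N_commute[OF G F] M_N_commute[OF inner_vac_proj_mem F] by simp
  also have "G \<Omega> = P' (G \<Omega>)"
    using M_N_commute[OF G outer_vac_proj_mem, of \<Omega>] vac_proj_vacuum[OF Diff_subset, of J] by metis
  then have "P (G \<Omega>) = cinner \<Omega> (G \<Omega>) *\<^sub>C \<Omega>" using vac_projs by metis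
  finally show ?thesis by (simp add: bounded_clinearD[OF commutantD(1)[OF F]])
qed

text \<open>Minimality of \<open>P\<close> in \<open>M\<close>, verified on the total vectors
  \<open>G (F \<Omega>)\<close>, where \<open>P\<close> only leaves a vacuum expectation
  value.\<close>

lemma vac_proj_minimal:
  assumes X: "X \<in> M"
  shows "P (X (P v)) = cinner \<Omega> (X \<Omega>) *\<^sub>C P v"
proof -
  have "P \<circ> X \<circ> P = (\<lambda>v. cinner \<Omega> (X \<Omega>) *\<^sub>C P v)"
  proof (rule total_eq)
    fix G F assume G: "G \<in> M" and F: "F \<in> N"
    show "(P \<circ> X \<circ> P) (G (F \<Omega>)) = cinner \<Omega> (X \<Omega>) *\<^sub>C P (G (F \<Omega>))"
      by (simp add: vac_proj_orbit G F X bounded_clinearD[OF commutantD(1)[OF X]]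
          bounded_clinearD[OF bounded_vac_proj] scaleC_scaleC mult.commute)
  qed (intro bounded_clinear_comp bounded_clinear_scaleC bounded_vac_proj commutantD(1)[OF X])+
  then show ?thesis by (simp add: fun_eq_iff)
qed

text \<open>
  An automorphism \<open>\<Psi>\<close> of the type I factor \<open>M\<close> that fixes the generators is trivial. The point is
  that \<open>\<Psi>\<close> fixes the minimal projection \<open>P\<close>: a fixed \<open>B\<close> satisfies \<open>P B\<^sup>\<dagger>B P = \<parallel>B \<Omega>\<parallel>\<^sup>2 P\<close>, hence
  \<open>\<parallel>B \<psi>\<parallel> = \<parallel>B \<Omega>\<parallel> \<parallel>\<psi>\<parallel>\<close> on the range of \<open>\<Psi> P\<close>, and combinations \<open>B\<close> of Weyl operators that
  approximate a multiple of the annihilation operator show that this range consists of vacuum vectors.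
\<close>

lemma automorphism_unique:
  assumes mem: "\<And>X. X \<in> M \<Longrightarrow> \<Psi> X \<in> M"
    and onto: "\<And>Y. Y \<in> M \<Longrightarrow> \<exists>X\<in>M. \<Psi> X = Y"
    and inj: "\<And>X Y. X \<in> M \<Longrightarrow> Y \<in> M \<Longrightarrow> \<Psi> X = \<Psi> Y \<Longrightarrow> X = Y"
    and add: "\<And>X Y. X \<in> M \<Longrightarrow> Y \<in> M \<Longrightarrow> \<Psi> (\<lambda>x. X x + Y x) = (\<lambda>x. \<Psi> X x + \<Psi> Y x)"
    and mult: "\<And>X Y. X \<in> M \<Longrightarrow> Y \<in> M \<Longrightarrow> \<Psi> (X \<circ> Y) = \<Psi> X \<circ> \<Psi> Y"
    and scale: "\<And>X z. X \<in> M \<Longrightarrow> \<Psi> (\<lambda>x. z *\<^sub>C X x) = (\<lambda>x. z *\<^sub>C \<Psi> X x)"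
    and star: "\<And>X. X \<in> M \<Longrightarrow> \<Psi> (adj X) = adj (\<Psi> X)"
    and fixed: "\<And>i. i \<in> J \<Longrightarrow> \<Psi> (f i) = f i" "\<And>i z. i \<in> J \<Longrightarrow> \<Psi> (weyl (q i) z) = weyl (q i) z"
    and X: "X \<in> M"
  shows "\<Psi> X = X"
proof -
  define Fix where "Fix = {X \<in> M. \<Psi> X = X}"
  have FixM: "B \<in> M" and FixE: "\<Psi> B = B" if "B \<in> Fix" for B using that by (auto simp: Fix_def)
  have M_bounded: "bounded_clinear B" if "B \<in> M" for B using that by (rule commutantD(1))
  have M_scale: "(\<lambda>x. z *\<^sub>C B x) \<in> M" if "B \<in> M" for B z
    using that com_bounded by (intro commutant_scaleC)
  have M_add: "(\<lambda>x. A x + B x) \<in> M" if "A \<in> M" "B \<in> M" for A B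
    using that com_bounded by (intro commutant_add)
  \<comment> \<open>A preimage of \<open>id\<close> exists by surjectivity; multiplying it by
    \<open>id\<close> shows what the image of \<open>id\<close> is.\<close>
  have Fix_id: "id \<in> Fix"
  proof -
    obtain Y where Y: "Y \<in> M" "\<Psi> Y = id" using onto commutant_id by blast
    have "\<Psi> Y \<circ> \<Psi> id = \<Psi> (Y \<circ> id)" using mult[OF Y(1) commutant_id] by simp
    then show ?thesis using Y commutant_id by (simp add: Fix_def)
  qed
  have Fix_comp: "A \<circ> B \<in> Fix" if "A \<in> Fix" "B \<in> Fix" for A B
    using that by (auto simp: Fix_def mult commutant_comp)
  have Fix_adj: "adj B \<in> Fix" if "B \<in> Fix" for B
    using that by (auto simp: Fix_def star M_adj)
  have Fix_scale: "(\<lambda>x. z *\<^sub>C B x) \<in> Fix" if "B \<in> Fix" for B z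
    using that by (auto simp: Fix_def scale M_scale)
  have Fix_add: "(\<lambda>x. A x + B x) \<in> Fix" if "A \<in> Fix" "B \<in> Fix" for A B
    using that by (auto simp: Fix_def add M_add)
  have Fix_diff: "(\<lambda>x. A x - B x) \<in> Fix" if "A \<in> Fix" "B \<in> Fix" for A B
    using Fix_add[OF that(1) Fix_scale[OF that(2), of "-1"]] by simp
  have Fix_fermion: "f i \<in> Fix" and Fix_weyl: "weyl (q i) z \<in> Fix" if i: "i \<in> J" for i z
  proof -
    have "i \<in> I" using i J by blast
    then have "bounded_clinear (f i)" "bounded_clinear (weyl (q i) z)"
      by (auto intro: bounded_fermion unitaryD(1)[OF unitary_weyl])
    then show "f i \<in> Fix" "weyl (q i) z \<in> Fix"
      using i \<open>i \<in> I\<close> fixed by (auto simp: Fix_def commutant_def com_def commutes_fermion_def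
          weakly_intertwines_iff_weyl)
  qed
  have zero: "(\<lambda>x. 0) \<in> Fix"
    using Fix_scale[OF Fix_id, of 0] by simp
  note P_mem = inner_vac_proj_mem
  define Q where "Q = \<Psi> P"
  have Q_mem: "Q \<in> M" unfolding Q_def by (rule mem[OF P_mem])
  have bQ: "bounded_clinear Q" using Q_mem by (rule M_bounded)
  have "P \<circ> P = P" by (simp add: fun_eq_iff vac_proj_idem)
  then have "Q \<circ> Q = Q" using mult[OF P_mem P_mem] by (simp only: Q_def)
  then have QQ: "Q (Q v) = Q v" for v by (simp add: fun_eq_iff)
  have Q_adj: "adj Q = Q" using star[OF P_mem] by (simp add: Q_def adj_vac_proj)
  have iso: "norm (B (Q v)) = norm (B \<Omega>) * norm (Q v)" if B: "B \<in> Fix" for B v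
  proof -
    have C: "adj B \<circ> B \<in> Fix" using B by (intro Fix_comp Fix_adj)
    let ?c = "cinner \<Omega> ((adj B \<circ> B) \<Omega>)"
    have "P \<circ> ((adj B \<circ> B) \<circ> P) = (\<lambda>x. ?c *\<^sub>C P x)"
      using vac_proj_minimal[OF FixM[OF C]] by (simp add: fun_eq_iff)
    then have "\<Psi> (P \<circ> ((adj B \<circ> B) \<circ> P)) = \<Psi> (\<lambda>x. ?c *\<^sub>C P x)" by (rule arg_cong)
    then have "Q \<circ> ((adj B \<circ> B) \<circ> Q) = (\<lambda>x. ?c *\<^sub>C Q x)"
      using P_mem FixM[OF C] FixE[OF C] by (simp add: mult scale commutant_comp Q_def)
    then have 1: "Q (adj B (B (Q v))) = ?c *\<^sub>C Q v" by (simp add: fun_eq_iff)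
    have "cinner (B (Q v)) (B (Q v)) = cinner (Q v) (adj B (B (Q v)))"
      by (rule cinner_adj_right[OF M_bounded[OF FixM[OF B]], symmetric])
    also have "\<dots> = cinner (Q v) (Q (adj B (B (Q v))))"
      using cinner_adj_left[OF bQ, of "Q v"] by (simp add: Q_adj QQ)
    also have "\<dots> = ?c * cinner (Q v) (Q v)" unfolding 1 by (simp add: cinner_simps)
    also have "?c = cinner (B \<Omega>) (B \<Omega>)"
      using cinner_adj_right[OF M_bounded[OF FixM[OF B]]] by simp
    finally have "complex_of_real ((norm (B (Q v)))\<^sup>2) = complex_of_real ((norm (B \<Omega>) * norm (Q v))\<^sup>2)"
      unfolding cinner_self power_mult_distrib of_real_mult .
    then have "(norm (B (Q v)))\<^sup>2 = (norm (B \<Omega>) * norm (Q v))\<^sup>2" by (simp only: of_real_eq_iff)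
    then show ?thesis by (simp add: power2_eq_iff_nonneg)
  qed
  have "Q v \<in> vac_space (J <+> J)" for v
    unfolding vac_space_def
  proof (intro CollectI ballI)
    fix m y assume m: "m \<in> J <+> J" and y: "y \<in> D"
    show "cinner (cr m y) (Q v) = 0"
    proof (cases m)
      case (Inl i)
      then have i: "i \<in> J" "i \<in> I" using m J by auto
      have "norm (f i (Q v)) = 0"
        using iso[OF Fix_fermion[OF i(1)]] by (simp add: fermion_vacuum i)
      then show ?thesis using Inl i by (simp add: cr_fermion cinner_adj_left bounded_fermion)
    next
      case (Inr i)
      then have i: "i \<in> J" "i \<in> I" using m J by auto
      let ?b = "Inr i :: 'i + 'i"
      have b: "?b \<in> modes" using i by auto
      \<comment> \<open>The coefficients are chosen so that the derivative at 0 is twice the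
        annihilator: the creator parts of the fields for \<open>1\<close> and \<open>\<i>\<close>
        cancel. It therefore vanishes at the vacuum.\<close>
      define B where "B t x = (- \<i>) *\<^sub>C (weyl (q i) (of_real t * 1) x - x)
        + (weyl (q i) (of_real t * \<i>) x - x)" for t :: real and x
      have BF: "B t \<in> Fix" for t
        unfolding B_def
        using Fix_weyl[OF i(1)] Fix_id
        by (intro Fix_add Fix_scale Fix_diff) (simp_all add: id_def)
      \<comment> \<open>The adjoint of \<open>B t\<close>; its derivative at 0 on \<open>D\<close>
        is twice the creator.\<close>
      define B' where "B' t x = \<i> *\<^sub>C (weyl (q i) (of_real t * (- 1)) x - x)
        + (weyl (q i) (of_real t * (- \<i>)) x - x)" for t :: real and x
      have BB': "cinner x (B t u) = cinner (B' t x) u" for t x u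
      proof -
        have "cinner x (weyl (q i) z u) = cinner (weyl (q i) (- z) x) u" for z
          using cinner_adj_left[OF unitaryD(1)[OF unitary_weyl[OF i(2)]], of z x u]
          by (simp add: adj_weyl[OF i(2)])
        then show ?thesis by (simp add: B_def B'_def cinner_simps)
      qed
      have wd: "((\<lambda>t. weyl (q i) (of_real t * z) x - x) has_vector_derivative \<i> *\<^sub>C field i z x) (at 0)"
        if "x \<in> D" for x z
        using has_vector_derivative_diff[OF weyl_derivative[OF i(2) that] has_vector_derivative_const]
        by simp
      note scd = bounded_linear.has_vector_derivative[OF bounded_linear_scaleC]
      have "((\<lambda>t. B t \<Omega>) has_vector_derivative
          (- \<i>) *\<^sub>C \<i> *\<^sub>C field i 1 \<Omega> + \<i> *\<^sub>C field i \<i> \<Omega>) (at 0)"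
        unfolding B_def
        by (intro has_vector_derivative_add scd wd finite_particle.vacuum)
      also have "(- \<i>) *\<^sub>C \<i> *\<^sub>C field i 1 \<Omega> + \<i> *\<^sub>C field i \<i> \<Omega> = 0"
        using b by (simp add: field_def an_vacuum scaleC_scaleC)
      finally have dB: "((\<lambda>t. B t \<Omega>) has_vector_derivative 0) (at 0)" .
      have B0: "B 0 x = 0" "B' 0 x = 0" for x by (simp_all add: B_def B'_def weyl_zero[OF i(2)])
      \<comment> \<open>\<open>Q v\<close> is not known to lie in \<open>D\<close>, so
        \<open>B t\<close> cannot be differentiated there. The derivative is taken on
        \<open>y\<close> and compared with the bound that \<open>iso\<close> provides for
        \<open>B t (Q v)\<close>.\<close>
      have "((\<lambda>t. cinner (B' t y) (Q v)) has_vector_derivative 0) (at 0)"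
      proof (rule zero_derivative_of_bound[OF dB])
        fix t
        have "norm (cinner y (B t (Q v))) \<le> norm y * norm (B t (Q v))" by (rule cmod_cinner_le)
        then show "norm (cinner (B' t y) (Q v) - cinner (B' 0 y) (Q v))
            \<le> (norm y * norm (Q v)) * norm (B t \<Omega> - B 0 \<Omega>)"
          by (simp add: B0 iso[OF BF] mult_ac flip: BB')
      qed
      moreover have "((\<lambda>t. cinner (B' t y) (Q v)) has_vector_derivative
          cinner (\<i> *\<^sub>C \<i> *\<^sub>C field i (- 1) y + \<i> *\<^sub>C field i (- \<i>) y) (Q v)) (at 0)"
        unfolding B'_def
        by (intro bounded_linear.has_vector_derivative[OF
              bounded_bilinear.bounded_linear_left[OF bounded_bilinear_cinner]]
            has_vector_derivative_add scd wd y)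
      ultimately have "cinner (\<i> *\<^sub>C \<i> *\<^sub>C field i (- 1) y + \<i> *\<^sub>C field i (- \<i>) y) (Q v) = 0"
        using vector_derivative_unique_at by blast
      also have "\<i> *\<^sub>C \<i> *\<^sub>C field i (- 1) y + \<i> *\<^sub>C field i (- \<i>) y = 2 *\<^sub>C cr ?b y"
        using scaleC_add_left[of 1 1 "cr ?b y"]
        by (simp add: field_def scaleC_scaleC scaleC_add_right scaleC_diff_right algebra_simps)
      finally show ?thesis using Inr by (simp add: cinner_simps)
    qed
  qed
  then have PQ: "P (Q v) = Q v" for v by (rule vac_proj_fix)
  have QP: "Q (P v) = Q v" for v
  proof (rule cinner_ext)
    fix y
    show "cinner y (Q (P v)) = cinner y (Q v)"
      using cinner_adj_left[OF bQ, of y] cinner_adj_left[OF bounded_vac_proj, of J "Q y"]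
      by (simp add: Q_adj adj_vac_proj PQ)
  qed
  \<comment> \<open>\<open>Q = P Q P\<close> is a multiple of \<open>P\<close> by minimality. A
    projection leaves the factors 0 and 1, and injectivity excludes 0.\<close>
  have Qc: "Q v = cinner \<Omega> (Q \<Omega>) *\<^sub>C P v" for v
    using vac_proj_minimal[OF Q_mem, of v] by (simp add: PQ QP)
  have P_vac: "P \<Omega> = \<Omega>" by (rule vac_proj_vacuum[OF J])
  have QP_eq: "Q = P"
  proof -
    let ?c = "cinner \<Omega> (Q \<Omega>)"
    have Q1: "Q \<Omega> = ?c *\<^sub>C \<Omega>" using Qc[of \<Omega>] P_vac by simp
    have "?c *\<^sub>C \<Omega> = ?c *\<^sub>C ?c *\<^sub>C \<Omega>" using QQ[of \<Omega>] Q1 bounded_clinearD(2)[OF bQ] by metis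
    then have "(?c - ?c * ?c) *\<^sub>C \<Omega> = 0" by (simp add: scaleC_diff_left scaleC_scaleC)
    then have "norm ((?c - ?c * ?c) *\<^sub>C \<Omega>) = 0" by simp
    then have "?c = ?c * ?c" using norm_vacuum(1) by (simp del: norm_eq_zero add: vacuum_norm) simp
    then consider "?c = 0" | "?c = 1" by auto
    then show ?thesis
    proof cases
      case 1
      have "Q x = 0" for x unfolding Qc[of x] 1 by simp
      then have "Q = (\<lambda>x. 0)" by (rule ext)
      then have "\<Psi> P = \<Psi> (\<lambda>x. 0)" using FixE[OF zero] by (simp add: Q_def)
      then have "P = (\<lambda>x. 0)" using inj[OF P_mem FixM[OF zero]] by blast
      then have "P \<Omega> = 0" by (rule fun_cong)
      then show ?thesis using P_vac by simp
    next
      case 2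
      have "Q x = P x" for x unfolding Qc[of x] 2 by simp
      then show ?thesis by (rule ext)
    qed
  qed
  define \<Delta> where "\<Delta> x = \<Psi> X x - X x" for x
  have \<Delta>_bounded: "bounded_clinear \<Delta>"
    unfolding \<Delta>_def using X mem by (intro bounded_clinear_diff M_bounded)
  \<comment> \<open>Minimality makes \<open>P g X g' P\<close> a multiple of \<open>P\<close>. Since
    \<open>\<Psi>\<close> fixes \<open>P\<close>, \<open>g\<close> and \<open>g'\<close>, replacing
    \<open>X\<close> by its image leaves the multiple unchanged.\<close>
  have sandwich: "P (g (\<Delta> (g' (P v)))) = 0" if g: "g \<in> Fix" and g': "g' \<in> Fix" for g g' v
  proof -
    have gm: "g \<in> M" "g' \<in> M" using g g' by (auto intro: FixM)
    have W: "g \<circ> (X \<circ> g') \<in> M" using gm X by (intro commutant_comp)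
    let ?c = "cinner \<Omega> ((g \<circ> (X \<circ> g')) \<Omega>)"
    have eq: "P \<circ> ((g \<circ> (X \<circ> g')) \<circ> P) = (\<lambda>x. ?c *\<^sub>C P x)"
      using vac_proj_minimal[OF W] by (simp add: fun_eq_iff)
    then have "\<Psi> (P \<circ> ((g \<circ> (X \<circ> g')) \<circ> P)) = \<Psi> (\<lambda>x. ?c *\<^sub>C P x)" by (rule arg_cong)
    then have "P \<circ> ((g \<circ> (\<Psi> X \<circ> g')) \<circ> P) = (\<lambda>x. ?c *\<^sub>C P x)"
      using P_mem gm X FixE[OF g] FixE[OF g'] QP_eq W
      by (simp add: mult scale commutant_comp Q_def)
    then have "P (g (\<Psi> X (g' (P v)))) = P (g (X (g' (P v))))" using eq by (simp add: fun_eq_iff)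
    then show ?thesis
      by (simp add: \<Delta>_def bounded_clinearD[OF M_bounded[OF gm(1)]] bounded_clinearD[OF bounded_vac_proj])
  qed
  \<comment> \<open>The projection onto the vectors not separated commutes with the generators and
    kills the range of \<open>P\<close>. Since \<open>F \<Omega>\<close> lies in this range, it
    kills all the total vectors.\<close>
  have separating: "v = 0" if v: "\<And>g. g \<in> Fix \<Longrightarrow> P (g v) = 0" for v
  proof -
    define K where "K = {v. \<forall>g\<in>Fix. P (g v) = 0}"
    have bl: "bounded_clinear (P \<circ> g)" if "g \<in> Fix" for g
      using that by (intro bounded_clinear_comp bounded_vac_proj M_bounded FixM)
    have K: "csubspace K" "closed K"
    proof -
      show "csubspace K"
        using bounded_clinearD[OF bl] by (auto simp: csubspace_def K_def)
      have "K = (\<Inter>g\<in>Fix. {v. (P \<circ> g) v = 0})" by (auto simp: K_def)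
      moreover have "closed {v. (P \<circ> g) v = 0}" if "g \<in> Fix" for g
        using bl[OF that] by (intro closed_Collect_eq continuous_intros linear_continuous_on
            bounded_clinear_bounded_linear)
      ultimately show "closed K" by (simp add: closed_INT)
    qed
    let ?E = "proj K"
    have bE: "bounded_clinear ?E" by (rule bounded_clinear_proj[OF K])
    have inv: "g v \<in> K" if g: "g \<in> Fix" and v: "v \<in> K" for g v
    proof -
      have "P (h (g v)) = 0" if "h \<in> Fix" for h
        using Fix_comp[OF that g] v by (auto simp: K_def)
      then show ?thesis by (simp add: K_def)
    qed
    have EF: "?E \<circ> g = g \<circ> ?E" if "g \<in> Fix" for g
      by (rule proj_commute[OF K, symmetric]) (use that in \<open>auto intro: M_bounded FixM inv Fix_adj\<close>)
    have Ecom: "?E \<in> com J"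
      unfolding com_def
    proof (intro CollectI conjI ballI bE)
      fix i assume i: "i \<in> J"
      then have "i \<in> I" using J by blast
      then show "weakly_intertwines ?E (Inr i) (Inr i)" "commutes_fermion ?E i"
        using bE i EF Fix_weyl Fix_fermion Fix_adj
        by (simp_all add: weakly_intertwines_iff_weyl commutes_fermion_def)
    qed
    have EP: "?E (P u) = 0" for u
    proof (rule proj_orth[OF K])
      fix y assume "y \<in> K"
      then have "P (id y) = 0" unfolding K_def using Fix_id by blast
      then show "cinner y (P u) = 0"
        using cinner_adj_left[OF bounded_vac_proj, of J y u] by (simp add: adj_vac_proj)
    qed
    have "?E = (\<lambda>x. 0)"
    proof (rule total_eq[OF bE])
      fix G F assume G: "G \<in> M" and F: "F \<in> N"
      have "?E (G (F \<Omega>)) = G (?E (F \<Omega>))" using commutantD(3)[OF G Ecom] by simp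
      also have "F \<Omega> = P (F \<Omega>)" using M_N_commute[OF inner_vac_proj_mem F, of \<Omega>] P_vac by metis
      then have "?E (F \<Omega>) = 0" using EP by metis
      finally show "?E (G (F \<Omega>)) = 0" by (simp add: bounded_clinearD[OF M_bounded[OF G]])
    qed simp
    moreover have "v \<in> K" using v by (simp add: K_def)
    ultimately show ?thesis using proj_mem[OF K] by metis
  qed
  have right: "\<Delta> (g' (P v)) = 0" if "g' \<in> Fix" for g' v
    by (rule separating) (rule sandwich[OF _ that])
  \<comment> \<open>The same separation removes the right factor: the matrix elements reduce to
    \<open>right\<close> with \<open>adj g\<close> in place of \<open>g'\<close>.\<close>
  have "adj \<Delta> u = 0" for u
  proof (rule separating)
    fix g assume g: "g \<in> Fix"
    note bg = M_bounded[OF FixM[OF g]]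
    show "P (g (adj \<Delta> u)) = 0"
    proof (rule cinner_ext)
      fix y
      have "cinner y (P (g (adj \<Delta> u))) = cinner (P y) (g (adj \<Delta> u))"
        using cinner_adj_left[OF bounded_vac_proj, of J y] by (simp add: adj_vac_proj)
      also have "\<dots> = cinner (\<Delta> (adj g (P y))) u"
        by (simp only: cinner_adj_left[OF bg, symmetric] cinner_adj_right[OF \<Delta>_bounded])
      finally have "cinner y (P (g (adj \<Delta> u))) = cinner (\<Delta> (adj g (P y))) u" .
      then show "cinner y (P (g (adj \<Delta> u))) = cinner y 0" using right[OF Fix_adj[OF g]] by simp
    qed
  qed
  then have "cinner u (\<Delta> x) = cinner u 0" for u x
    using cinner_adj_left[OF \<Delta>_bounded, of u x] by simp
  then have "\<Delta> x = 0" for x by (rule cinner_ext)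
  then show ?thesis by (simp add: \<Delta>_def fun_eq_iff)
qed

end

end

section \<open>The system and its copy\<close>

lemma CAR_pullback:
  assumes "CAR I f" "g ` K \<subseteq> I" "inj_on g K"
  shows "CAR K (\<lambda>k. f (g k))"
  using assms unfolding CAR_def inj_on_def by (auto simp: image_subset_iff)

lemma op_prod_simps [simp]: "op_prod F [] = id" "op_prod F (n # ns) = F n \<circ> op_prod F ns"
  by (simp_all add: op_prod_def)

lemma op_prod_conjugate:
  assumes "unitary U"
  shows "op_prod (\<lambda>n. U \<circ> F n \<circ> adj U) ns = U \<circ> op_prod F ns \<circ> adj U"
  by (induction ns) (use unitaryD[OF assms] in \<open>auto simp: fun_eq_iff\<close>)

fun copy :: "'s + 's \<Rightarrow> 's + 's" where
  "copy (Inl n) = Inr n"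
| "copy (Inr n) = Inl n"

fun site :: "'s + 's \<Rightarrow> 's" where
  "site (Inl n) = n"
| "site (Inr n) = n"

lemma copy_copy [simp]: "copy (copy i) = i" "site (copy i) = site i"
  by (cases i; simp)+

text \<open>\<open>A\<close> holds the sites whose fermions change copy, \<open>B\<close> those
  whose bosons do.\<close>

fun flip :: "'s set \<Rightarrow> 's set \<Rightarrow> ('s + 's) + ('s + 's) \<Rightarrow> ('s + 's) + ('s + 's)" where
  "flip A B (Inl i) = Inl (if site i \<in> A then copy i else i)"
| "flip A B (Inr i) = Inr (if site i \<in> B then copy i else i)"

lemma transpose_flip:
  "Transposition.transpose (Inl (Inl n)) (Inl (Inr n)) = flip {n} {}"
  "Transposition.transpose (Inr (Inl n)) (Inr (Inr n)) = flip {} {n}"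
proof -
  have "Transposition.transpose (Inl (Inl n)) (Inl (Inr n)) m = flip {n} {} m \<and>
      Transposition.transpose (Inr (Inl n)) (Inr (Inr n)) m = flip {} {n} m" for m
  proof -
    consider k where "m = Inl (Inl k)" | k where "m = Inl (Inr k)" | k where "m = Inr (Inl k)"
      | k where "m = Inr (Inr k)" by (metis sum.exhaust)
    then show ?thesis by cases (auto simp: Transposition.transpose_def)
  qed
  then show "Transposition.transpose (Inl (Inl n)) (Inl (Inr n)) = flip {n} {}"
    "Transposition.transpose (Inr (Inl n)) (Inr (Inr n)) = flip {} {n}" by auto
qed

text \<open>Two exchanges at one site cancel, hence the symmetric differences.\<close>

lemma flip_flip: "flip A B (flip A' B' m) = flip (A - A' \<union> (A' - A)) (B - B' \<union> (B' - B)) m"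
  by (cases m) auto

section \<open>Swaps of the copies as permutations of modes\<close>

locale doubled_lattice =
  fixes \<Lambda> :: "'s set" and a b :: "'s \<Rightarrow> 'h::complex_hilbert \<Rightarrow> 'h" and c d :: "'s \<Rightarrow> 'h uop" and \<Omega> :: 'h
  assumes finite_sites: "finite \<Lambda>"
    and fock: "fock_modes (\<Lambda> <+> \<Lambda>) (case_sum a b) (case_sum c d) \<Omega>"

sublocale doubled_lattice \<subseteq> fock_modes "\<Lambda> <+> \<Lambda>" "case_sum a b" "case_sum c d" \<Omega>
  by (rule fock)

context doubled_lattice
begin

abbreviation "sites \<equiv> \<Lambda> <+> \<Lambda>"
abbreviation "fer \<equiv> case_sum a b"
abbreviation "bos \<equiv> case_sum c d"

lemma copy_mem: "copy i \<in> sites \<longleftrightarrow> i \<in> sites"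
  by (cases i) auto

lemma flip_mem: "m \<in> modes \<Longrightarrow> flip A B m \<in> modes"
  by (cases m) (auto simp: copy_mem)

definition swaps :: "'s set \<Rightarrow> 's set \<Rightarrow> ('h \<Rightarrow> 'h) \<Rightarrow> bool" where
  "swaps A B X \<longleftrightarrow> second_quant (\<lambda>_. 1) (flip A B) X \<and> unitary X"

text \<open>Reduces identities between products of swaps to identities between sets of
  sites.\<close>

lemma swaps_unique: "swaps A B X \<Longrightarrow> swaps A B Y \<Longrightarrow> X = Y"
  unfolding swaps_def by (auto intro: second_quant_unique)

lemma swaps_id: "swaps {} {} id"
proof -
  have "flip {} {} m = m" for m :: "('s + 's) + ('s + 's)" by (cases m) auto
  then have "(flip {} {} :: ('s + 's) + ('s + 's) \<Rightarrow> _) = id" by auto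
  moreover have "unitary (id :: 'h \<Rightarrow> 'h)" by (rule unitaryI) auto
  ultimately show ?thesis using second_quant_id by (simp add: swaps_def)
qed

lemma swaps_comp:
  assumes "swaps A B X" "swaps A' B' Y"
  shows "swaps (A - A' \<union> (A' - A)) (B - B' \<union> (B' - B)) (X \<circ> Y)"
proof -
  have "second_quant (\<lambda>m. 1 * 1) (flip A B \<circ> flip A' B') (X \<circ> Y)"
    using assms flip_mem by (intro second_quant_comp) (auto simp: swaps_def)
  moreover have "flip A B \<circ> flip A' B' = flip (A - A' \<union> (A' - A)) (B - B' \<union> (B' - B))"
    by (rule ext) (simp only: comp_apply flip_flip)
  ultimately show ?thesis using assms unitary_comp by (auto simp: swaps_def)
qed

lemma swaps_commute:
  assumes "swaps A B X" "swaps A' B' Y"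
  shows "X \<circ> Y = Y \<circ> X"
  using swaps_comp[OF assms] swaps_comp[OF assms(2,1)]
  by (intro swaps_unique[of "A - A' \<union> (A' - A)" "B - B' \<union> (B' - B)"]) (auto simp: Un_commute)

lemma swaps_involution:
  assumes X: "swaps A B X"
  shows "X (X x) = x" "adj X = X"
proof -
  have "X \<circ> X = id" using swaps_comp[OF X X] swaps_id by (intro swaps_unique) auto
  then show *: "X (X x) = x" for x by (metis comp_apply id_apply)
  have u: "unitary X" using X by (simp add: swaps_def)
  show "adj X = X"
  proof
    fix x show "adj X x = X x" using unitaryD(2)[OF u, of "X x"] * by simp
  qed
qed

lemma swaps_weakly_intertwines:
  assumes X: "swaps A B X" and m: "m \<in> modes"
  shows "weakly_intertwines X m (flip A B m)"
proof (rule second_quant_weakly_intertwines[where \<tau> = "flip A B", OF _ swaps_involution(2)[OF X] m flip_mem[OF m]])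
  show "second_quant (\<lambda>_. 1) (flip A B) X" using X by (simp add: swaps_def)
  show "flip A B (flip A B m) = m" by (cases m) auto
qed auto

lemma swaps_com:
  assumes X: "swaps A B X" and J: "J \<subseteq> sites" "site ` J \<inter> (A \<union> B) = {}"
  shows "X \<in> com J"
proof -
  have b: "bounded_clinear X" using X by (auto simp: swaps_def unitaryD)
  have "weakly_intertwines X (Inl i) (Inl i)" "weakly_intertwines X (Inr i) (Inr i)" if "i \<in> J" for i
  proof -
    have "i \<in> sites" "site i \<notin> A" "site i \<notin> B" using that J by auto
    then show "weakly_intertwines X (Inl i) (Inl i)" "weakly_intertwines X (Inr i) (Inr i)"
      using swaps_weakly_intertwines[OF X, of "Inl i"] swaps_weakly_intertwines[OF X, of "Inr i"]
      by (simp_all add: InlI InrI)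
  qed
  then show ?thesis using b J by (auto simp: com_def commutes_fermion_weakly subset_iff)
qed

definition fermion_swap :: "'s \<Rightarrow> 'h \<Rightarrow> 'h" where
  "fermion_swap n = swap (graph (a n)) (graph (b n))"

definition boson_swap :: "'s \<Rightarrow> 'h \<Rightarrow> 'h" where
  "boson_swap n = swap (c n) (d n)"

lemma site_swaps:
  assumes n: "n \<in> \<Lambda>"
  shows swaps_fermion: "swaps {n} {} (fermion_swap n)" and swaps_boson: "swaps {} {n} (boson_swap n)"
    and swap_mem: "X \<in> {fermion_swap n, boson_swap n} \<Longrightarrow> X \<in> commutant (com ({n} <+> {n}))"
proof -
  let ?p = "Inl (Inl n) :: ('s + 's) + ('s + 's)" and ?p' = "Inl (Inr n) :: ('s + 's) + ('s + 's)"
  let ?r = "Inr (Inl n) :: ('s + 's) + ('s + 's)" and ?r' = "Inr (Inr n) :: ('s + 's) + ('s + 's)"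
  have p: "?p \<in> modes" "?p' \<in> modes" "?p \<noteq> ?p'" "isl ?p = isl ?p'"
    and r: "?r \<in> modes" "?r' \<in> modes" "?r \<noteq> ?r'" "isl ?r = isl ?r'" using n by auto
  have eq: "fermion_swap n = exchange ?p ?p'" "boson_swap n = exchange ?r ?r'"
    by (simp_all add: fermion_swap_def boson_swap_def exchange_def[OF p] exchange_def[OF r] uop_def)
  show "swaps {n} {} (fermion_swap n)" "swaps {} {n} (boson_swap n)"
    using second_quant_exchange[OF p] second_quant_exchange[OF r] unitary_exchange[OF p] unitary_exchange[OF r]
    by (simp_all only: swaps_def eq transpose_flip)
  have sub: "{n} <+> {n} \<subseteq> sites" using n by auto
  have mem: "m \<in> ({n} <+> {n}) <+> ({n} <+> {n})" if "m \<in> {?p, ?p', ?r, ?r'}" for m using that by auto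
  assume "X \<in> {fermion_swap n, boson_swap n}"
  then show "X \<in> commutant (com ({n} <+> {n}))"
  proof (elim insertE emptyE; intro commutantI)
    assume X: "X = fermion_swap n"
    show "bounded_clinear X" using unitary_exchange[OF p] X eq by (simp add: unitaryD)
    fix Y assume "Y \<in> com ({n} <+> {n})"
    then show "X \<circ> Y = Y \<circ> X"
      unfolding X eq by (intro commute_exchange[OF p, symmetric] com_bounded com_weakly[OF sub] mem) auto
  next
    assume X: "X = boson_swap n"
    show "bounded_clinear X" using unitary_exchange[OF r] X eq by (simp add: unitaryD)
    fix Y assume "Y \<in> com ({n} <+> {n})"
    then show "X \<circ> Y = Y \<circ> X"
      unfolding X eq by (intro commute_exchange[OF r, symmetric] com_bounded com_weakly[OF sub] mem) auto
  qed
qed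

lemma swaps_fermion_prod: "distinct ns \<Longrightarrow> set ns \<subseteq> \<Lambda> \<Longrightarrow> swaps (set ns) {} (op_prod fermion_swap ns)"
proof (induction ns)
  case (Cons n ns)
  have "swaps ({n} - set ns \<union> (set ns - {n})) ({} - {} \<union> ({} - {})) (fermion_swap n \<circ> op_prod fermion_swap ns)"
    using Cons by (intro swaps_comp swaps_fermion) auto
  moreover have "{n} - set ns \<union> (set ns - {n}) = set (n # ns)" using Cons by auto
  ultimately show ?case by (simp only: op_prod_simps Diff_empty Un_empty_right)
qed (simp add: swaps_id)

lemma swaps_boson_prod: "distinct ns \<Longrightarrow> set ns \<subseteq> \<Lambda> \<Longrightarrow> swaps {} (set ns) (op_prod boson_swap ns)"
proof (induction ns)
  case (Cons n ns)
  have "swaps ({} - {} \<union> ({} - {})) ({n} - set ns \<union> (set ns - {n})) (boson_swap n \<circ> op_prod boson_swap ns)"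
    using Cons by (intro swaps_comp swaps_boson) auto
  moreover have "{n} - set ns \<union> (set ns - {n}) = set (n # ns)" using Cons by auto
  ultimately show ?case by (simp only: op_prod_simps Diff_empty Un_empty_right)
qed (simp add: swaps_id)

text \<open>The orderings leave no trace in the site sets; with \<open>swaps_unique\<close>, all
  orderings give the same operator.\<close>

lemma swaps_prod:
  assumes "ks \<in> permutations_of_set \<Lambda>" "ns \<in> permutations_of_set \<Lambda>"
  shows "swaps \<Lambda> \<Lambda> (op_prod fermion_swap ks \<circ> op_prod boson_swap ns)"
  using swaps_comp[OF swaps_fermion_prod swaps_boson_prod, of ks ns] assms
  by (simp add: permutations_of_set_def)

definition total_swap :: "'h \<Rightarrow> 'h" where
  "total_swap = (SOME X. swaps \<Lambda> \<Lambda> X)"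

lemma swaps_total: "swaps \<Lambda> \<Lambda> total_swap"
proof -
  obtain ns where "ns \<in> permutations_of_set \<Lambda>"
    using finite_distinct_list[OF finite_sites] by (auto simp: permutations_of_set_def)
  then have "\<exists>X. swaps \<Lambda> \<Lambda> X" using swaps_prod by blast
  then show ?thesis unfolding total_swap_def by (rule someI_ex)
qed

lemma total_swap:
  shows total_swap_involution: "total_swap (total_swap x) = x"
    and adj_total_swap: "adj total_swap = total_swap" and unitary_total_swap: "unitary total_swap"
    and bounded_total_swap: "bounded_clinear total_swap"
  using swaps_total swaps_involution[OF swaps_total] by (auto simp: swaps_def unitaryD)

definition conj_swap :: "('h \<Rightarrow> 'h) \<Rightarrow> 'h \<Rightarrow> 'h" where
  "conj_swap X = total_swap \<circ> X \<circ> total_swap"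

lemma conj_swap_simps:
  shows "conj_swap (conj_swap X) = X" "conj_swap (X \<circ> Y) = conj_swap X \<circ> conj_swap Y"
    "bounded_clinear X \<Longrightarrow> bounded_clinear (conj_swap X)"
    "bounded_clinear X \<Longrightarrow> adj (conj_swap X) = conj_swap (adj X)"
  using total_swap
  by (auto simp: conj_swap_def fun_eq_iff adj_comp bounded_clinear_comp)

lemma conj_swap_generators:
  assumes i: "i \<in> sites"
  shows "conj_swap (fer i) = fer (copy i)" "conj_swap (adj (fer i)) = adj (fer (copy i))"
    "conj_swap (weyl (bos i) z) = weyl (bos (copy i)) z"
proof -
  have s: "site i \<in> \<Lambda>" using i by (cases i) auto
  have ci: "copy i \<in> sites" using i by (simp add: copy_mem)
  have "weakly_intertwines total_swap (Inl i) (Inl (copy i))" "weakly_intertwines total_swap (Inr i) (Inr (copy i))"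
    using swaps_weakly_intertwines[OF swaps_total, of "Inl i"] swaps_weakly_intertwines[OF swaps_total, of "Inr i"] i s
    by (simp_all add: InlI InrI)
  then have "total_swap \<circ> fer i = fer (copy i) \<circ> total_swap" "total_swap \<circ> adj (fer i) = adj (fer (copy i)) \<circ> total_swap"
    "total_swap \<circ> weyl (bos i) z = weyl (bos (copy i)) z \<circ> total_swap"
    using weakly_intertwines_fermion[OF bounded_total_swap i ci] weakly_intertwines_weyl[OF bounded_total_swap i ci]
    by auto
  then show "conj_swap (fer i) = fer (copy i)" "conj_swap (adj (fer i)) = adj (fer (copy i))"
    "conj_swap (weyl (bos i) z) = weyl (bos (copy i)) z"
    unfolding conj_swap_def by (simp_all add: comp_assoc) (simp_all add: fun_eq_iff total_swap)
qed

lemma conj_swap_com: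
  assumes J: "J \<subseteq> sites" and X: "X \<in> com J"
  shows "conj_swap X \<in> com (copy ` J)"
proof -
  have b: "bounded_clinear X" "bounded_clinear (conj_swap X)"
    using X by (auto intro: com_bounded conj_swap_simps)
  have "commutes_fermion (conj_swap X) (copy i) \<and> weakly_intertwines (conj_swap X) (Inr (copy i)) (Inr (copy i))"
    if i: "i \<in> J" for i
  proof -
    have iI: "i \<in> sites" using i J by auto
    have "X \<circ> fer i = fer i \<circ> X" "X \<circ> adj (fer i) = adj (fer i) \<circ> X"
      "X \<circ> weyl (bos i) z = weyl (bos i) z \<circ> X" for z
    proof -
      have "commutes_fermion X i" "weakly_intertwines X (Inr i) (Inr i)" using X i by (auto simp: com_def)
      then show "X \<circ> fer i = fer i \<circ> X" "X \<circ> adj (fer i) = adj (fer i) \<circ> X"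
        "X \<circ> weyl (bos i) z = weyl (bos i) z \<circ> X"
        using weakly_intertwines_iff_weyl[OF b(1) iI] unfolding commutes_fermion_def by blast+
    qed
    then have "conj_swap X \<circ> conj_swap (fer i) = conj_swap (fer i) \<circ> conj_swap X"
      "conj_swap X \<circ> conj_swap (adj (fer i)) = conj_swap (adj (fer i)) \<circ> conj_swap X"
      "conj_swap X \<circ> conj_swap (weyl (bos i) z) = conj_swap (weyl (bos i) z) \<circ> conj_swap X" for z
      by (simp_all flip: conj_swap_simps(2))
    then show ?thesis
      using b iI by (simp add: conj_swap_generators commutes_fermion_def weakly_intertwines_iff_weyl copy_mem)
  qed
  then show ?thesis using b by (auto simp: com_def)
qed

lemma conj_swap_algebra:
  assumes J: "J \<subseteq> sites" and X: "X \<in> commutant (com J)"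
  shows "conj_swap X \<in> commutant (com (copy ` J))"
proof (rule commutantI)
  show "bounded_clinear (conj_swap X)" using commutantD(1)[OF X] by (rule conj_swap_simps)
  fix Y assume "Y \<in> com (copy ` J)"
  then have "conj_swap Y \<in> com (copy ` copy ` J)" using J by (intro conj_swap_com) (auto simp: copy_mem)
  then have "conj_swap Y \<in> com J" by (simp add: image_image)
  then have "X \<circ> conj_swap Y = conj_swap Y \<circ> X" by (rule commutantD(2)[OF X])
  then have "conj_swap (X \<circ> conj_swap Y) = conj_swap (conj_swap Y \<circ> X)" by simp
  then show "conj_swap X \<circ> Y = Y \<circ> conj_swap X" by (simp add: conj_swap_simps)
qed

abbreviation "JA \<equiv> Inl ` \<Lambda> :: ('s + 's) set"
abbreviation "JB \<equiv> Inr ` \<Lambda> :: ('s + 's) set"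

lemma JAB: "JA \<subseteq> sites" "JB \<subseteq> sites" "copy ` JA = JB" "copy ` JB = JA" "sites - JA = JB" "sites - JB = JA"
  by (auto simp: image_image)

lemma copy_algebras:
  "mode_algebra \<Lambda> a c = commutant (com JA)" "mode_algebra \<Lambda> b d = commutant (com JB)"
proof -
  have "{weyl (c n) z | n z. n \<in> \<Lambda>} = {weyl (bos i) z | i z. i \<in> JA}"
    "{weyl (d n) z | n z. n \<in> \<Lambda>} = {weyl (bos i) z | i z. i \<in> JB}"
    by (force; fail | (intro set_eqI iffI; clarsimp; metis (no_types, lifting) imageI old.sum.simps(5,6)))+
  then have "mode_algebra \<Lambda> a c = mode_algebra JA fer bos" "mode_algebra \<Lambda> b d = mode_algebra JB fer bos"
    by (simp_all add: mode_algebra_def image_image)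
  then show "mode_algebra \<Lambda> a c = commutant (com JA)" "mode_algebra \<Lambda> b d = commutant (com JB)"
    using mode_algebra_commutant JAB by simp_all
qed

lemma region_algebra_commutant:
  "R \<subseteq> \<Lambda> \<Longrightarrow> region_algebra a b c d R = commutant (com (R <+> R))"
  unfolding region_algebra_def by (rule mode_algebra_commutant) auto

lemma klein_exists: "J \<subseteq> sites \<Longrightarrow> \<exists>\<kappa>. klein_operator J \<kappa>"
  using finite_subset[of J sites] finite_sites by (intro klein_operator_exists) auto

lemma substituted_conj_swap:
  assumes U: "U \<in> mode_algebra \<Lambda> a c" and sub: "substituted \<Lambda> a b c d U U'"
  shows "U' = conj_swap U"
proof -
  obtain \<Phi> where iso: "star_isomorphism \<Phi> (mode_algebra \<Lambda> a c) (mode_algebra \<Lambda> b d)"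
    and gen: "\<And>n. n \<in> \<Lambda> \<Longrightarrow> \<Phi> (a n) = b n" "\<And>n z. n \<in> \<Lambda> \<Longrightarrow> \<Phi> (weyl (c n) z) = weyl (d n) z"
    and U': "\<Phi> U = U'"
    using sub unfolding substituted_def by blast
  let ?MA = "commutant (com JA)" and ?MB = "commutant (com JB)"
  have bij: "bij_betw \<Phi> ?MA ?MB" using iso by (simp add: star_isomorphism_def copy_algebras)
  have hom: "\<Phi> (\<lambda>x. X x + Y x) = (\<lambda>x. \<Phi> X x + \<Phi> Y x)" "\<Phi> (X \<circ> Y) = \<Phi> X \<circ> \<Phi> Y"
    "\<Phi> (\<lambda>x. z *\<^sub>C X x) = (\<lambda>x. z *\<^sub>C \<Phi> X x)" "\<Phi> (adj X) = adj (\<Phi> X)"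
    if "X \<in> ?MA" "Y \<in> ?MA" for X Y z
    using iso that unfolding star_isomorphism_def copy_algebras by blast+
  have \<Phi>_mem: "\<Phi> X \<in> ?MB" if "X \<in> ?MA" for X using bij that by (auto simp: bij_betw_def)
  obtain \<kappa> where \<kappa>: "klein_operator JA \<kappa>" using klein_exists[OF JAB(1)] by blast
  have toA: "conj_swap X \<in> ?MA" if "X \<in> ?MB" for X using conj_swap_algebra[OF JAB(2) that] JAB by simp
  have toB: "conj_swap X \<in> ?MB" if "X \<in> ?MA" for X using conj_swap_algebra[OF JAB(1) that] JAB by simp
  have "conj_swap (\<Phi> U) = U"
  proof (rule automorphism_unique[OF JAB(1) \<kappa>, where \<Psi> = "\<lambda>X. conj_swap (\<Phi> X)"])
    show "U \<in> ?MA" using U by (simp add: copy_algebras)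
    show "conj_swap (\<Phi> X) \<in> ?MA" if "X \<in> ?MA" for X using that by (intro toA \<Phi>_mem)
    show "\<exists>X\<in>?MA. conj_swap (\<Phi> X) = Y" if "Y \<in> ?MA" for Y
    proof -
      have "conj_swap Y \<in> \<Phi> ` ?MA" using bij toB[OF that] by (simp add: bij_betw_def)
      then show ?thesis using conj_swap_simps(1) by (metis imageE)
    qed
    fix X assume X: "X \<in> ?MA"
    fix z :: complex
    show "conj_swap (\<Phi> (\<lambda>x. z *\<^sub>C X x)) = (\<lambda>x. z *\<^sub>C conj_swap (\<Phi> X) x)"
      using hom(3)[OF X X] by (simp add: conj_swap_def fun_eq_iff bounded_clinearD[OF bounded_total_swap])
    show "conj_swap (\<Phi> (adj X)) = adj (conj_swap (\<Phi> X))"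
      using hom(4)[OF X X] commutantD(1)[OF \<Phi>_mem[OF X]] by (simp add: conj_swap_simps)
    fix Y assume Y: "Y \<in> ?MA"
    show "conj_swap (\<Phi> (\<lambda>x. X x + Y x)) = (\<lambda>x. conj_swap (\<Phi> X) x + conj_swap (\<Phi> Y) x)"
      using hom(1)[OF X Y] by (simp add: conj_swap_def fun_eq_iff bounded_clinearD[OF bounded_total_swap])
    show "conj_swap (\<Phi> (X \<circ> Y)) = conj_swap (\<Phi> X) \<circ> conj_swap (\<Phi> Y)"
      using hom(2)[OF X Y] by (simp add: conj_swap_simps)
    show "X = Y" if "conj_swap (\<Phi> X) = conj_swap (\<Phi> Y)"
    proof -
      have "\<Phi> X = \<Phi> Y" using that conj_swap_simps(1) by metis
      then show ?thesis using bij X Y by (auto simp: bij_betw_def inj_on_def)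
    qed
  next
    fix i z assume "i \<in> JA"
    then obtain n where n: "i = Inl n" "n \<in> \<Lambda>" by blast
    then show "conj_swap (\<Phi> (fer i)) = fer i" "conj_swap (\<Phi> (weyl (bos i) z)) = weyl (bos i) z"
      using conj_swap_generators[of "Inr n"] gen by auto
  qed
  then show ?thesis using U' conj_swap_simps(1) by metis
qed

end

section \<open>Parity and localization of the evolved swaps\<close>

context doubled_lattice
begin

lemma swaps_commutes_parity:
  assumes X: "swaps A B X" and \<theta>: "klein_operator sites \<theta>"
  shows "X \<circ> \<theta> = \<theta> \<circ> X"
proof -
  have sq: "second_quant (\<lambda>_. 1) (flip A B) X" "second_quant (klein_sign sites) id \<theta>"
    using X \<theta> by (auto simp: swaps_def klein_operator_def)
  have 1: "second_quant (\<lambda>m. klein_sign sites m * 1) (flip A B \<circ> id) (X \<circ> \<theta>)"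
    by (rule second_quant_comp[OF sq]) simp
  have 2: "second_quant (\<lambda>m. 1 * klein_sign sites (flip A B m)) (id \<circ> flip A B) (\<theta> \<circ> X)"
    by (rule second_quant_comp[OF sq(2,1) flip_mem])
  show ?thesis
  proof (rule second_quant_unique[OF 1 2])
    fix m :: "('s + 's) + ('s + 's)" assume m: "m \<in> modes"
    have "klein_sign sites (flip A B m) = klein_sign sites m"
      using m by (cases m) (auto simp: klein_sign_def image_iff copy_mem)
    then show "klein_sign sites m * 1 = 1 * klein_sign sites (flip A B m)" by simp
  qed auto
qed

text \<open>Recovers the parity of a region from the total parity and the outer parity, the two for
  which commutation is accessible.\<close>

lemma klein_product:
  assumes J: "J \<subseteq> sites" and k: "klein_operator J \<kappa>" "klein_operator (sites - J) \<kappa>'" "klein_operator sites \<theta>"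
  shows "\<theta> = \<kappa> \<circ> \<kappa>'" "\<kappa> = \<theta> \<circ> \<kappa>'"
proof -
  have sq: "second_quant (klein_sign J) id \<kappa>" "second_quant (klein_sign (sites - J)) id \<kappa>'"
    "second_quant (klein_sign sites) id \<theta>" using k by (auto simp: klein_operator_def)
  have 1: "second_quant (\<lambda>m. klein_sign (sites - J) m * klein_sign J (id m)) (id \<circ> id) (\<kappa> \<circ> \<kappa>')"
    by (rule second_quant_comp[OF sq(1,2)]) simp
  show eq: "\<theta> = \<kappa> \<circ> \<kappa>'"
    by (rule second_quant_unique[OF sq(3) 1]) (use J in \<open>auto simp: klein_sign_def\<close>)
  have "\<kappa>' \<circ> \<kappa>' = id" by (rule klein_operator_involution[OF k(2)])
  then show "\<kappa> = \<theta> \<circ> \<kappa>'" unfolding eq comp_assoc by simp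
qed

text \<open>Makes the invariance of ancillary fermions applicable to the fermions of the
  copy.\<close>

lemma copy_fermion_ancillary:
  assumes n: "n \<in> \<Lambda>"
  shows "ancillary_fermion \<Lambda> a c (b n)"
  unfolding ancillary_fermion_def
proof (intro conjI ballI)
  define g :: "'s option \<Rightarrow> 's + 's" where "g = case_option (Inr n) Inl"
  have "CAR (insert None (Some ` \<Lambda>)) (\<lambda>k. fer (g k))"
    by (rule CAR_pullback[OF fermion_CAR]) (use n in \<open>auto simp: g_def inj_on_def split: option.splits\<close>)
  moreover have "(\<lambda>k. fer (g k)) = case_option (b n) a"
    by (auto simp: g_def fun_eq_iff split: option.splits)
  ultimately show "CAR (insert None (Some ` \<Lambda>)) (case_option (b n) a)" by simp
  fix m assume "m \<in> \<Lambda>"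
  then show "commutes_with (b n) (c m)" "commutes_with (adj (b n)) (c m)"
    using boson_fermion_commute[of "Inr n" "Inl m"] n by auto
qed

text \<open>Affiliation yields commutation with the annihilator only; self-adjointness of
  \<open>X\<close> supplies the creator.\<close>

lemma commutes_with_weakly_intertwines:
  assumes X: "bounded_clinear X" "adj X = X" and i: "i \<in> sites" and c: "commutes_with X (bos i)"
  shows "weakly_intertwines X (Inr i) (Inr i)"
  unfolding weakly_intertwines_def
proof (intro ballI conjI)
  have m: "Inr i \<in> modes" using i by auto
  have ad: "cinner y (X x) = cinner (X y) x" for x y
    using cinner_adj_left[OF X(1)] X(2) by simp
  have an: "(X v, X (an (Inr i) v)) \<in> uop (Inr i)" if "v \<in> D" for v
    using uop_an[OF m that] c by (simp add: commutes_with_def uop_def)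
  fix x y assume x: "x \<in> D" and y: "y \<in> D"
  show "cinner y (X (an (Inr i) x)) = cinner (cr (Inr i) y) (X x)"
    using uop_cr[OF m y] an[OF x] by (simp add: adjoint_def)
  have "cinner (cr (Inr i) x) (X y) = cinner x (X (an (Inr i) y))"
    using uop_cr[OF m x] an[OF y] by (simp add: adjoint_def)
  then have "cinner (X y) (cr (Inr i) x) = cinner (X (an (Inr i) y)) x"
    by (metis cinner_commute)
  then show "cinner y (X (cr (Inr i) x)) = cinner (an (Inr i) y) (X x)" by (simp add: ad)
qed

lemma commute_conjugate:
  assumes U: "unitary U" and XY: "X \<circ> (adj U \<circ> Y \<circ> U) = (adj U \<circ> Y \<circ> U) \<circ> X"
  shows "(U \<circ> X \<circ> adj U) \<circ> Y = Y \<circ> (U \<circ> X \<circ> adj U)"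
proof
  fix x
  have "X (adj U (Y (U (adj U x)))) = adj U (Y (U (X (adj U x))))"
    using XY by (metis comp_apply)
  then have "U (X (adj U (Y x))) = U (adj U (Y (U (X (adj U x)))))"
    by (simp add: unitaryD[OF U])
  then show "((U \<circ> X \<circ> adj U) \<circ> Y) x = (Y \<circ> (U \<circ> X \<circ> adj U)) x"
    by (simp add: unitaryD[OF U])
qed

lemma conjugate_commute:
  assumes U: "unitary U" and XY: "(U \<circ> X \<circ> adj U) \<circ> Y = Y \<circ> (U \<circ> X \<circ> adj U)"
  shows "X \<circ> (adj U \<circ> Y \<circ> U) = (adj U \<circ> Y \<circ> U) \<circ> X"
proof
  fix x
  have "U (X (adj U (Y (U x)))) = Y (U (X (adj U (U x))))" using XY by (metis comp_apply)
  then have "adj U (U (X (adj U (Y (U x))))) = adj U (Y (U (X (adj U (U x)))))" by simp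
  then show "(X \<circ> (adj U \<circ> Y \<circ> U)) x = ((adj U \<circ> Y \<circ> U) \<circ> X) x"
    by (simp add: unitaryD[OF U])
qed

text \<open>The algebra of the empty region commutes with all bounded operators, whereas an evolved
  fermion does not commute with its own adjoint: the anticommutation relations at the vacuum show
  this.\<close>

lemma causal_region_nonempty:
  assumes n: "n \<in> \<Lambda>" and U: "unitary U" and loc: "adj U \<circ> a n \<circ> U \<in> region_algebra a b c d R" and R: "R \<subseteq> \<Lambda>"
  shows "R \<noteq> {}"
proof
  assume "R = {}"
  then have V: "adj U \<circ> a n \<circ> U \<in> commutant (com {})" using loc R by (simp add: region_algebra_commutant Plus_def)
  have i: "Inl n \<in> sites" using n by auto
  have ba: "bounded_clinear (a n)" using bounded_fermion[OF i] by simp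
  have "adj U \<circ> adj (a n) \<circ> U \<in> com {}"
    using U ba by (simp add: com_def bounded_clinear_comp bounded_clinear_adj unitaryD)
  from commutantD(2)[OF V this]
  have "adj U (a n (U (adj U (adj (a n) (U x))))) = adj U (adj (a n) (U (adj U (a n (U x)))))" for x
    by (simp add: fun_eq_iff)
  from this[of "adj U \<Omega>"] have "adj U (a n (adj (a n) \<Omega>)) = adj U (adj (a n) (a n \<Omega>))"
    by (simp add: unitaryD[OF U])
  then have "U (adj U (a n (adj (a n) \<Omega>))) = U (adj U (adj (a n) (a n \<Omega>)))" by simp
  then have "a n (adj (a n) \<Omega>) = adj (a n) (a n \<Omega>)" by (simp add: unitaryD[OF U])
  moreover have "a n \<Omega> = 0" using fermion_vacuum[OF i] by simp
  ultimately have "a n (adj (a n) \<Omega>) = 0" using bounded_clinearD(3)[OF bounded_clinear_adj[OF ba]] by simp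
  moreover have "a n (adj (a n) \<Omega>) = - adj (a n) (a n \<Omega>) + \<Omega>"
    using CAR_D(3)[OF fermion_CAR i i, of \<Omega>] by simp
  ultimately show False
    using \<open>a n \<Omega> = 0\<close> bounded_clinearD(3)[OF bounded_clinear_adj[OF ba]] norm_vacuum(1) by simp
qed

context
  fixes U :: "'h \<Rightarrow> 'h"
  assumes U: "unitary U" "U \<in> mode_algebra \<Lambda> a c"
    and anc: "\<And>e. ancillary_fermion \<Lambda> a c e \<Longrightarrow> adj U \<circ> e \<circ> U = e"
begin

text \<open>The fermions are ancillary for the original system; the Weyl operators of the copy lie
  in the commutant of its algebra.\<close>

lemma evolution_commutes:
  assumes n: "n \<in> \<Lambda>"
  shows "commutes_fermion U (Inr n)" "U \<circ> weyl (d n) z = weyl (d n) z \<circ> U"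
proof -
  have i: "Inr n \<in> sites" using n by auto
  have bb: "bounded_clinear (b n)" using bounded_fermion[OF i] by simp
  have eq: "adj U \<circ> b n \<circ> U = b n" by (rule anc[OF copy_fermion_ancillary[OF n]])
  have "adj (adj U \<circ> b n \<circ> U) = adj U \<circ> adj (b n) \<circ> U"
    using U bb by (simp add: adj_comp bounded_clinear_comp bounded_clinear_adj unitaryD comp_assoc)
  then have eq': "adj U \<circ> adj (b n) \<circ> U = adj (b n)" by (simp add: eq)
  have "U (b n x) = b n (U x)" "U (adj (b n) x) = adj (b n) (U x)" for x
    using fun_cong[OF eq, of x] fun_cong[OF eq', of x] unitaryD(3)[OF U(1)] by (metis comp_apply)+
  then show "commutes_fermion U (Inr n)" by (auto simp: commutes_fermion_def)
  obtain \<kappa> where \<kappa>: "klein_operator JA \<kappa>" using klein_exists[OF JAB(1)] by blast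
  have "weyl (bos (Inr n)) z \<in> com JA" using n by (intro weyl_com[OF JAB(1) \<kappa>]) auto
  then show "U \<circ> weyl (d n) z = weyl (d n) z \<circ> U"
    using U(2) commutantD(2)[of U "com JA"] by (simp add: copy_algebras)
qed

text \<open>\<open>U\<close> commutes with \<open>b\<close> and with the twisted \<open>b \<kappa>\<close>, hence with
  \<open>\<kappa> = b\<^sup>\<dagger> (b \<kappa>) + b (b\<^sup>\<dagger> \<kappa>)\<close>; so it is even.\<close>

lemma evolution_parity:
  assumes \<theta>: "klein_operator sites \<theta>"
  shows "U \<circ> \<theta> = \<theta> \<circ> U"
proof -
  obtain \<kappa> where \<kappa>: "klein_operator JA \<kappa>" using klein_exists[OF JAB(1)] by blast
  obtain \<kappa>' where \<kappa>': "klein_operator (sites - JA) \<kappa>'" using klein_exists[of "sites - JA"] by blast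
  have bU: "bounded_clinear U" using U by (simp add: unitaryD)
  have 1: "U \<circ> \<kappa>' = \<kappa>' \<circ> U"
    using \<kappa>' bU evolution_commutes(1) unfolding klein_operator_def JAB by blast
  have 2: "U \<circ> \<kappa> = \<kappa> \<circ> U"
  proof (cases "\<Lambda> = {}")
    \<comment> \<open>Without sites there is no fermion of the copy to build \<open>\<kappa>\<close>
      from, but then commutation is vacuous.\<close>
    case True
    then have "\<forall>i\<in>JA. commutes_fermion U i" by simp
    then show ?thesis using \<kappa> bU unfolding klein_operator_def by blast
  next
    case False
    then obtain n where n: "n \<in> \<Lambda>" by blast
    then have i: "Inr n \<in> sites" "Inr n \<in> sites - JA" by auto
    have UM: "U \<in> commutant (com JA)" using U(2) by (simp add: copy_algebras)
    note tw = twisted_fermion_com[OF JAB(1) \<kappa> i(2)]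
    have t: "U (b n (\<kappa> x)) = b n (\<kappa> (U x))" "U (adj (b n) (\<kappa> x)) = adj (b n) (\<kappa> (U x))" for x
      using commutantD(3)[OF UM tw(1), of x] commutantD(3)[OF UM tw(2), of x] by simp_all
    note cb = commutes_fermionD[OF evolution_commutes(1)[OF n], simplified]
    have car: "b n (adj (b n) x) + adj (b n) (b n x) = x" for x
      using CAR_D(3)[OF fermion_CAR i(1) i(1), of x] by simp
    show ?thesis
    proof
      fix x
      have "U (\<kappa> x) = U (b n (adj (b n) (\<kappa> x)) + adj (b n) (b n (\<kappa> x)))" by (simp add: car)
      also have "\<dots> = b n (adj (b n) (\<kappa> (U x))) + adj (b n) (b n (\<kappa> (U x)))"
        by (simp only: bounded_clinearD(1)[OF bU] cb(1)[of "adj (b n) (\<kappa> x)"] cb(2)[of "b n (\<kappa> x)"] t)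
      also have "\<dots> = \<kappa> (U x)" by (rule car)
      finally show "(U \<circ> \<kappa>) x = (\<kappa> \<circ> U) x" by simp
    qed
  qed
  show ?thesis
    unfolding klein_product(1)[OF JAB(1) \<kappa> \<kappa>' \<theta>] using 1 2 by (metis comp_assoc)
qed

text \<open>Causality bounds the spreading of \<open>U\<^sub>A\<^sup>\<dagger> a U\<^sub>A\<close>. A swap at \<open>n\<close> therefore commutes with
  \<open>U\<^sub>B\<^sup>\<dagger> b\<^sub>m U\<^sub>B\<close> unless \<open>n\<close> lies in the region \<open>R m\<close>, and by duality its evolution is localized on the
  sites \<open>m\<close> of that kind.\<close>

lemma swap_evolution_localized:
  assumes R: "\<And>m. R m \<subseteq> \<Lambda>"
    and loc: "\<And>m. m \<in> \<Lambda> \<Longrightarrow> adj U \<circ> a m \<circ> U \<in> region_algebra a b c d (R m)"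
      "\<And>m. m \<in> \<Lambda> \<Longrightarrow> affiliated (conjugate U (c m)) (region_algebra a b c d (R m))"
    and n: "n \<in> \<Lambda>" "n \<in> R n" and X0: "X0 \<in> {fermion_swap n, boson_swap n}"
  shows "conj_swap U \<circ> X0 \<circ> adj (conj_swap U) \<in> region_algebra a b c d {m \<in> \<Lambda>. n \<in> R m}"
proof -
  define W where "W = conj_swap U"
  define R' where "R' = {m \<in> \<Lambda>. n \<in> R m}"
  define J where "J = R' <+> R'"
  define X where "X = W \<circ> X0 \<circ> adj W"
  have bU: "bounded_clinear U" using U by (simp add: unitaryD)
  have W: "unitary W" unfolding W_def conj_swap_def by (intro unitary_comp unitary_total_swap U)
  have adW: "adj W = conj_swap (adj U)" unfolding W_def using bU by (simp add: conj_swap_simps)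
  have R': "R' \<subseteq> \<Lambda>" and J: "J \<subseteq> sites" by (auto simp: R'_def J_def)
  \<comment> \<open>From here on only the site of the swap matters, so the fermionic and the bosonic
    case are treated together.\<close>
  obtain A B where AB: "A \<subseteq> {n}" "B \<subseteq> {n}" "swaps A B X0"
    using X0 swaps_fermion[OF n(1)] swaps_boson[OF n(1)] by blast
  have X0u: "unitary X0" "bounded_clinear X0" "adj X0 = X0"
    using AB(3) swaps_involution(2) by (auto simp: swaps_def unitaryD)
  have X0com: "X0 \<in> com K" if "K \<subseteq> sites" "n \<notin> site ` K" for K
    using that AB by (intro swaps_com) auto
  have bX: "bounded_clinear X" unfolding X_def
    using W X0u by (intro bounded_clinear_comp bounded_clinear_adj) (auto simp: unitaryD)
  have adX: "adj X = X"
    unfolding X_def using unitaryD(1)[OF W] X0u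
    by (simp add: adj_comp bounded_clinear_comp bounded_clinear_adj comp_assoc)
  have X0_swap: "X0 \<circ> total_swap = total_swap \<circ> X0" by (rule swaps_commute[OF AB(3) swaps_total])
  \<comment> \<open>The total swap fixes \<open>X0\<close>, so commutation with an evolved mode of
    the original carries over to the copy evolving under \<open>W\<close>.\<close>
  have X0_conj: "X0 \<circ> (adj W \<circ> conj_swap Y \<circ> W) = (adj W \<circ> conj_swap Y \<circ> W) \<circ> X0"
    if "X0 \<circ> (adj U \<circ> Y \<circ> U) = (adj U \<circ> Y \<circ> U) \<circ> X0" for Y
  proof -
    have "adj W \<circ> conj_swap Y \<circ> W = conj_swap (adj U \<circ> Y \<circ> U)"
      unfolding adW unfolding W_def conj_swap_simps(2) ..
    moreover have "conj_swap X0 = X0"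
      unfolding conj_swap_def X0_swap[symmetric] comp_assoc by (simp add: fun_eq_iff total_swap_involution)
    ultimately show ?thesis using that conj_swap_simps(2) by metis
  qed
  have fer_commute: "X \<circ> fer j = fer j \<circ> X" and bos_commute: "X \<circ> weyl (bos j) z = weyl (bos j) z \<circ> X"
    if j: "j \<in> sites - J" for j z
  proof -
    obtain m where m: "m \<in> \<Lambda>" "n \<notin> R m" and jm: "j = Inl m \<or> j = Inr m"
      using j by (auto simp: J_def R'_def)
    \<comment> \<open>\<open>n\<close> lies in its own region \<open>R n\<close> but not in
      \<open>R m\<close>.\<close>
    then have nm: "n \<noteq> m" using n by auto
    have mi: "Inl m \<in> sites" "Inr m \<in> sites" using m by auto
    have "(X \<circ> fer j = fer j \<circ> X) \<and> X \<circ> weyl (bos j) z = weyl (bos j) z \<circ> X"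
      using jm
    proof
      \<comment> \<open>\<open>W\<close> acts on the copy alone and leaves this mode unchanged, so
        it suffices that the swap sits at another site.\<close>
      assume j: "j = Inl m"
      have "conj_swap U \<circ> conj_swap (fer (Inr m)) = conj_swap (fer (Inr m)) \<circ> conj_swap U"
        "conj_swap U \<circ> conj_swap (weyl (bos (Inr m)) z) = conj_swap (weyl (bos (Inr m)) z) \<circ> conj_swap U"
        using evolution_commutes(1)[OF m(1)] evolution_commutes(2)[OF m(1), of z]
        by (simp_all add: commutes_fermion_def flip: conj_swap_simps(2))
      then have Wj: "W \<circ> fer j = fer j \<circ> W" "W \<circ> weyl (bos j) z = weyl (bos j) z \<circ> W"
        using mi(2) by (simp_all add: conj_swap_generators W_def j del: old.sum.case)
      have "X0 \<in> com {j}" using mi nm j by (intro X0com) auto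
      then have X0j: "X0 \<circ> fer j = fer j \<circ> X0" "X0 \<circ> weyl (bos j) z = weyl (bos j) z \<circ> X0"
        using X0u mi j by (auto simp: com_def commutes_fermion_def weakly_intertwines_iff_weyl)
      have "adj W \<circ> Y \<circ> W = Y" if "W \<circ> Y = Y \<circ> W" for Y
        unfolding comp_assoc that[symmetric] using unitaryD(2)[OF W] by (simp add: fun_eq_iff)
      then show ?thesis
        unfolding X_def using X0j Wj by (intro conjI commute_conjugate[OF W]) simp_all
    next
      assume j: "j = Inr m"
      let ?K = "R m <+> R m"
      have K: "?K \<subseteq> sites" "n \<notin> site ` ?K" using R[of m] m by auto
      note X0K = X0com[OF K]
      have "X0 \<circ> (adj U \<circ> a m \<circ> U) = (adj U \<circ> a m \<circ> U) \<circ> X0"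
        using loc(1)[OF m(1)] commutantD(2)[OF _ X0K] R[of m] by (simp add: region_algebra_commutant)
      then have "X0 \<circ> (adj W \<circ> conj_swap (a m) \<circ> W) = (adj W \<circ> conj_swap (a m) \<circ> W) \<circ> X0"
        by (rule X0_conj)
      then have 1: "X \<circ> b m = b m \<circ> X"
        unfolding X_def using conj_swap_generators(1)[OF mi(1)] by (intro commute_conjugate[OF W]) simp
      have "X0 \<in> commutant (region_algebra a b c d (R m))"
        using X0K X0u(2) commutantD(2)[OF _ X0K] R[of m]
        by (simp add: region_algebra_commutant commutant_def)
      then have cw: "commutes_with X0 (conjugate U (c m))"
        using loc(2)[OF m(1)] X0u(1) by (simp add: affiliated_def)
      \<comment> \<open>Affiliation concerns the unbounded evolved mode. Commutation is moved to
        \<open>c m\<close> itself, turned into commutation with its Weyl operators, and then moved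
        back.\<close>
      let ?Y = "U \<circ> X0 \<circ> adj U"
      have "commutes_with ?Y (c m)"
        unfolding commutes_with_def
      proof (intro allI impI)
        fix x y assume "(x, y) \<in> c m"
        then have "(adj U x, adj U y) \<in> conjugate U (c m)" by (auto simp: conjugate_def)
        then have "(X0 (adj U x), X0 (adj U y)) \<in> conjugate U (c m)" using cw by (simp add: commutes_with_def)
        then obtain x' y' where "X0 (adj U x) = adj U x'" "X0 (adj U y) = adj U y'" "(x', y') \<in> c m"
          by (auto simp: conjugate_def)
        then show "(?Y x, ?Y y) \<in> c m" by (simp add: unitaryD(3)[OF U(1)])
      qed
      moreover have "bounded_clinear ?Y" "adj ?Y = ?Y"
        using bU X0u by (simp_all add: adj_comp bounded_clinear_comp bounded_clinear_adj comp_assoc)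
      ultimately have "weakly_intertwines ?Y (Inr (Inl m)) (Inr (Inl m))"
        using mi by (intro commutes_with_weakly_intertwines) auto
      from weakly_intertwines_weyl[OF \<open>bounded_clinear ?Y\<close> mi(1) mi(1) this, of z]
      have "X0 \<circ> (adj U \<circ> weyl (c m) z \<circ> U) = (adj U \<circ> weyl (c m) z \<circ> U) \<circ> X0"
        by (intro conjugate_commute[OF U(1)]) simp
      then have "X0 \<circ> (adj W \<circ> conj_swap (weyl (c m) z) \<circ> W) = (adj W \<circ> conj_swap (weyl (c m) z) \<circ> W) \<circ> X0"
        by (rule X0_conj)
      then have "X \<circ> weyl (d m) z = weyl (d m) z \<circ> X"
        unfolding X_def using conj_swap_generators(3)[OF mi(1)] by (intro commute_conjugate[OF W]) simp
      then show ?thesis using 1 j by simp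
    qed
    then show "X \<circ> fer j = fer j \<circ> X" "X \<circ> weyl (bos j) z = weyl (bos j) z \<circ> X" by auto
  qed
  \<comment> \<open>Since \<open>X\<close> is self-adjoint, taking adjoints yields the
    creators.\<close>
  have fer: "commutes_fermion X j" if j: "j \<in> sites - J" for j
    using fer_commute[OF j] commute_adj[OF bX _ fer_commute[OF j]] bounded_fermion[of j] j adX
    by (simp add: commutes_fermion_def)
  obtain \<kappa> \<kappa>' \<theta> where k: "klein_operator J \<kappa>" "klein_operator (sites - J) \<kappa>'" "klein_operator sites \<theta>"
    using klein_exists[OF J] klein_exists[of "sites - J"] klein_exists[of sites] by blast
  have X\<theta>: "X \<circ> \<theta> = \<theta> \<circ> X"
  proof -
    have sw: "total_swap \<circ> \<theta> = \<theta> \<circ> total_swap" "X0 \<circ> \<theta> = \<theta> \<circ> X0"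
      using swaps_commutes_parity[OF _ k(3)] swaps_total AB(3) by auto
    have "W \<circ> \<theta> = \<theta> \<circ> W"
      unfolding W_def conj_swap_def using sw(1) evolution_parity[OF k(3)] by (metis comp_assoc)
    then have "adj W \<circ> \<theta> \<circ> W = \<theta>"
      unfolding comp_assoc by (metis comp_assoc fun.map_id id_comp unitary_def W)
    then show ?thesis
      unfolding X_def using sw(2) by (intro commute_conjugate[OF W]) simp
  qed
  have "X \<circ> \<kappa>' = \<kappa>' \<circ> X" using k(2) bX fer unfolding klein_operator_def by blast
  then have X\<kappa>: "X \<circ> \<kappa> = \<kappa> \<circ> X"
    unfolding klein_product(2)[OF J k] using X\<theta> by (metis comp_assoc)
  have "X \<in> twisted_com J \<kappa>"
    unfolding twisted_com_def[OF J k(1)]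
  proof (intro CollectI conjI ballI bX)
    fix j assume j: "j \<in> sites - J"
    show "weakly_intertwines X (Inr j) (Inr j)"
      using j bos_commute bX by (simp add: weakly_intertwines_iff_weyl)
    have "X \<circ> fer j = fer j \<circ> X" "X \<circ> adj (fer j) = adj (fer j) \<circ> X"
      using fer[OF j] by (auto simp: commutes_fermion_def)
    then show "X \<circ> (fer j \<circ> \<kappa>) = (fer j \<circ> \<kappa>) \<circ> X" "X \<circ> (adj (fer j) \<circ> \<kappa>) = (adj (fer j) \<circ> \<kappa>) \<circ> X"
      using X\<kappa> by (metis comp_assoc)+
  qed
  then have "X \<in> commutant (com J)" by (rule twisted_com_mode_algebra[OF J k(1)])
  then show ?thesis
    using R' by (simp add: region_algebra_commutant X_def W_def J_def R'_def)
qed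

end

end

section \<open>Decomposition of the joint evolution into local swaps\<close>

theorem corollary4p6:
  fixes \<Lambda> :: "'s::metric_space set"
    and a b :: "'s \<Rightarrow> 'h::complex_hilbert \<Rightarrow> 'h"
    and c d :: "'s \<Rightarrow> 'h uop"
    and \<Omega> :: 'h
    and U\<^sub>A U\<^sub>B :: "'h \<Rightarrow> 'h"
    and S SS :: "'s \<Rightarrow> 'h \<Rightarrow> 'h"
    and L :: real
  assumes "finite \<Lambda>"
    and "fock_modes (\<Lambda> <+> \<Lambda>) (case_sum a b) (case_sum c d) \<Omega>"
    and "unitary U\<^sub>A" and "U\<^sub>A \<in> mode_algebra \<Lambda> a c"
    and "\<And>e. ancillary_fermion \<Lambda> a c e \<Longrightarrow> adj U\<^sub>A \<circ> e \<circ> U\<^sub>A = e"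
    and "L \<ge> 0" and "causal \<Lambda> a b c d L U\<^sub>A"
    and "substituted \<Lambda> a b c d U\<^sub>A U\<^sub>B"
    and "\<And>n. S n = swap (graph (a n)) (graph (b n))"
    and "\<And>n. SS n = swap (c n) (d n)"
  shows "(\<forall>ks \<in> permutations_of_set \<Lambda>. \<forall>ns \<in> permutations_of_set \<Lambda>.
          \<forall>ms \<in> permutations_of_set \<Lambda>. \<forall>ls \<in> permutations_of_set \<Lambda>.
            U\<^sub>A \<circ> adj U\<^sub>B =
              op_prod S ks \<circ> op_prod SS ns \<circ>
              op_prod (\<lambda>m. U\<^sub>B \<circ> S m \<circ> adj U\<^sub>B) ms \<circ> op_prod (\<lambda>l. U\<^sub>B \<circ> SS l \<circ> adj U\<^sub>B) ls)
       \<and> (\<forall>n\<in>\<Lambda>. \<forall>X \<in> {S n, SS n}.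
            unitary X \<and> X \<in> region_algebra a b c d {n})
       \<and> (\<forall>n\<in>\<Lambda>. \<forall>X \<in> {U\<^sub>B \<circ> S n \<circ> adj U\<^sub>B, U\<^sub>B \<circ> SS n \<circ> adj U\<^sub>B}.
            unitary X \<and> X \<in> region_algebra a b c d {k\<in>\<Lambda>. dist k n < L})
       \<and> (\<forall>m\<in>\<Lambda>. \<forall>n\<in>\<Lambda>.
            \<forall>X \<in> {U\<^sub>B \<circ> S m \<circ> adj U\<^sub>B, U\<^sub>B \<circ> SS m \<circ> adj U\<^sub>B}.
            \<forall>Y \<in> {U\<^sub>B \<circ> S n \<circ> adj U\<^sub>B, U\<^sub>B \<circ> SS n \<circ> adj U\<^sub>B}. X \<circ> Y = Y \<circ> X)"
proof -
  interpret doubled_lattice \<Lambda> a b c d \<Omega> by (rule doubled_lattice.intro) (rule assms)+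
  have S: "S = fermion_swap" and SS: "SS = boson_swap"
    by (simp_all add: fun_eq_iff fermion_swap_def boson_swap_def assms(9,10))
  have U\<^sub>B: "U\<^sub>B = conj_swap U\<^sub>A" by (rule substituted_conj_swap[OF assms(4,8)])
  then have uB: "unitary U\<^sub>B" unfolding conj_swap_def by (simp add: unitary_comp unitary_total_swap assms(3))
  note invB = unitaryD(2,3)[OF uB]
  have conj_comp: "(U\<^sub>B \<circ> X \<circ> adj U\<^sub>B) \<circ> (U\<^sub>B \<circ> Y \<circ> adj U\<^sub>B) = U\<^sub>B \<circ> (X \<circ> Y) \<circ> adj U\<^sub>B" for X Y
    by (simp add: fun_eq_iff invB)
  have site_swap: "\<exists>A B. swaps A B X" if "n \<in> \<Lambda>" "X \<in> {S n, SS n}" for n X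
    using that swaps_fermion swaps_boson unfolding S SS by blast
  define R where "R n = {m \<in> \<Lambda>. dist n m < L}" for n
  have loc: "adj U\<^sub>A \<circ> a m \<circ> U\<^sub>A \<in> region_algebra a b c d (R m)"
    "affiliated (conjugate U\<^sub>A (c m)) (region_algebra a b c d (R m))" if "m \<in> \<Lambda>" for m
    using assms(7) that by (auto simp: causal_def R_def)
  have R: "R m \<subseteq> \<Lambda>" for m by (auto simp: R_def)
  \<comment> \<open>A site belongs to its own region only if \<open>L\<close> is positive, which
    follows from nonemptiness of the region.\<close>
  have Rn: "n \<in> R n" if "n \<in> \<Lambda>" for n
  proof -
    have "R n \<noteq> {}" by (rule causal_region_nonempty[OF that assms(3) loc(1)[OF that] R])
    then obtain m where "dist n m < L" by (auto simp: R_def)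
    then have "0 < L" using zero_le_dist[of n m] by linarith
    then show ?thesis using that by (simp add: R_def)
  qed
  show ?thesis
  proof (intro conjI ballI)
    fix ks ns ms ls
    assume perms: "ks \<in> permutations_of_set \<Lambda>" "ns \<in> permutations_of_set \<Lambda>"
      "ms \<in> permutations_of_set \<Lambda>" "ls \<in> permutations_of_set \<Lambda>"
    have tot: "op_prod S ks \<circ> op_prod SS ns = total_swap" "op_prod S ms \<circ> op_prod SS ls = total_swap"
      unfolding S SS by (intro swaps_unique[OF swaps_prod swaps_total] perms)+
    have "op_prod S ks \<circ> op_prod SS ns \<circ> op_prod (\<lambda>m. U\<^sub>B \<circ> S m \<circ> adj U\<^sub>B) ms
        \<circ> op_prod (\<lambda>l. U\<^sub>B \<circ> SS l \<circ> adj U\<^sub>B) ls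
      = (op_prod S ks \<circ> op_prod SS ns) \<circ> (U\<^sub>B \<circ> (op_prod S ms \<circ> op_prod SS ls) \<circ> adj U\<^sub>B)"
      unfolding op_prod_conjugate[OF uB] by (simp add: fun_eq_iff invB)
    \<comment> \<open>Regrouped so that the two total swaps around \<open>U\<^sub>B\<close> undo the
      exchange of copies and return \<open>U\<^sub>A\<close>.\<close>
    also have "\<dots> = (total_swap \<circ> U\<^sub>B \<circ> total_swap) \<circ> adj U\<^sub>B" unfolding tot by (simp only: comp_assoc)
    also have "total_swap \<circ> U\<^sub>B \<circ> total_swap = U\<^sub>A"
      using conj_swap_simps(1)[of U\<^sub>A] unfolding U\<^sub>B conj_swap_def .
    finally show "U\<^sub>A \<circ> adj U\<^sub>B = op_prod S ks \<circ> op_prod SS ns \<circ>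
        op_prod (\<lambda>m. U\<^sub>B \<circ> S m \<circ> adj U\<^sub>B) ms \<circ> op_prod (\<lambda>l. U\<^sub>B \<circ> SS l \<circ> adj U\<^sub>B) ls" ..
  next
    fix n X assume n: "n \<in> \<Lambda>" and X: "X \<in> {S n, SS n}"
    show "unitary X" using site_swap[OF n X] by (auto simp: swaps_def)
    show "X \<in> region_algebra a b c d {n}"
      using swap_mem[OF n] X n by (simp add: region_algebra_commutant S SS)
  next
    fix n X assume n: "n \<in> \<Lambda>" and "X \<in> {U\<^sub>B \<circ> S n \<circ> adj U\<^sub>B, U\<^sub>B \<circ> SS n \<circ> adj U\<^sub>B}"
    then obtain X0 where X0: "X0 \<in> {S n, SS n}" "X = U\<^sub>B \<circ> X0 \<circ> adj U\<^sub>B" by blast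
    then show "unitary X"
      using site_swap[OF n X0(1)] uB by (auto simp: swaps_def intro!: unitary_comp unitary_adj)
    have "X \<in> region_algebra a b c d {k \<in> \<Lambda>. n \<in> R k}"
      unfolding X0(2) U\<^sub>B
      by (rule swap_evolution_localized[OF assms(3-5) R loc n Rn[OF n]]) (use X0 in \<open>simp_all add: S SS\<close>)
    also have "{k \<in> \<Lambda>. n \<in> R k} = {k \<in> \<Lambda>. dist k n < L}" using n by (auto simp: R_def)
    finally show "X \<in> region_algebra a b c d {k \<in> \<Lambda>. dist k n < L}" .
  next
    fix m n X Y
    assume m: "m \<in> \<Lambda>" and n: "n \<in> \<Lambda>" and "X \<in> {U\<^sub>B \<circ> S m \<circ> adj U\<^sub>B, U\<^sub>B \<circ> SS m \<circ> adj U\<^sub>B}"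
      and "Y \<in> {U\<^sub>B \<circ> S n \<circ> adj U\<^sub>B, U\<^sub>B \<circ> SS n \<circ> adj U\<^sub>B}"
    then obtain X0 Y0 where X0: "X0 \<in> {S m, SS m}" "X = U\<^sub>B \<circ> X0 \<circ> adj U\<^sub>B"
      and Y0: "Y0 \<in> {S n, SS n}" "Y = U\<^sub>B \<circ> Y0 \<circ> adj U\<^sub>B" by blast
    have "X0 \<circ> Y0 = Y0 \<circ> X0" using site_swap[OF m X0(1)] site_swap[OF n Y0(1)] swaps_commute by blast
    then show "X \<circ> Y = Y \<circ> X" unfolding X0(2) Y0(2) conj_comp by simp
  qed
qed

end
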